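(* Let $\mathcal{X}=\{(i_1,i_2)^T:i_1=1,2,\dots,\ i_2=1,2,\dots\}$ with the order $\boldsymbol{x}_1\preceq\boldsymbol{x}_2$ iff $x_{1,1}\le x_{2,1}$ and $x_{1,2}\le x_{2,2}$. Let $Z_1,Z_2,\dots,Z_n$ be i.i.d. random variables with values in $\mathcal{X}$ and probability mass function $\boldsymbol{p}$ that is bimonotone decreasing, i.e. $p_{\boldsymbol{x}_1}\ge p_{\boldsymbol{x}_2}$ whenever $\boldsymbol{x}_1\preceq\boldsymbol{x}_2$. Let $\hat{p}_{n,\boldsymbol{x}}=\frac1n\sum_{j=1}^n1\{Z_j=\boldsymbol{x}\}$ be the empirical estimator and let $$\hat{\boldsymbol{p}}_n^{*}=\underset{\xi\in\mathcal{F}^{an}}{\mathrm{argmin}}\sum_{\boldsymbol{x}\in\mathcal{X}}(\xi_{\boldsymbol{x}}-\hat{p}_{n,\boldsymbol{x}})^2,$$ where $\mathcal{F}^{an}$ is the set of bimonotone decreasing functions in $l_2=l_2(\mathcal{X})$ ($\hat{\boldsymbol{p}}_n^{*}$ is the maximum likelihood estimator of $\boldsymbol{p}$ under the bimonotone decreasing constraint). Then $$n^{1/2}(\hat{\boldsymbol{p}}_n^{*}-\boldsymbol{p})\stackrel{d}{\to}\varphi(\boldsymbol{Y}_{\boldsymbol{0},C})\quad\text{in }l_2,$$ where $\boldsymbol{Y}_{\boldsymbol{0},C}$ is a Gaussian process in $l_2$ with mean zero and covariance operator $C$ given by $\langle C\boldsymbol{e}_{\boldsymbol{i}},\boldsymbol{e}_{\boldsymbol{i}'}\rangle=p_{\boldsymbol{i}}\delta_{\boldsymbol{i},\boldsymbol{i}'}-p_{\boldsymbol{i}}p_{\boldsymbol{i}'}$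 ($\boldsymbol{e}_{\boldsymbol{i}}$ being the standard orthonormal basis of $l_2$, $\delta$ the Kronecker delta), and $\varphi:l_2\to l_2$ maps $\boldsymbol{\theta}$ to the concatenation of the separate (unweighted) isotonic regressions, with respect to $\preceq$, of the restrictions of $\boldsymbol{\theta}$ to the comparable level sets of $\boldsymbol{p}$.
   Context: Two elements $x,y$ are comparable if $x\preceq y$ or $y\preceq x$. A function $f$ on $A\subseteq\mathcal{X}$ is isotonic if $x,y\in A$, $x\preceq y$ imply $f(x)\le f(y)$. The unweighted isotonic regression of a square summable $\theta$ over $A\subseteq\mathcal{X}$ is the (unique) minimizer of $\sum_{x\in A}(f(x)-\theta(x))^2$ over square summable isotonic functions $f$ on $A$. Comparable level sets of $\boldsymbol{p}$: take the level sets $\{x\in\mathcal{X}:p_x=c\}$ and partition each of them into the connected components of the graph whose vertices are the elements of the level set and whose edges join comparable elements. These components partition $\mathcal{X}$. Operator $\varphi$: $\varphi(\boldsymbol{\theta})_x$ is the value at $x$ of the isotonic regression, over the comparable level set containing $x$, of the restriction of $\boldsymbol{\theta}$ to that set.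
   Formalization: The regressions in φ are taken decreasing with respect to ⪯ (isotonic for the reverse order), since with increasing ones the claim fails, e.g. for p = 1/2 at (1,1) and (1,2); the parenthetical remark that the estimator is the MLE is not part of the formal claim. *)

theory Defs
  imports "HOL-Probability.Probability"
begin

section \<open>The Hilbert space of square summable functions\<close>

lemma summable_on_mult_of_squares:
  fixes f g :: "'a \<Rightarrow> real"
  assumes "(\<lambda>x. (f x)\<^sup>2) summable_on A" "(\<lambda>x. (g x)\<^sup>2) summable_on A"
  shows "(\<lambda>x. f x * g x) summable_on A"
proof -
  have "(\<lambda>x. (f x)\<^sup>2 + (g x)\<^sup>2) summable_on A"
    using assms by (rule summable_on_add)
  moreover have "norm (f x * g x) \<le> (f x)\<^sup>2 + (g x)\<^sup>2" for x
  proof -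
    have "0 \<le> (\<bar>f x\<bar> - \<bar>g x\<bar>)\<^sup>2" "0 \<le> \<bar>f x\<bar> * \<bar>g x\<bar>" by simp_all
    then have "\<bar>f x\<bar> * \<bar>g x\<bar> \<le> \<bar>f x\<bar>\<^sup>2 + \<bar>g x\<bar>\<^sup>2"
      unfolding power2_diff by linarith
    then show ?thesis by (simp add: abs_mult)
  qed
  ultimately have "(\<lambda>x. norm (f x * g x)) summable_on A"
    by (rule Infinite_Sum.abs_summable_on_comparison_test')
  then show ?thesis by (rule abs_summable_summable)
qed

typedef 'a ell2 = "{f :: 'a \<Rightarrow> real. (\<lambda>x. (f x)\<^sup>2) summable_on UNIV}"
  morphisms ell2_nth Abs_ell2
  by (rule exI[of _ "\<lambda>_. 0"]) simp

setup_lifting type_definition_ell2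

lemma square_summable_ell2_nth: "(\<lambda>x. (ell2_nth f x)\<^sup>2) summable_on UNIV"
  using ell2_nth[of f] by simp

lemma summable_ell2_nth_mult: "(\<lambda>x. ell2_nth f x * ell2_nth g x) summable_on UNIV"
  by (intro summable_on_mult_of_squares square_summable_ell2_nth)

lemma square_summable_add:
  fixes f g :: "'a \<Rightarrow> real"
  assumes "(\<lambda>x. (f x)\<^sup>2) summable_on A" "(\<lambda>x. (g x)\<^sup>2) summable_on A"
  shows "(\<lambda>x. (f x + g x)\<^sup>2) summable_on A"
proof -
  have "(\<lambda>x. (f x)\<^sup>2 + (g x)\<^sup>2 + 2 * (f x * g x)) summable_on A"
    by (intro summable_on_add summable_on_cmult_right summable_on_mult_of_squares assms)
  then show ?thesis by (simp add: power2_sum mult.assoc)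
qed

lemma square_summable_scale:
  fixes f :: "'a \<Rightarrow> real"
  assumes "(\<lambda>x. (f x)\<^sup>2) summable_on A"
  shows "(\<lambda>x. (c * f x)\<^sup>2) summable_on A"
  using summable_on_cmult_right[OF assms, of "c\<^sup>2"] by (simp add: power_mult_distrib)

instantiation ell2 :: (type) real_inner
begin

lift_definition zero_ell2 :: "'a ell2" is "\<lambda>_. 0" by simp

lift_definition plus_ell2 :: "'a ell2 \<Rightarrow> 'a ell2 \<Rightarrow> 'a ell2" is "\<lambda>f g x. f x + g x"
  by (rule square_summable_add)

lift_definition uminus_ell2 :: "'a ell2 \<Rightarrow> 'a ell2" is "\<lambda>f x. - f x" by simp

lift_definition minus_ell2 :: "'a ell2 \<Rightarrow> 'a ell2 \<Rightarrow> 'a ell2" is "\<lambda>f g x. f x - g x"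
proof -
  fix f g :: "'a \<Rightarrow> real"
  assume "(\<lambda>x. (f x)\<^sup>2) summable_on UNIV" "(\<lambda>x. (g x)\<^sup>2) summable_on UNIV"
  then show "(\<lambda>x. (f x - g x)\<^sup>2) summable_on UNIV"
    using square_summable_add[of f UNIV "\<lambda>x. - g x"] by simp
qed

lift_definition scaleR_ell2 :: "real \<Rightarrow> 'a ell2 \<Rightarrow> 'a ell2" is "\<lambda>c f x. c * f x"
  by (rule square_summable_scale)

lift_definition inner_ell2 :: "'a ell2 \<Rightarrow> 'a ell2 \<Rightarrow> real" is "\<lambda>f g. \<Sum>\<^sub>\<infinity>x. f x * g x" .

definition norm_ell2 :: "'a ell2 \<Rightarrow> real" where "norm_ell2 f = sqrt (inner f f)"

definition sgn_ell2 :: "'a ell2 \<Rightarrow> 'a ell2" where "sgn_ell2 f = scaleR (inverse (norm f)) f"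

definition dist_ell2 :: "'a ell2 \<Rightarrow> 'a ell2 \<Rightarrow> real" where "dist_ell2 f g = norm (f - g)"

definition uniformity_ell2 :: "('a ell2 \<times> 'a ell2) filter" where
  "uniformity_ell2 = (INF e\<in>{0 <..}. principal {(x, y). dist x y < e})"

definition open_ell2 :: "'a ell2 set \<Rightarrow> bool" where
  "open_ell2 U \<longleftrightarrow> (\<forall>x\<in>U. \<forall>\<^sub>F (x', y) in uniformity. x' = x \<longrightarrow> y \<in> U)"

instance
proof
  fix f g h :: "'a ell2" and a b :: real
  show "f + g + h = f + (g + h)" by transfer (simp add: algebra_simps)
  show "f + g = g + f" by transfer (simp add: algebra_simps)
  show "0 + f = f" by transfer simp
  show "- f + f = 0" by transfer simp
  show "f - g = f + - g" by transfer simp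
  show "a *\<^sub>R (f + g) = a *\<^sub>R f + a *\<^sub>R g" by transfer (simp add: algebra_simps)
  show "(a + b) *\<^sub>R f = a *\<^sub>R f + b *\<^sub>R f" by transfer (simp add: algebra_simps)
  show "a *\<^sub>R b *\<^sub>R f = (a * b) *\<^sub>R f" by transfer (simp add: algebra_simps)
  show "1 *\<^sub>R f = f" by transfer simp
  show "sgn f = scaleR (inverse (norm f)) f" by (rule sgn_ell2_def)
  show "dist f g = norm (f - g)" by (rule dist_ell2_def)
  show "norm f = sqrt (inner f f)" by (rule norm_ell2_def)
  show "inner f g = inner g f" by transfer (simp add: mult.commute)
  show "inner (f + g) h = inner f h + inner g h"
    unfolding inner_ell2.rep_eq plus_ell2.rep_eq distrib_right
    by (intro infsum_add summable_ell2_nth_mult)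
  show "inner (a *\<^sub>R f) g = a * inner f g"
    unfolding inner_ell2.rep_eq scaleR_ell2.rep_eq mult.assoc
    by (intro infsum_cmult_right summable_ell2_nth_mult)
  show "0 \<le> inner f f"
    unfolding inner_ell2.rep_eq by (intro infsum_nonneg) simp
  show "inner f f = 0 \<longleftrightarrow> f = 0"
  proof
    assume "inner f f = 0"
    then have "ell2_nth f x * ell2_nth f x = 0" for x
      unfolding inner_ell2.rep_eq
      by (intro nonneg_infsum_le_0D[of "\<lambda>x. ell2_nth f x * ell2_nth f x" UNIV])
         (simp_all add: summable_ell2_nth_mult)
    then show "f = 0"
      by (simp add: ell2_nth_inject[symmetric] zero_ell2.rep_eq fun_eq_iff)
  next
    assume "f = 0"
    then show "inner f f = 0" by (simp add: inner_ell2.rep_eq zero_ell2.rep_eq)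
  qed
  show "(uniformity :: ('a ell2 \<times> 'a ell2) filter) = (INF e\<in>{0 <..}. principal {(x, y). dist x y < e})"
    by (rule uniformity_ell2_def)
next
  fix U :: "'a ell2 set"
  show "open U \<longleftrightarrow> (\<forall>x\<in>U. \<forall>\<^sub>F (x', y) in uniformity. x' = x \<longrightarrow> y \<in> U)"
    by (rule open_ell2_def)
qed

end

lift_definition ell2_basis :: "'a \<Rightarrow> 'a ell2" is "\<lambda>i x. if x = i then 1 else 0"
proof -
  fix i :: 'a
  have "(\<lambda>x. (if x = i then 1 else 0 :: real)\<^sup>2) summable_on {i}" by simp
  then show "(\<lambda>x. (if x = i then 1 else 0 :: real)\<^sup>2) summable_on UNIV"
    by (rule summable_on_cong_neutral[THEN iffD1, rotated -1]) auto
qed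

lemma square_summable_pmf: "(\<lambda>x. (pmf p x)\<^sup>2) summable_on UNIV"
proof -
  have "(\<lambda>x. norm (pmf p x)) summable_on UNIV"
    using pmf_abs_summable[of p UNIV] by (simp add: abs_summable_equivalent[symmetric])
  moreover have "norm ((pmf p x)\<^sup>2) \<le> norm (pmf p x)" for x
    by (simp add: power2_eq_square mult_left_le pmf_le_1)
  ultimately have "(\<lambda>x. norm ((pmf p x)\<^sup>2)) summable_on UNIV"
    by (rule Infinite_Sum.abs_summable_on_comparison_test)
  then show ?thesis by (rule abs_summable_summable)
qed

lift_definition ell2_of_pmf :: "'a pmf \<Rightarrow> 'a ell2" is pmf
  by (rule square_summable_pmf)


section \<open>The grid of pairs of positive integers\<close>

typedef grid = "{(i1 :: nat, i2 :: nat). 1 \<le> i1 \<and> 1 \<le> i2}"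
  morphisms coords Abs_grid
  by auto

instantiation grid :: order
begin

definition less_eq_grid :: "grid \<Rightarrow> grid \<Rightarrow> bool" where
  "x \<le> y \<longleftrightarrow> fst (coords x) \<le> fst (coords y) \<and> snd (coords x) \<le> snd (coords y)"

definition less_grid :: "grid \<Rightarrow> grid \<Rightarrow> bool" where
  "x < y \<longleftrightarrow> x \<le> y \<and> \<not> y \<le> (x :: grid)"

instance
  by standard (auto simp: less_eq_grid_def less_grid_def coords_inject[symmetric] prod_eq_iff)

end


section \<open>Isotonic regression and comparable level sets\<close>

text \<open>
  The order is a parameter, so that regression under a decreasing constraint is isotonic
  regression with respect to the reverse order. Functions on \<open>A\<close> are represented by
  functions in \<^term>\<open>extensional A\<close>, which makes the minimizer unique.
\<close>

definition isotonic_regression ::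
    "('a \<Rightarrow> 'a \<Rightarrow> bool) \<Rightarrow> 'a set \<Rightarrow> ('a \<Rightarrow> real) \<Rightarrow> 'a \<Rightarrow> real" where
  "isotonic_regression le A \<theta> =
    (THE f. is_arg_min (\<lambda>f. \<Sum>\<^sub>\<infinity>x\<in>A. (f x - \<theta> x)\<^sup>2)
      (\<lambda>f. f \<in> extensional A \<and> (\<lambda>x. (f x)\<^sup>2) summable_on A \<and> monotone_on A le (\<le>) f) f)"

definition comparable :: "('a \<Rightarrow> 'a \<Rightarrow> bool) \<Rightarrow> 'a \<Rightarrow> 'a \<Rightarrow> bool" where
  "comparable le x y \<longleftrightarrow> le x y \<or> le y x"

definition comparable_level_set ::
    "('a \<Rightarrow> 'a \<Rightarrow> bool) \<Rightarrow> ('a \<Rightarrow> real) \<Rightarrow> 'a \<Rightarrow> 'a set" where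
  "comparable_level_set le p x =
    {y. (x, y) \<in> {(u, v). p u = p x \<and> p v = p x \<and> comparable le u v}\<^sup>*}"

definition level_set_regression ::
    "('a \<Rightarrow> 'a \<Rightarrow> bool) \<Rightarrow> ('a \<Rightarrow> real) \<Rightarrow> 'a ell2 \<Rightarrow> 'a ell2" where
  "level_set_regression le p \<theta> =
    Abs_ell2 (\<lambda>x. isotonic_regression le (comparable_level_set le p x) (ell2_nth \<theta>) x)"


section \<open>The estimators\<close>

definition empirical_pmf :: "(nat \<Rightarrow> 'w \<Rightarrow> 'a) \<Rightarrow> nat \<Rightarrow> 'w \<Rightarrow> 'a \<Rightarrow> real" where
  "empirical_pmf Z n \<omega> x = (1 / real n) * (\<Sum>j=1..n. of_bool (Z j \<omega> = x))"

definition antitonic_ell2 :: "'a::order ell2 set" where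
  "antitonic_ell2 = {\<xi>. antimono (ell2_nth \<xi>)}"

definition antitonic_estimator :: "(nat \<Rightarrow> 'w \<Rightarrow> 'a::order) \<Rightarrow> nat \<Rightarrow> 'w \<Rightarrow> 'a ell2" where
  "antitonic_estimator Z n \<omega> =
    (THE \<xi>. is_arg_min (\<lambda>\<xi>. \<Sum>\<^sub>\<infinity>x. (ell2_nth \<xi> x - empirical_pmf Z n \<omega> x)\<^sup>2)
      (\<lambda>\<xi>. \<xi> \<in> antitonic_ell2) \<xi>)"


section \<open>Gaussian elements and convergence in distribution\<close>

text \<open>Point masses count as (degenerate) normal distributions.\<close>

definition gaussian_variable :: "'w measure \<Rightarrow> ('w \<Rightarrow> real) \<Rightarrow> bool" where
  "gaussian_variable M X \<longleftrightarrow> X \<in> borel_measurable M \<and>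
    ((\<exists>\<mu> \<sigma>. 0 < \<sigma> \<and> distributed M lborel X (normal_density \<mu> \<sigma>)) \<or> (\<exists>\<mu>. AE \<omega> in M. X \<omega> = \<mu>))"

definition gaussian_process ::
    "'w measure \<Rightarrow> ('w \<Rightarrow> 'h::real_inner) \<Rightarrow> 'h \<Rightarrow> ('h \<Rightarrow> 'h) \<Rightarrow> bool" where
  "gaussian_process M Y m C \<longleftrightarrow>
    prob_space M \<and> Y \<in> borel_measurable M \<and>
    (\<forall>h. gaussian_variable M (\<lambda>\<omega>. Y \<omega> \<bullet> h)) \<and>
    (\<forall>h. (\<integral>\<omega>. Y \<omega> \<bullet> h \<partial>M) = m \<bullet> h) \<and>
    (\<forall>u v. (\<integral>\<omega>. ((Y \<omega> - m) \<bullet> u) * ((Y \<omega> - m) \<bullet> v) \<partial>M) = C u \<bullet> v)"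

definition converges_in_distribution ::
    "'w measure \<Rightarrow> (nat \<Rightarrow> 'w \<Rightarrow> 'h::topological_space) \<Rightarrow> 'v measure \<Rightarrow> ('v \<Rightarrow> 'h) \<Rightarrow> bool" where
  "converges_in_distribution M X N Y \<longleftrightarrow>
    (\<forall>n. X n \<in> borel_measurable M) \<and> Y \<in> borel_measurable N \<and>
    (\<forall>f :: 'h \<Rightarrow> real. continuous_on UNIV f \<longrightarrow> bounded (range f) \<longrightarrow>
      (\<lambda>n. \<integral>\<omega>. f (X n \<omega>) \<partial>M) \<longlonglongrightarrow> (\<integral>\<omega>. f (Y \<omega>) \<partial>N))"

end

theory Submission
  imports Defs
begin

text \<open>
  Up to scaling, the estimator is the metric projection of the empirical distribution onto the closed
  convex cone \<open>F\<close> of antitonic functions, so \<open>sqrt n (estimator - p)\<close> is the difference quotient of that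
  projection at \<open>p\<close> in the direction of the empirical fluctuation \<open>sqrt n (empirical - p)\<close>. In a Hilbert
  space these quotients converge to the projection onto the tangent cone of \<open>F\<close> at \<open>p\<close>. The tangent cone
  consists of the functions that are antitonic on the level sets of \<open>p\<close>, and the projection onto it is the
  level set regression. Since the quotients are 1-Lipschitz, the convergence is uniform on compact sets,
  and the claim follows from tightness and a central limit theorem in \<open>l2\<close>. That theorem is reduced to
  the real one: trigonometric polynomials in continuous linear functionals approximate bounded
  continuous functions on compact sets.
\<close>

section \<open>Square summable functions\<close>

lemma norm_sq_ell2: "(norm f)\<^sup>2 = (\<Sum>\<^sub>\<infinity>x. (ell2_nth f x)\<^sup>2)"
  unfolding power2_norm_eq_inner by (simp add: inner_ell2.rep_eq power2_eq_square)

lemma sum_ell2_nth_sq_le_norm_sq: "finite F \<Longrightarrow> (\<Sum>x\<in>F. (ell2_nth f x)\<^sup>2) \<le> (norm f)\<^sup>2"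
  unfolding norm_sq_ell2 by (intro finite_sum_le_infsum square_summable_ell2_nth) auto

lemma ell2_eqI: "(\<And>x. ell2_nth f x = ell2_nth g x) \<Longrightarrow> f = g"
  by (simp add: ell2_nth_inject[symmetric] fun_eq_iff)

lemma abs_ell2_nth_le_norm: "\<bar>ell2_nth f x\<bar> \<le> norm f"
  using sum_ell2_nth_sq_le_norm_sq[of "{x}" f] by (simp add: abs_le_square_iff[symmetric])

lemma inner_ell2_basis: "f \<bullet> ell2_basis i = ell2_nth f i"
proof -
  have "f \<bullet> ell2_basis i = (\<Sum>\<^sub>\<infinity>x\<in>{i}. ell2_nth f x)"
    unfolding inner_ell2.rep_eq ell2_basis.rep_eq by (intro infsum_cong_neutral) auto
  then show ?thesis by simp
qed

lemma norm_ell2_basis: "norm (ell2_basis i) = 1"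
  by (simp add: norm_eq_sqrt_inner inner_ell2_basis ell2_basis.rep_eq)

lemma ell2_nth_sum: "ell2_nth (\<Sum>i\<in>F. f i) x = (\<Sum>i\<in>F. ell2_nth (f i) x)"
  by (induction F rule: infinite_finite_induct) (simp_all add: zero_ell2.rep_eq plus_ell2.rep_eq)

lift_definition ell2_restrict :: "'a set \<Rightarrow> 'a ell2 \<Rightarrow> 'a ell2" is "\<lambda>A f x. if x \<in> A then f x else 0"
proof -
  fix A and f :: "'a \<Rightarrow> real" assume square_summable: "(\<lambda>x. (f x)\<^sup>2) summable_on UNIV"
  show "(\<lambda>x. (if x \<in> A then f x else 0)\<^sup>2) summable_on UNIV"
    by (rule summable_on_comparison_test[OF square_summable]) auto
qed

lemmas ell2_nth_simps = zero_ell2.rep_eq plus_ell2.rep_eq minus_ell2.rep_eq uminus_ell2.rep_eq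
  scaleR_ell2.rep_eq ell2_nth_sum ell2_basis.rep_eq ell2_of_pmf.rep_eq ell2_restrict.rep_eq

lemma norm_sq_ell2_restrict: "(norm (ell2_restrict A f))\<^sup>2 = (\<Sum>\<^sub>\<infinity>x\<in>A. (ell2_nth f x)\<^sup>2)"
  unfolding norm_sq_ell2 by (rule infsum_cong_neutral) (auto simp: ell2_nth_simps)

lemma bounded_linear_ell2_restrict: "bounded_linear (ell2_restrict A)"
proof (rule bounded_linear_intro[of _ 1])
  fix f :: "'a ell2"
  have "(norm (ell2_restrict A f))\<^sup>2 \<le> (norm f)\<^sup>2"
    unfolding norm_sq_ell2_restrict norm_sq_ell2
    by (intro infsum_mono_neutral summable_on_subset_banach[OF square_summable_ell2_nth])
      (auto simp: ell2_nth_simps)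
  then show "norm (ell2_restrict A f) \<le> norm f * 1" by simp
qed (simp_all add: ell2_eqI ell2_nth_simps)

lemma ell2_restrict_eq_sum: "finite F \<Longrightarrow> ell2_restrict F f = (\<Sum>x\<in>F. ell2_nth f x *\<^sub>R ell2_basis x)"
  by (rule ell2_eqI) (auto simp: ell2_nth_simps if_distrib[of "\<lambda>u. _ * u"] cong: if_cong)

lemma ell2_restrict_tendsto: "((\<lambda>F. ell2_restrict F f) \<longlongrightarrow> f) (finite_subsets_at_top UNIV)"
proof -
  have split: "(norm (ell2_restrict F f - f))\<^sup>2 = (norm f)\<^sup>2 - (\<Sum>x\<in>F. (ell2_nth f x)\<^sup>2)" if "finite F" for F
  proof -
    have "ell2_restrict F f - f = - ell2_restrict (- F) f"
      by (rule ell2_eqI) (simp add: ell2_nth_simps)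
    then have "(norm (ell2_restrict F f - f))\<^sup>2 = (\<Sum>\<^sub>\<infinity>x\<in>UNIV - F. (ell2_nth f x)\<^sup>2)"
      by (simp add: norm_sq_ell2_restrict Compl_eq_Diff_UNIV)
    also have "\<dots> = (norm f)\<^sup>2 - (\<Sum>x\<in>F. (ell2_nth f x)\<^sup>2)"
      using that by (simp add: infsum_Diff square_summable_ell2_nth norm_sq_ell2)
    finally show ?thesis .
  qed
  have "((\<lambda>x. (ell2_nth f x)\<^sup>2) has_sum (norm f)\<^sup>2) UNIV"
    unfolding norm_sq_ell2 by (intro has_sum_infsum square_summable_ell2_nth)
  then have "((\<lambda>F. sqrt ((norm f)\<^sup>2 - (\<Sum>x\<in>F. (ell2_nth f x)\<^sup>2))) \<longlongrightarrow> sqrt ((norm f)\<^sup>2 - (norm f)\<^sup>2))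
      (finite_subsets_at_top UNIV)"
    unfolding has_sum_def by (intro tendsto_intros)
  then have "((\<lambda>F. norm (ell2_restrict F f - f)) \<longlongrightarrow> sqrt ((norm f)\<^sup>2 - (norm f)\<^sup>2)) (finite_subsets_at_top UNIV)"
    by (rule Lim_transform_eventually)
      (rule eventually_finite_subsets_at_top_weakI, simp add: split[symmetric])
  then show ?thesis by (simp add: tendsto_norm_zero_iff LIM_zero_iff)
qed

lemma ell2_restrict_approx:
  "0 < e \<Longrightarrow> \<exists>F. finite F \<and> (\<forall>G. finite G \<and> F \<subseteq> G \<longrightarrow> dist (ell2_restrict G f) f < e)"
  using tendstoD[OF ell2_restrict_tendsto, of e f] by (auto simp: eventually_finite_subsets_at_top)

lemma finite_ell2_superlevel:
  assumes "0 < d" shows "finite {x. d \<le> \<bar>ell2_nth f x\<bar>}"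
proof -
  obtain F where F_approx: "finite F" "\<And>G. finite G \<Longrightarrow> F \<subseteq> G \<Longrightarrow> dist (ell2_restrict G f) f < d"
    using ell2_restrict_approx[OF assms, of f] by metis
  have "x \<in> F" if "d \<le> \<bar>ell2_nth f x\<bar>" for x
  proof (rule ccontr)
    assume "x \<notin> F"
    then have "ell2_nth (ell2_restrict F f - f) x = - ell2_nth f x" by (simp add: ell2_nth_simps)
    then have "\<bar>ell2_nth f x\<bar> \<le> dist (ell2_restrict F f) f"
      using abs_ell2_nth_le_norm[of "ell2_restrict F f - f" x] by (simp add: dist_norm)
    then show False using that F_approx(2)[OF F_approx(1) order_refl] by linarith
  qed
  then show ?thesis by (intro finite_subset[OF _ F_approx(1)]) blast
qed

lemma bounded_linear_eq_on_ell2_basis: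
  assumes f_linear: "bounded_linear f" and g_linear: "bounded_linear g"
    and eq_basis: "\<And>i. f (ell2_basis i) = g (ell2_basis i)"
  shows "f u = g u"
proof (rule tendsto_unique)
  show "((\<lambda>F. f (ell2_restrict F u)) \<longlongrightarrow> f u) (finite_subsets_at_top UNIV)"
    by (rule bounded_linear.tendsto[OF f_linear ell2_restrict_tendsto])
  have "f (ell2_restrict F u) = g (ell2_restrict F u)" if "finite F" for F
    unfolding ell2_restrict_eq_sum[OF that] linear_sum[OF bounded_linear.linear[OF f_linear]]
      linear_sum[OF bounded_linear.linear[OF g_linear]]
    by (simp add: eq_basis linear_scale bounded_linear.linear f_linear g_linear)
  then have "\<forall>\<^sub>F F in finite_subsets_at_top UNIV. g (ell2_restrict F u) = f (ell2_restrict F u)"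
    by (intro eventually_finite_subsets_at_top_weakI) simp
  then show "((\<lambda>F. f (ell2_restrict F u)) \<longlongrightarrow> g u) (finite_subsets_at_top UNIV)"
    by (rule Lim_transform_eventually[OF bounded_linear.tendsto[OF g_linear ell2_restrict_tendsto]])
qed simp

lemma bilinear_eq_on_ell2_basis:
  assumes "\<And>v. bounded_linear (\<lambda>u. b u v)" "\<And>u. bounded_linear (b u)"
    and "\<And>v. bounded_linear (\<lambda>u. c u v)" "\<And>u. bounded_linear (c u)"
    and eq_basis: "\<And>i j. b (ell2_basis i) (ell2_basis j) = c (ell2_basis i) (ell2_basis j)"
  shows "b u v = c u v"
proof -
  have "b (ell2_basis i) v = c (ell2_basis i) v" for i
    using assms(2,4) eq_basis by (rule bounded_linear_eq_on_ell2_basis)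
  with assms(1,3) show ?thesis by (rule bounded_linear_eq_on_ell2_basis)
qed

subsection \<open>Completeness and separability\<close>

lemma ell2_pointwise_limit:
  assumes lim: "\<And>x. (\<lambda>n. ell2_nth (X n) x) \<longlonglongrightarrow> a x" and bound: "\<forall>\<^sub>F n in sequentially. norm (X n) \<le> B"
  obtains f where "ell2_nth f = a" "norm f \<le> B"
proof
  have "0 \<le> B" using eventually_happens[OF bound] by (auto intro: order_trans[OF norm_ge_zero])
  have sums: "(\<Sum>x\<in>F. (a x)\<^sup>2) \<le> B\<^sup>2" if "finite F" for F
  proof (rule tendsto_upperbound)
    show "(\<lambda>n. \<Sum>x\<in>F. (ell2_nth (X n) x)\<^sup>2) \<longlonglongrightarrow> (\<Sum>x\<in>F. (a x)\<^sup>2)"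
      by (intro tendsto_intros lim)
    show "\<forall>\<^sub>F n in sequentially. (\<Sum>x\<in>F. (ell2_nth (X n) x)\<^sup>2) \<le> B\<^sup>2"
      using bound
      by eventually_elim (intro order_trans[OF sum_ell2_nth_sq_le_norm_sq[OF that]] power_mono norm_ge_zero)
  qed simp
  have summable: "(\<lambda>x. (a x)\<^sup>2) summable_on UNIV"
    using sums by (intro nonneg_bdd_above_summable_on bdd_aboveI[of _ "B\<^sup>2"]) auto
  then show nth: "ell2_nth (Abs_ell2 a) = a" by (simp add: Abs_ell2_inverse)
  have "(norm (Abs_ell2 a))\<^sup>2 \<le> B\<^sup>2"
    unfolding norm_sq_ell2 nth by (rule infsum_le_finite_sums[OF summable sums])
  then show "norm (Abs_ell2 a) \<le> B" using \<open>0 \<le> B\<close> by (rule power2_le_imp_le)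
qed

instance ell2 :: (type) banach
proof
  fix X :: "nat \<Rightarrow> 'a ell2" assume Cauchy_X: "Cauchy X"
  have "convergent (\<lambda>n. ell2_nth (X n) x)" for x
    unfolding inner_ell2_basis[symmetric]
    by (intro Cauchy_convergent bounded_linear.Cauchy[OF bounded_linear_inner_left Cauchy_X])
  then obtain a where pointwise_lim: "\<And>x. (\<lambda>n. ell2_nth (X n) x) \<longlonglongrightarrow> a x" unfolding convergent_def by metis
  obtain B where "\<And>n. norm (X n) \<le> B"
    using cauchy_imp_bounded[OF Cauchy_X] unfolding bounded_iff by blast
  then have "\<forall>\<^sub>F n in sequentially. norm (X n) \<le> B" by simp
  then obtain f where f_nth: "ell2_nth f = a" by (rule ell2_pointwise_limit[OF pointwise_lim])
  have "X \<longlonglongrightarrow> f"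
  proof (rule metric_LIMSEQ_I)
    fix e :: real assume "0 < e"
    then obtain N where N_Cauchy: "\<And>m n. N \<le> m \<Longrightarrow> N \<le> n \<Longrightarrow> dist (X m) (X n) < e / 2"
      using metric_CauchyD[OF Cauchy_X, of "e / 2"] by auto
    have "dist (X m) f < e" if "N \<le> m" for m
    proof -
      have "(\<lambda>n. ell2_nth (X m - X n) x) \<longlonglongrightarrow> ell2_nth (X m - f) x" for x
        unfolding minus_ell2.rep_eq f_nth by (intro tendsto_intros pointwise_lim)
      moreover have "\<forall>\<^sub>F n in sequentially. norm (X m - X n) \<le> e / 2"
        using N_Cauchy[OF that] by (auto simp: eventually_sequentially dist_norm intro: less_imp_le)
      ultimately obtain g where "ell2_nth g = ell2_nth (X m - f)" "norm g \<le> e / 2"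
        by (rule ell2_pointwise_limit)
      then show ?thesis using \<open>0 < e\<close> by (simp add: ell2_nth_inject dist_norm)
    qed
    then show "\<exists>N. \<forall>n\<ge>N. dist (X n) f < e" by blast
  qed
  then show "convergent X" by (rule convergentI)
qed

lemma topological_basis_balls_dense:
  fixes D :: "'a::metric_space set"
  assumes dense: "closure D = UNIV"
  shows "topological_basis ((\<lambda>(x, n). ball x (1 / real (Suc n))) ` (D \<times> UNIV))"
proof (rule topological_basisI)
  fix U and x :: 'a assume "open U" "x \<in> U"
  then obtain e where ball_e: "0 < e" "ball x e \<subseteq> U" by (meson openE)
  obtain n where n_small: "1 / real (Suc n) < e / 2" using nat_approx_posE[of "e / 2"] ball_e(1) by auto
  have "x \<in> closure D" using dense by simp
  then obtain y where y_near: "y \<in> D" "dist y x < 1 / real (Suc n)"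
    unfolding closure_approachable by (metis of_nat_0_less_iff zero_less_Suc zero_less_divide_1_iff)
  have "ball y (1 / real (Suc n)) \<subseteq> ball x e"
  proof
    fix z assume "z \<in> ball y (1 / real (Suc n))"
    then have "dist z y < e / 2" "dist x y < e / 2"
      using n_small y_near(2) by (auto simp: dist_commute simp del: of_nat_Suc)
    then show "z \<in> ball x e" by (simp add: dist_commute dist_triangle_half_l)
  qed
  with ball_e(2) have "ball y (1 / real (Suc n)) \<subseteq> U" by (rule subset_trans[rotated])
  moreover have "x \<in> ball y (1 / real (Suc n))" using y_near(2) by (simp only: mem_ball)
  moreover have "ball y (1 / real (Suc n)) \<in> (\<lambda>(x, n). ball x (1 / real (Suc n))) ` (D \<times> UNIV)"
    using y_near(1) by (intro image_eqI[of _ _ "(y, n)"]) simp_all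
  ultimately show "\<exists>B\<in>(\<lambda>(x, n). ball x (1 / real (Suc n))) ` (D \<times> UNIV). x \<in> B \<and> B \<subseteq> U"
    by (intro bexI[of _ "ball y (1 / real (Suc n))"] conjI)
qed auto

lemma ell2_countable_dense_set: "\<exists>D :: 'a::countable ell2 set. countable D \<and> closure D = UNIV"
proof (intro exI conjI)
  define c :: "('a \<times> rat) list \<Rightarrow> 'a ell2" where "c l = (\<Sum>(x, q)\<leftarrow>l. of_rat q *\<^sub>R ell2_basis x)" for l
  show "countable (range c)" by simp
  have "\<exists>l. dist (c l) f < e" if e_pos: "0 < e" for f e
  proof -
    obtain F where F_approx: "finite F" "\<And>G. finite G \<Longrightarrow> F \<subseteq> G \<Longrightarrow> dist (ell2_restrict G f) f < e / 2"
      using ell2_restrict_approx[OF half_gt_zero[OF e_pos], of f] by metis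
    obtain xs where xs_set: "set xs = F" "distinct xs" using F_approx(1) finite_distinct_list by blast
    define d where "d = e / (2 * (real (card F) + 1))"
    have d_small: "0 < d" "real (card F) * d \<le> e / 2" using e_pos by (auto simp: d_def field_simps)
    have "\<exists>q. \<bar>of_rat q - r\<bar> < d" for r
    proof -
      obtain q where "r - d < of_rat q" "of_rat q < r" using of_rat_dense[of "r - d" r] d_small(1) by auto
      then show ?thesis by (intro exI[of _ q]) linarith
    qed
    then obtain q where q_close: "\<And>r. \<bar>of_rat (q r) - r\<bar> < d" by metis
    have "c (map (\<lambda>x. (x, q (ell2_nth f x))) xs) = (\<Sum>x\<in>F. of_rat (q (ell2_nth f x)) *\<^sub>R ell2_basis x)"
      using xs_set by (simp add: c_def comp_def sum_list_distinct_conv_sum_set)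
    then have "c (map (\<lambda>x. (x, q (ell2_nth f x))) xs) - ell2_restrict F f
        = (\<Sum>x\<in>F. (of_rat (q (ell2_nth f x)) - ell2_nth f x) *\<^sub>R ell2_basis x)"
      using F_approx(1) by (simp add: ell2_restrict_eq_sum sum_subtractf scaleR_diff_left)
    also have "norm \<dots> \<le> real (card F) * d"
      using q_close by (intro sum_norm_bound) (simp add: norm_ell2_basis less_imp_le)
    finally have "dist (c (map (\<lambda>x. (x, q (ell2_nth f x))) xs)) (ell2_restrict F f) \<le> e / 2"
      using d_small(2) by (simp add: dist_norm)
    then have "dist (c (map (\<lambda>x. (x, q (ell2_nth f x))) xs)) f < e"
      using F_approx(2)[OF F_approx(1) order_refl] dist_triangle[of _ f "ell2_restrict F f"]
      by (smt (verit) field_sum_of_halves)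
    then show ?thesis ..
  qed
  then show "closure (range c) = UNIV" by (auto simp: closure_approachable)
qed

instance ell2 :: (countable) polish_space
proof
  obtain D :: "'a ell2 set" where D_dense: "countable D" "closure D = UNIV"
    using ell2_countable_dense_set by blast
  have "countable ((\<lambda>(x, n). ball x (1 / real (Suc n))) ` (D \<times> UNIV))" using D_dense(1) by simp
  then show "\<exists>B :: 'a ell2 set set. countable B \<and> open = generate_topology B"
    using topological_basis_imp_subbasis[OF topological_basis_balls_dense[OF D_dense(2)]] by blast
qed

section \<open>Projection onto closed convex sets of a Hilbert space\<close>

definition metric_projection :: "'h::real_inner set \<Rightarrow> 'h \<Rightarrow> 'h" where
  "metric_projection S a = (SOME z. z \<in> S \<and> (\<forall>w\<in>S. dist a z \<le> dist a w))"

lemma dist_sq_convex_le: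
  fixes a z w :: "'h::real_inner"
  assumes "convex S" "z \<in> S" "w \<in> S" "0 \<le> d" "\<And>v. v \<in> S \<Longrightarrow> d \<le> dist a v"
  shows "(dist z w)\<^sup>2 \<le> 2 * (dist a z)\<^sup>2 + 2 * (dist a w)\<^sup>2 - 4 * d\<^sup>2"
proof -
  define m where "m = (1/2) *\<^sub>R z + (1/2) *\<^sub>R w"
  have "m \<in> S" unfolding m_def using assms by (intro convexD) auto
  then have "d\<^sup>2 \<le> (dist a m)\<^sup>2" using assms by (intro power_mono) auto
  moreover have "(dist z w)\<^sup>2 = 2 * (dist a z)\<^sup>2 + 2 * (dist a w)\<^sup>2 - 4 * (dist a m)\<^sup>2"
    unfolding m_def dist_norm power2_norm_eq_inner
    by (simp add: inner_diff_left inner_diff_right inner_add_left inner_add_right inner_commute algebra_simps)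
  ultimately show ?thesis by linarith
qed

lemma Cauchy_minimizing_sequence:
  fixes a :: "'h::real_inner"
  assumes "convex S" "\<And>n. z n \<in> S" "\<And>v. v \<in> S \<Longrightarrow> d \<le> dist a v" "0 \<le> d"
    and lim: "(\<lambda>n. dist a (z n)) \<longlonglongrightarrow> d"
  shows "Cauchy z"
proof (rule metric_CauchyI)
  fix e :: real assume e_pos: "0 < e"
  have "(\<lambda>n. 4 * (dist a (z n))\<^sup>2) \<longlonglongrightarrow> 4 * d\<^sup>2" by (intro tendsto_intros lim)
  then have "\<forall>\<^sub>F n in sequentially. 4 * (dist a (z n))\<^sup>2 < 4 * d\<^sup>2 + e\<^sup>2"
    by (rule order_tendstoD) (use e_pos in simp)
  then obtain N where N_close: "\<And>n. N \<le> n \<Longrightarrow> 4 * (dist a (z n))\<^sup>2 < 4 * d\<^sup>2 + e\<^sup>2"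
    by (auto simp: eventually_sequentially)
  have "dist (z m) (z n) < e" if "N \<le> m" "N \<le> n" for m n
  proof -
    have "(dist (z m) (z n))\<^sup>2 \<le> 2 * (dist a (z m))\<^sup>2 + 2 * (dist a (z n))\<^sup>2 - 4 * d\<^sup>2"
      using assms by (intro dist_sq_convex_le[of S])
    also have "\<dots> < e\<^sup>2" using N_close[OF that(1)] N_close[OF that(2)] by linarith
    finally show ?thesis by (rule power2_less_imp_less) (use e_pos in simp)
  qed
  then show "\<exists>N. \<forall>m\<ge>N. \<forall>n\<ge>N. dist (z m) (z n) < e" by blast
qed

lemma metric_projection_exists:
  fixes a :: "'h::{real_inner, complete_space}"
  assumes "closed S" "convex S" "S \<noteq> {}"
  shows "\<exists>z\<in>S. \<forall>w\<in>S. dist a z \<le> dist a w"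
proof -
  define d where "d = infdist a S"
  have d_le: "d \<le> dist a w" if "w \<in> S" for w unfolding d_def using that by (rule infdist_le)
  have "\<exists>z\<in>S. dist a z < d + 1 / real (Suc n)" for n
  proof -
    have "(INF w\<in>S. dist a w) < d + 1 / real (Suc n)" using assms(3) by (simp add: d_def infdist_notempty)
    then show ?thesis by (subst (asm) cINF_less_iff[OF assms(3)]) auto
  qed
  then obtain z where z_minimizing: "\<And>n. z n \<in> S" "\<And>n. dist a (z n) < d + 1 / real (Suc n)" by metis
  have lim: "(\<lambda>n. dist a (z n)) \<longlonglongrightarrow> d"
  proof (rule real_tendsto_sandwich[OF _ _ tendsto_const])
    show "(\<lambda>n. d + 1 / real (Suc n)) \<longlonglongrightarrow> d"
      using tendsto_add[OF tendsto_const[of d] LIMSEQ_inverse_real_of_nat] by (simp add: inverse_eq_divide)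
  qed (use d_le[OF z_minimizing(1)] less_imp_le[OF z_minimizing(2)] in \<open>simp_all del: of_nat_Suc\<close>)
  have "Cauchy z"
    using assms(2) z_minimizing(1) d_le infdist_nonneg lim
    unfolding d_def by (rule Cauchy_minimizing_sequence)
  then obtain l where z_lim: "z \<longlonglongrightarrow> l" by (auto simp: Cauchy_convergent_iff convergent_def)
  have "l \<in> S" using assms(1) z_minimizing(1) z_lim by (auto simp: closed_sequential_limits)
  moreover have "dist a l = d" by (rule LIMSEQ_unique[OF _ lim]) (intro tendsto_intros z_lim)
  ultimately show ?thesis using d_le by auto
qed

context
  fixes S :: "'h::{real_inner, complete_space} set"
  assumes S_closed_convex: "closed S" "convex S" "S \<noteq> {}"
begin

lemma metric_projection_in: "metric_projection S a \<in> S"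
  and metric_projection_le: "w \<in> S \<Longrightarrow> dist a (metric_projection S a) \<le> dist a w"
  using someI_ex[of "\<lambda>z. z \<in> S \<and> (\<forall>w\<in>S. dist a z \<le> dist a w)"] metric_projection_exists[OF S_closed_convex, of a]
  unfolding metric_projection_def by blast+

lemma metric_projection_eqI:
  assumes "w \<in> S" "\<And>v. v \<in> S \<Longrightarrow> dist a w \<le> dist a v"
  shows "w = metric_projection S a"
  by (rule any_closest_point_unique[OF S_closed_convex(2,1) assms(1) metric_projection_in, of a])
    (simp_all add: assms(2) metric_projection_le)

lemma is_arg_min_norm_sq_iff:
  "is_arg_min (\<lambda>z. (norm (z - a))\<^sup>2) (\<lambda>z. z \<in> S) w \<longleftrightarrow> w = metric_projection S a"
proof -
  have "(norm (z - a))\<^sup>2 < (norm (w - a))\<^sup>2 \<longleftrightarrow> dist a z < dist a w" for z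
    unfolding dist_norm norm_minus_commute[of a] by (auto intro: power2_less_imp_less power_strict_mono)
  then have "is_arg_min (\<lambda>z. (norm (z - a))\<^sup>2) (\<lambda>z. z \<in> S) w \<longleftrightarrow> w \<in> S \<and> (\<forall>v\<in>S. dist a w \<le> dist a v)"
    by (auto simp: is_arg_min_def not_less)
  also have "\<dots> \<longleftrightarrow> w = metric_projection S a"
    using metric_projection_eqI[of w a] metric_projection_in[of a] metric_projection_le[of _ a] by auto
  finally show ?thesis .
qed

lemma metric_projection_dot: "w \<in> S \<Longrightarrow> (a - metric_projection S a) \<bullet> (w - metric_projection S a) \<le> 0"
  using metric_projection_le
  by (intro any_closest_point_dot[OF S_closed_convex(2,1) metric_projection_in]) auto

lemma metric_projection_pythagoras:
  assumes "w \<in> S"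
  shows "(dist w (metric_projection S a))\<^sup>2 \<le> (dist a w)\<^sup>2 - (dist a (metric_projection S a))\<^sup>2"
  using metric_projection_dot[OF assms, of a] unfolding dist_norm power2_norm_eq_inner
  by (simp add: inner_diff_left inner_diff_right inner_commute algebra_simps)

lemma metric_projection_nonexpansive: "dist (metric_projection S a) (metric_projection S b) \<le> dist a b"
proof -
  define u where "u = metric_projection S a - metric_projection S b"
  have "u \<bullet> u \<le> (a - b) \<bullet> u"
    using metric_projection_dot[OF metric_projection_in, of a b]
      metric_projection_dot[OF metric_projection_in, of b a]
    unfolding u_def by (simp add: inner_diff_left inner_diff_right inner_commute algebra_simps)
  also have "\<dots> \<le> norm (a - b) * norm u" by (rule norm_cauchy_schwarz)
  finally have "norm u * norm u \<le> norm (a - b) * norm u"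
    by (simp add: power2_norm_eq_inner[symmetric] power2_eq_square)
  then show ?thesis
    unfolding dist_norm u_def[symmetric] by (cases "norm u = 0") (auto simp: mult_le_cancel_right)
qed

lemma continuous_on_metric_projection: "continuous_on A (metric_projection S)"
proof (rule lipschitz_on_continuous_on)
  show "1-lipschitz_on A (metric_projection S)"
    by (rule lipschitz_onI) (simp_all add: metric_projection_nonexpansive)
qed

end

subsection \<open>Directional derivative of the projection\<close>

definition feasible_directions :: "'h::real_vector set \<Rightarrow> 'h \<Rightarrow> 'h set" where
  "feasible_directions S p = {\<eta>. \<exists>t>0. p + t *\<^sub>R \<eta> \<in> S}"

definition tangent_cone :: "'h::real_normed_vector set \<Rightarrow> 'h \<Rightarrow> 'h set" where
  "tangent_cone S p = closure (feasible_directions S p)"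

definition projection_quotient :: "'h::real_inner set \<Rightarrow> 'h \<Rightarrow> real \<Rightarrow> 'h \<Rightarrow> 'h" where
  "projection_quotient S p t \<theta> = (metric_projection S (p + t *\<^sub>R \<theta>) - p) /\<^sub>R t"

lemma eventually_feasible:
  assumes "convex S" "p \<in> S" "\<eta> \<in> feasible_directions S p"
  shows "\<forall>\<^sub>F t in at_right 0. p + t *\<^sub>R \<eta> \<in> S"
proof -
  obtain s where s_feasible: "0 < s" "p + s *\<^sub>R \<eta> \<in> S"
    using assms(3) by (auto simp: feasible_directions_def)
  have "p + t *\<^sub>R \<eta> \<in> S" if "0 < t" "t < s" for t
  proof -
    have "(1 - t / s) *\<^sub>R p + (t / s) *\<^sub>R (p + s *\<^sub>R \<eta>) \<in> S"
      using assms(1,2) s_feasible that by (intro convexD) auto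
    then show ?thesis using s_feasible(1) by (simp add: algebra_simps)
  qed
  then show ?thesis using s_feasible(1) by (auto simp: eventually_at_right_field)
qed

lemma convex_feasible_directions:
  assumes "convex S" "p \<in> S"
  shows "convex (feasible_directions S p)"
proof (rule convexI)
  fix \<eta> \<zeta> :: 'a and u v :: real
  assume "\<eta> \<in> feasible_directions S p" "\<zeta> \<in> feasible_directions S p"
    and convex_comb: "0 \<le> u" "0 \<le> v" "u + v = 1"
  then have "\<forall>\<^sub>F t in at_right 0. 0 < t \<and> p + t *\<^sub>R \<eta> \<in> S \<and> p + t *\<^sub>R \<zeta> \<in> S"
    using assms by (intro eventually_conj eventually_feasible eventually_at_right_less)
  then obtain t where t_feasible: "0 < t" "p + t *\<^sub>R \<eta> \<in> S" "p + t *\<^sub>R \<zeta> \<in> S"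
    using eventually_happens'[OF trivial_limit_at_right_real] by blast
  have "u *\<^sub>R (p + t *\<^sub>R \<eta>) + v *\<^sub>R (p + t *\<^sub>R \<zeta>) \<in> S"
    using assms(1) t_feasible(2,3) convex_comb by (rule convexD)
  also have "u *\<^sub>R (p + t *\<^sub>R \<eta>) + v *\<^sub>R (p + t *\<^sub>R \<zeta>)
      = (u + v) *\<^sub>R p + t *\<^sub>R (u *\<^sub>R \<eta> + v *\<^sub>R \<zeta>)"
    by (simp add: algebra_simps)
  finally show "u *\<^sub>R \<eta> + v *\<^sub>R \<zeta> \<in> feasible_directions S p"
    using t_feasible(1) convex_comb(3) by (auto simp: feasible_directions_def)
qed

lemma tangent_cone_closed_convex:
  assumes "convex S" "p \<in> S"
  shows "closed (tangent_cone S p)" "convex (tangent_cone S p)" "tangent_cone S p \<noteq> {}"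
proof -
  have "0 \<in> feasible_directions S p"
    using assms(2) by (auto simp: feasible_directions_def intro: exI[of _ 1])
  then show "tangent_cone S p \<noteq> {}" unfolding tangent_cone_def using closure_subset by blast
qed (simp_all add: tangent_cone_def convex_closure convex_feasible_directions assms)

context
  fixes S :: "'h::{real_inner, complete_space} set" and p :: 'h
  assumes S_closed_convex: "closed S" "convex S" and p_in_S: "p \<in> S"
begin

private lemma nonempty: "S \<noteq> {}" using p_in_S by blast

private lemma dist_add_scaleR: "0 \<le> t \<Longrightarrow> dist (p + t *\<^sub>R \<theta>) (p + t *\<^sub>R \<theta>') = t * dist \<theta> \<theta>'"
  by (simp add: dist_norm scaleR_diff_right[symmetric])

lemma projection_quotient_nonexpansive:
  assumes "0 \<le> t"
  shows "dist (projection_quotient S p t \<theta>) (projection_quotient S p t \<theta>') \<le> dist \<theta> \<theta>'"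
proof (cases "t = 0")
  case False
  have "dist (projection_quotient S p t \<theta>) (projection_quotient S p t \<theta>')
      = inverse t * dist (metric_projection S (p + t *\<^sub>R \<theta>)) (metric_projection S (p + t *\<^sub>R \<theta>'))"
    using assms by (simp add: projection_quotient_def dist_norm scaleR_diff_right[symmetric])
  also have "\<dots> \<le> inverse t * dist (p + t *\<^sub>R \<theta>) (p + t *\<^sub>R \<theta>')"
    using assms by (intro mult_left_mono metric_projection_nonexpansive S_closed_convex nonempty) simp
  also have "\<dots> = dist \<theta> \<theta>'" unfolding dist_add_scaleR[OF assms] using False by simp
  finally show ?thesis .
qed (simp add: projection_quotient_def)

lemma projection_quotient_in_feasible_directions:
  assumes "0 < t"
  shows "projection_quotient S p t \<theta> \<in> feasible_directions S p"
  using assms metric_projection_in[OF S_closed_convex nonempty]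
  by (auto simp: feasible_directions_def projection_quotient_def intro!: exI[of _ t])

lemma projection_quotient_le:
  assumes "0 < t" "p + t *\<^sub>R \<eta> \<in> S"
  shows "dist \<theta> (projection_quotient S p t \<theta>) \<le> dist \<theta> \<eta>"
proof -
  have "t * dist \<theta> (projection_quotient S p t \<theta>)
      = dist (p + t *\<^sub>R \<theta>) (p + t *\<^sub>R projection_quotient S p t \<theta>)"
    using assms(1) by (simp only: dist_add_scaleR less_imp_le)
  also have "\<dots> = dist (p + t *\<^sub>R \<theta>) (metric_projection S (p + t *\<^sub>R \<theta>))"
    using assms(1) by (simp add: projection_quotient_def)
  also have "\<dots> \<le> dist (p + t *\<^sub>R \<theta>) (p + t *\<^sub>R \<eta>)"
    using assms(2) by (rule metric_projection_le[OF S_closed_convex nonempty])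
  also have "\<dots> = t * dist \<theta> \<eta>" using assms(1) by (simp only: dist_add_scaleR less_imp_le)
  finally show ?thesis using assms(1) by simp
qed

theorem projection_quotient_tendsto:
  "((\<lambda>t. projection_quotient S p t \<theta>) \<longlongrightarrow> metric_projection (tangent_cone S p) \<theta>) (at_right 0)"
proof (rule tendstoI)
  fix e :: real assume e_pos: "0 < e"
  note T_closed_convex = tangent_cone_closed_convex[OF S_closed_convex(2) p_in_S]
  define z where "z = metric_projection (tangent_cone S p) \<theta>"
  have "z \<in> closure (feasible_directions S p)"
    using metric_projection_in[OF T_closed_convex] by (simp add: z_def tangent_cone_def)
  then obtain \<eta> where \<eta>_feasible: "\<And>k. \<eta> k \<in> feasible_directions S p" "\<eta> \<longlonglongrightarrow> z"
    unfolding closure_sequential by blast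
  have "(\<lambda>k. (dist \<theta> (\<eta> k))\<^sup>2) \<longlonglongrightarrow> (dist \<theta> z)\<^sup>2" by (intro tendsto_intros \<eta>_feasible)
  then have "\<forall>\<^sub>F k in sequentially. (dist \<theta> (\<eta> k))\<^sup>2 < (dist \<theta> z)\<^sup>2 + e\<^sup>2"
    by (rule order_tendstoD) (use e_pos in simp)
  then obtain k where k_close: "(dist \<theta> (\<eta> k))\<^sup>2 < (dist \<theta> z)\<^sup>2 + e\<^sup>2"
    using eventually_happens'[OF sequentially_bot] by blast
  have "\<forall>\<^sub>F t in at_right 0. 0 < t \<and> p + t *\<^sub>R \<eta> k \<in> S"
    by (intro eventually_conj eventually_feasible S_closed_convex p_in_S \<eta>_feasible eventually_at_right_less)
  then show "\<forall>\<^sub>F t in at_right 0. dist (projection_quotient S p t \<theta>) z < e"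
  proof eventually_elim
    case (elim t)
    define q where "q = projection_quotient S p t \<theta>"
    have "q \<in> tangent_cone S p"
      using projection_quotient_in_feasible_directions elim closure_subset
      by (auto simp: q_def tangent_cone_def)
    then have "(dist q z)\<^sup>2 \<le> (dist \<theta> q)\<^sup>2 - (dist \<theta> z)\<^sup>2"
      unfolding z_def by (rule metric_projection_pythagoras[OF T_closed_convex])
    also have "(dist \<theta> q)\<^sup>2 \<le> (dist \<theta> (\<eta> k))\<^sup>2"
      unfolding q_def using elim by (intro power_mono projection_quotient_le) auto
    finally have "(dist q z)\<^sup>2 < e\<^sup>2" using k_close by simp
    then show "dist q z < e" by (rule power2_less_imp_less) (use e_pos in simp)
  qed
qed

end

section \<open>Tightness and convergence in distribution\<close>

definition uniformly_tight :: "'w measure \<Rightarrow> ('i \<Rightarrow> 'w \<Rightarrow> 'h::topological_space) \<Rightarrow> bool" where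
  "uniformly_tight M X \<longleftrightarrow> (\<forall>e>0. \<exists>K. compact K \<and> (\<forall>i. measure M {\<omega>\<in>space M. X i \<omega> \<notin> K} \<le> e))"

lemma uniformly_tightD:
  "uniformly_tight M X \<Longrightarrow> 0 < e \<Longrightarrow> \<exists>K. compact K \<and> (\<forall>i. measure M {\<omega>\<in>space M. X i \<omega> \<notin> K} \<le> e)"
  by (simp add: uniformly_tight_def)

lemma sets_notin_closed:
  assumes "X \<in> borel_measurable M" "closed K"
  shows "{\<omega>\<in>space M. X \<omega> \<notin> K} \<in> sets M"
proof -
  have "X -` (- K) \<inter> space M \<in> sets M"
    using assms by (intro measurable_sets[OF assms(1)] borel_open) auto
  then show ?thesis by (simp add: vimage_def Collect_conj_eq Int_commute)
qed

lemma compact_Inter_finite_nets: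
  fixes F :: "nat \<Rightarrow> 'a::complete_space set"
  assumes "\<And>k. finite (F k)"
  shows "compact (\<Inter>k. \<Union>a\<in>F k. cball a (inverse (real (Suc k))))" (is "compact ?K")
  unfolding compact_eq_totally_bounded complete_eq_closed
proof (intro conjI allI impI)
  show "closed ?K" using assms by (intro closed_INT ballI closed_UN) auto
  fix d :: real assume "0 < d"
  then obtain k where "inverse (real (Suc k)) < d" using reals_Archimedean by blast
  then have "cball a (inverse (real (Suc k))) \<subseteq> ball a d" for a :: 'a
    by (auto simp del: of_nat_Suc)
  then have "?K \<subseteq> (\<Union>a\<in>F k. ball a d)" by blast
  then show "\<exists>G. finite G \<and> ?K \<subseteq> (\<Union>a\<in>G. ball a d)" using assms by blast
qed

lemma uniformly_tightI_finite_nets: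
  fixes X :: "'i \<Rightarrow> 'w \<Rightarrow> 'h::complete_space"
  assumes prob_M: "prob_space M" and meas_X: "\<And>i. X i \<in> borel_measurable M"
    and net: "\<And>e d. 0 < e \<Longrightarrow> 0 < d \<Longrightarrow>
      \<exists>F. finite F \<and> (\<forall>i. measure M {\<omega>\<in>space M. X i \<omega> \<notin> (\<Union>a\<in>F. cball a d)} \<le> e)"
  shows "uniformly_tight M X"
  unfolding uniformly_tight_def
proof (intro allI impI)
  fix e :: real assume e_pos: "0 < e"
  interpret prob_space M by fact
  have "\<forall>k. \<exists>F. finite F \<and> (\<forall>i. prob {\<omega>\<in>space M. X i \<omega> \<notin> (\<Union>a\<in>F. cball a (inverse (real (Suc k))))}
      \<le> e * (1/2) ^ Suc k)"
    using e_pos by (intro allI net) simp_all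
  from choice[OF this] obtain F where
    F_net: "\<forall>k. finite (F k) \<and>
      (\<forall>i. prob {\<omega>\<in>space M. X i \<omega> \<notin> (\<Union>a\<in>F k. cball a (inverse (real (Suc k))))} \<le> e * (1/2) ^ Suc k)"
    by (rule exE)
  define B where "B k = (\<Union>a\<in>F k. cball a (inverse (real (Suc k))))" for k
  have "prob {\<omega>\<in>space M. X i \<omega> \<notin> (\<Inter>k. B k)} \<le> e" for i
  proof -
    have meas: "{\<omega>\<in>space M. X i \<omega> \<notin> B k} \<in> events" for k
      unfolding B_def using F_net by (intro sets_notin_closed meas_X closed_UN) auto
    have half: "(\<lambda>k. e * (1/2) ^ Suc k) sums e" using sums_mult[OF power_half_series, of e] by simp
    have prob_le: "prob {\<omega>\<in>space M. X i \<omega> \<notin> B k} \<le> e * (1/2) ^ Suc k" for k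
      using F_net unfolding B_def by blast
    have summable: "summable (\<lambda>k. prob {\<omega>\<in>space M. X i \<omega> \<notin> B k})"
      using prob_le by (intro summable_comparison_test'[OF sums_summable[OF half]]) (simp del: power_Suc)
    have "prob {\<omega>\<in>space M. X i \<omega> \<notin> (\<Inter>k. B k)} = prob (\<Union>k. {\<omega>\<in>space M. X i \<omega> \<notin> B k})"
      by (rule arg_cong[where f = prob]) auto
    also have "\<dots> \<le> (\<Sum>k. prob {\<omega>\<in>space M. X i \<omega> \<notin> B k})"
      using meas summable by (intro finite_measure_subadditive_countably) auto
    also have "\<dots> \<le> (\<Sum>k. e * (1/2) ^ Suc k)"
      using prob_le summable sums_summable[OF half] by (rule suminf_le)
    finally show ?thesis using half by (simp add: sums_iff)
  qed
  then show "\<exists>K. compact K \<and> (\<forall>i. prob {\<omega>\<in>space M. X i \<omega> \<notin> K} \<le> e)"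
    using compact_Inter_finite_nets[of F, folded B_def] F_net by (intro exI[of _ "\<Inter>k. B k"]) simp
qed

lemma (in prob_space) random_variable_tight:
  fixes Y :: "'a \<Rightarrow> 'h::polish_space"
  assumes meas_Y [measurable]: "random_variable borel Y" and e_pos: "0 < e"
  obtains K where "compact K" "prob {\<omega>\<in>space M. Y \<omega> \<notin> K} \<le> e"
proof -
  interpret D: prob_space "distr M borel Y" by (rule prob_space_distr) fact
  have "ennreal (1 - e) < emeasure (distr M borel Y) UNIV"
    using e_pos D.emeasure_space_1 by (simp add: ennreal_less_one_iff)
  also have "emeasure (distr M borel Y) UNIV
      = (SUP K\<in>{K. K \<subseteq> UNIV \<and> compact K}. emeasure (distr M borel Y) K)"
    by (rule inner_regular) simp_all
  finally obtain K where K_mass: "compact K" "ennreal (1 - e) < emeasure (distr M borel Y) K"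
    by (auto simp: less_SUP_iff)
  have closed: "closed K" using K_mass(1) by (rule compact_imp_closed)
  then have "\<not> prob (Y -` K \<inter> space M) \<le> 1 - e"
    using K_mass(2) ennreal_leI[of "prob (Y -` K \<inter> space M)" "1 - e"]
    by (auto simp: emeasure_distr emeasure_eq_measure)
  moreover have "{\<omega>\<in>space M. Y \<omega> \<notin> K} = space M - (Y -` K \<inter> space M)" by auto
  ultimately have "prob {\<omega>\<in>space M. Y \<omega> \<notin> K} \<le> e" using closed by (simp add: prob_compl)
  with K_mass(1) show thesis by (rule that)
qed

lemma borel_measurable_continuous_compose:
  assumes "continuous_on UNIV f" "X \<in> borel_measurable M"
  shows "(\<lambda>\<omega>. f (X \<omega>)) \<in> borel_measurable M"
  using measurable_compose[OF assms(2) borel_measurable_continuous_onI[OF assms(1)]] .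

lemma (in prob_space) integrable_bounded_continuous:
  fixes f :: "'h::topological_space \<Rightarrow> real"
  assumes "continuous_on UNIV f" "\<And>x. \<bar>f x\<bar> \<le> B" "random_variable borel X"
  shows "integrable M (\<lambda>\<omega>. f (X \<omega>))"
  using borel_measurable_continuous_compose[OF assms(1,3)] assms(2)
  by (intro integrable_const_bound[of _ B]) simp_all

lemma (in prob_space) abs_expectation_diff_le:
  fixes f g :: "'h::t2_space \<Rightarrow> real"
  assumes f_bdd_cont: "continuous_on UNIV f" "\<And>x. \<bar>f x\<bar> \<le> B"
    and g_bdd_cont: "continuous_on UNIV g" "\<And>x. \<bar>g x\<bar> \<le> D"
    and meas_X: "random_variable borel X" and K_mass: "compact K" "prob {\<omega>\<in>space M. X \<omega> \<notin> K} \<le> \<delta>"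
    and near: "0 \<le> e" "\<And>x. x \<in> K \<Longrightarrow> \<bar>f x - g x\<bar> \<le> e"
  shows "\<bar>expectation (\<lambda>\<omega>. f (X \<omega>)) - expectation (\<lambda>\<omega>. g (X \<omega>))\<bar> \<le> e + (B + D) * \<delta>"
proof -
  define A where "A = {\<omega>\<in>space M. X \<omega> \<notin> K}"
  have A_event: "A \<in> events" unfolding A_def by (intro sets_notin_closed meas_X compact_imp_closed K_mass)
  have integrable_fg: "integrable M (\<lambda>\<omega>. f (X \<omega>))" "integrable M (\<lambda>\<omega>. g (X \<omega>))"
    using integrable_bounded_continuous[OF f_bdd_cont meas_X] integrable_bounded_continuous[OF g_bdd_cont meas_X]
    by blast+
  have bounds_nonneg: "0 \<le> B + D" using f_bdd_cont(2)[of undefined] g_bdd_cont(2)[of undefined] by linarith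
  have "\<bar>expectation (\<lambda>\<omega>. f (X \<omega>)) - expectation (\<lambda>\<omega>. g (X \<omega>))\<bar> \<le> expectation (\<lambda>\<omega>. \<bar>f (X \<omega>) - g (X \<omega>)\<bar>)"
    using integrable_fg integral_abs_bound[of M "\<lambda>\<omega>. f (X \<omega>) - g (X \<omega>)"] by simp
  also have "\<dots> \<le> expectation (\<lambda>\<omega>. e + (B + D) * indicator A \<omega>)"
  proof (rule integral_mono)
    fix \<omega> assume "\<omega> \<in> space M"
    then show "\<bar>f (X \<omega>) - g (X \<omega>)\<bar> \<le> e + (B + D) * indicator A \<omega>"
      using near(1) near(2)[of "X \<omega>"] f_bdd_cont(2)[of "X \<omega>"] g_bdd_cont(2)[of "X \<omega>"]
      by (auto simp: A_def indicator_def)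
  qed (use integrable_fg A_event in \<open>auto simp: emeasure_eq_measure\<close>)
  also have "\<dots> = e + (B + D) * prob A" using A_event by (simp add: prob_space emeasure_eq_measure)
  also have "\<dots> \<le> e + (B + D) * \<delta>"
    using K_mass(2) bounds_nonneg by (intro add_left_mono mult_left_mono) (simp_all add: A_def)
  finally show ?thesis .
qed

subsection \<open>The extended continuous mapping theorem\<close>

lemma uniform_limit_on_compactI:
  fixes g :: "'n \<Rightarrow> 'a::topological_space \<Rightarrow> 'b::metric_space"
  assumes compact_K: "compact K" and cont: "continuous_on UNIV l"
    and lim: "\<And>x. x \<in> K \<Longrightarrow> ((\<lambda>(n, y). g n y) \<longlongrightarrow> l x) (F \<times>\<^sub>F nhds x)"
  shows "uniform_limit K g l F"
proof (rule uniform_limitI)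
  fix e :: real assume e_pos: "0 < e"
  have "\<exists>U. open U \<and> x \<in> U \<and> (\<forall>\<^sub>F n in F. \<forall>y\<in>U. dist (g n y) (l y) < e)" if x_in_K: "x \<in> K" for x
  proof -
    have "((\<lambda>z. l (snd z)) \<longlongrightarrow> l x) (F \<times>\<^sub>F nhds x)"
      by (rule continuous_on_tendsto_compose[OF cont filterlim_snd]) simp_all
    with lim[OF x_in_K] have "((\<lambda>z. dist (case z of (n, y) \<Rightarrow> g n y) (l (snd z))) \<longlongrightarrow> dist (l x) (l x)) (F \<times>\<^sub>F nhds x)"
      by (rule tendsto_dist)
    then have "\<forall>\<^sub>F z in F \<times>\<^sub>F nhds x. dist (case z of (n, y) \<Rightarrow> g n y) (l (snd z)) < e"
      by (rule order_tendstoD) (use e_pos in simp)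
    then obtain P Q where P_ev: "eventually P F" and Q_ev: "eventually Q (nhds x)"
      and PQ_close: "\<forall>n y. P n \<longrightarrow> Q y \<longrightarrow> dist (g n y) (l y) < e"
      unfolding eventually_prod_filter by auto
    obtain U where U_nbhd: "open U" "x \<in> U" "\<forall>y\<in>U. Q y" using Q_ev unfolding eventually_nhds by blast
    have "\<forall>\<^sub>F n in F. \<forall>y\<in>U. dist (g n y) (l y) < e"
      using P_ev by eventually_elim (use PQ_close U_nbhd(3) in blast)
    with U_nbhd(1,2) show ?thesis by blast
  qed
  then have "\<forall>x\<in>K. \<exists>U. open U \<and> x \<in> U \<and> (\<forall>\<^sub>F n in F. \<forall>y\<in>U. dist (g n y) (l y) < e)" by blast
  from bchoice[OF this] obtain U where
    U_nbhd: "\<forall>x\<in>K. open (U x) \<and> x \<in> U x \<and> (\<forall>\<^sub>F n in F. \<forall>y\<in>U x. dist (g n y) (l y) < e)"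
    by (rule exE)
  have U_open: "open (U x)" if "x \<in> K" for x using U_nbhd that by blast
  have cover: "K \<subseteq> (\<Union>x\<in>K. U x)" using U_nbhd by blast
  obtain C where C_cover: "C \<subseteq> K" "finite C" "K \<subseteq> (\<Union>x\<in>C. U x)"
    by (rule compactE_image[OF compact_K U_open cover])
  have "\<forall>\<^sub>F n in F. \<forall>x\<in>C. \<forall>y\<in>U x. dist (g n y) (l y) < e"
    using C_cover(1,2) U_nbhd by (intro eventually_ball_finite) auto
  then show "\<forall>\<^sub>F n in F. \<forall>y\<in>K. dist (g n y) (l y) < e"
    by eventually_elim (use C_cover(3) in blast)
qed

lemma nonexpansive_tendsto_prod:
  fixes Q :: "'n \<Rightarrow> 'a::metric_space \<Rightarrow> 'b::metric_space"
  assumes nonexpansive: "\<And>n x y. dist (Q n x) (Q n y) \<le> dist x y" and lim: "((\<lambda>n. Q n x) \<longlongrightarrow> l) F"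
  shows "((\<lambda>(n, y). Q n y) \<longlongrightarrow> l) (F \<times>\<^sub>F nhds x)"
proof (rule tendstoI)
  fix e :: real assume "0 < e"
  then have "\<forall>\<^sub>F n in F. dist (Q n x) l < e / 2" "\<forall>\<^sub>F y in nhds x. dist y x < e / 2"
    using tendstoD[OF lim] tendstoD[OF filterlim_ident] half_gt_zero by blast+
  moreover have "dist (Q n y) l < e" if "dist (Q n x) l < e / 2" "dist y x < e / 2" for n y
    using that nonexpansive[of n y x] dist_triangle[of "Q n y" l "Q n x"] by simp
  ultimately show "\<forall>\<^sub>F z in F \<times>\<^sub>F nhds x. dist (case z of (n, y) \<Rightarrow> Q n y) l < e"
    unfolding eventually_prod_filter by (intro exI conjI) (assumption | simp)+
qed

lemma expectation_diff_tendsto_0_if_tight: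
  fixes X :: "nat \<Rightarrow> 'w \<Rightarrow> 'h::t2_space" and g :: "nat \<Rightarrow> 'h \<Rightarrow> real"
  assumes prob_M: "prob_space M" and meas_X: "\<And>n. X n \<in> borel_measurable M" and tight: "uniformly_tight M X"
    and g_bdd_cont: "\<And>n. continuous_on UNIV (g n)" "\<And>n x. \<bar>g n x\<bar> \<le> B"
    and l_bdd_cont: "continuous_on UNIV l" "\<And>x. \<bar>l x\<bar> \<le> B"
    and lim: "\<And>K. compact K \<Longrightarrow> uniform_limit K g l sequentially"
  shows "(\<lambda>n. (\<integral>\<omega>. g n (X n \<omega>) \<partial>M) - (\<integral>\<omega>. l (X n \<omega>) \<partial>M)) \<longlonglongrightarrow> 0"
proof (rule LIMSEQ_I)
  fix r :: real assume r_pos: "0 < r"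
  interpret prob_space M by fact
  have "0 \<le> B" using l_bdd_cont(2)[of undefined] by linarith
  define e where "e = r / (4 * B + 2)"
  have "0 < 4 * B + 2" using \<open>0 \<le> B\<close> by simp
  then have "0 < e" "e * (4 * B + 2) = r" using r_pos unfolding e_def by simp_all
  then have e_small: "0 < e" "e + (B + B) * e < r" using r_pos by (simp_all add: algebra_simps)
  obtain K where K_mass: "compact K" "\<forall>n. prob {\<omega>\<in>space M. X n \<omega> \<notin> K} \<le> e"
    using uniformly_tightD[OF tight e_small(1)] by blast
  obtain N where N_close: "\<And>n x. N \<le> n \<Longrightarrow> x \<in> K \<Longrightarrow> \<bar>g n x - l x\<bar> < e"
    using uniform_limitD[OF lim[OF K_mass(1)] e_small(1)]
    by (auto simp: eventually_sequentially dist_real_def)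
  have "\<bar>expectation (\<lambda>\<omega>. g n (X n \<omega>)) - expectation (\<lambda>\<omega>. l (X n \<omega>))\<bar> < r" if "N \<le> n" for n
  proof -
    have "\<bar>expectation (\<lambda>\<omega>. g n (X n \<omega>)) - expectation (\<lambda>\<omega>. l (X n \<omega>))\<bar> \<le> e + (B + B) * e"
      using N_close[OF that] K_mass e_small(1)
      by (intro abs_expectation_diff_le[OF g_bdd_cont l_bdd_cont meas_X, of K]) (auto intro: less_imp_le)
    then show ?thesis using e_small(2) by linarith
  qed
  then show "\<exists>N. \<forall>n\<ge>N. norm (expectation (\<lambda>\<omega>. g n (X n \<omega>)) - expectation (\<lambda>\<omega>. l (X n \<omega>)) - 0) < r"
    by (intro exI[of _ N]) simp
qed

theorem converges_in_distribution_extended_mapping: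
  fixes X :: "nat \<Rightarrow> 'w \<Rightarrow> 'h::t2_space" and Q :: "nat \<Rightarrow> 'h \<Rightarrow> 'k::topological_space"
  assumes prob_M: "prob_space M" and tight: "uniformly_tight M X"
    and conv: "converges_in_distribution M X N Y"
    and Q_cont: "\<And>n. continuous_on UNIV (Q n)" and P_cont: "continuous_on UNIV P"
    and lim: "\<And>x. ((\<lambda>(n, y). Q n y) \<longlongrightarrow> P x) (sequentially \<times>\<^sub>F nhds x)"
  shows "converges_in_distribution M (\<lambda>n \<omega>. Q n (X n \<omega>)) N (\<lambda>\<omega>. P (Y \<omega>))"
  unfolding converges_in_distribution_def
proof (intro conjI allI impI)
  have meas_X: "X n \<in> borel_measurable M" for n using conv by (simp add: converges_in_distribution_def)
  have meas_Y: "Y \<in> borel_measurable N" using conv by (simp add: converges_in_distribution_def)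
  show "(\<lambda>\<omega>. Q n (X n \<omega>)) \<in> borel_measurable M" for n
    by (rule borel_measurable_continuous_compose[OF Q_cont meas_X])
  show "(\<lambda>\<omega>. P (Y \<omega>)) \<in> borel_measurable N" by (rule borel_measurable_continuous_compose[OF P_cont meas_Y])
  fix f :: "'k \<Rightarrow> real" assume f_cont_bdd: "continuous_on UNIV f" "bounded (range f)"
  obtain B where f_le: "\<And>x. \<bar>f x\<bar> \<le> B" using f_cont_bdd(2) by (auto simp: bounded_iff)
  have fQ_cont: "continuous_on UNIV (\<lambda>x. f (Q n x))" for n
    using continuous_on_compose2[OF f_cont_bdd(1) Q_cont] by simp
  have fP_cont: "continuous_on UNIV (\<lambda>x. f (P x))"
    using continuous_on_compose2[OF f_cont_bdd(1) P_cont] by simp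
  have "((\<lambda>(n, y). f (Q n y)) \<longlongrightarrow> f (P x)) (sequentially \<times>\<^sub>F nhds x)" for x
    using continuous_on_tendsto_compose[OF f_cont_bdd(1) lim[of x]] by (simp add: case_prod_unfold)
  then have "uniform_limit K (\<lambda>n x. f (Q n x)) (\<lambda>x. f (P x)) sequentially" if "compact K" for K
    using that by (intro uniform_limit_on_compactI fP_cont)
  then have "(\<lambda>n. (\<integral>\<omega>. f (Q n (X n \<omega>)) \<partial>M) - (\<integral>\<omega>. f (P (X n \<omega>)) \<partial>M)) \<longlonglongrightarrow> 0"
    by (intro expectation_diff_tendsto_0_if_tight[OF prob_M meas_X tight fQ_cont f_le fP_cont f_le])
  moreover have "(\<lambda>n. \<integral>\<omega>. f (P (X n \<omega>)) \<partial>M) \<longlonglongrightarrow> (\<integral>\<omega>. f (P (Y \<omega>)) \<partial>N)"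
    using conv fP_cont bounded_subset[OF f_cont_bdd(2), of "range (\<lambda>x. f (P x))"]
    unfolding converges_in_distribution_def by blast
  ultimately show "(\<lambda>n. \<integral>\<omega>. f (Q n (X n \<omega>)) \<partial>M) \<longlonglongrightarrow> (\<integral>\<omega>. f (P (Y \<omega>)) \<partial>N)"
    by (rule Lim_transform[rotated])
qed

subsection \<open>Convergence of the one-dimensional projections\<close>

inductive_set trig_functions :: "('h::real_inner \<Rightarrow> real) set" where
  cos: "(\<lambda>x. c * cos (x \<bullet> h + a)) \<in> trig_functions"
| add: "f \<in> trig_functions \<Longrightarrow> g \<in> trig_functions \<Longrightarrow> (\<lambda>x. f x + g x) \<in> trig_functions"

lemma trig_functions_const: "(\<lambda>_. c) \<in> trig_functions"
  using trig_functions.cos[of c 0 0] by simp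

lemma trig_functions_mult:
  assumes "f \<in> trig_functions" "g \<in> trig_functions"
  shows "(\<lambda>x. f x * g x) \<in> trig_functions"
  using assms(1)
proof induction
  case (cos c h a)
  show ?case using assms(2)
  proof induction
    case (cos d k b)
    have "(c * cos (x \<bullet> h + a)) * (d * cos (x \<bullet> k + b)) =
        (c * d / 2) * cos (x \<bullet> (h - k) + (a - b)) + (c * d / 2) * cos (x \<bullet> (h + k) + (a + b))" for x
    proof -
      have "x \<bullet> (h - k) + (a - b) = (x \<bullet> h + a) - (x \<bullet> k + b)"
        "x \<bullet> (h + k) + (a + b) = (x \<bullet> h + a) + (x \<bullet> k + b)"
        by (simp_all add: inner_diff_right inner_add_right)
      then show ?thesis by (simp only: cos_diff cos_add) (simp add: field_simps)
    qed
    then show ?case by (simp only: trig_functions.intros)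
  next
    case (add f g)
    then show ?case unfolding distrib_left by (intro trig_functions.add)
  qed
next
  case (add f g)
  then show ?case unfolding distrib_right by (intro trig_functions.add)
qed

lemma trig_functions_polynomial:
  assumes f_trig: "f \<in> trig_functions" and q_polynomial: "real_polynomial_function q"
  shows "(\<lambda>x. q (f x)) \<in> trig_functions"
  using q_polynomial
  by induction
    (auto simp: real_bounded_linear intro: trig_functions_const trig_functions.add trig_functions_mult f_trig)

lemma trig_functions_continuous: "f \<in> trig_functions \<Longrightarrow> continuous_on S f"
  by (induction rule: trig_functions.induct) (auto intro!: continuous_intros)

lemma trig_functions_bounded: "f \<in> trig_functions \<Longrightarrow> \<exists>B. \<forall>x. \<bar>f x\<bar> \<le> B"
proof (induction rule: trig_functions.induct)
  case (cos c h a)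
  have "\<bar>c * cos (x \<bullet> h + a)\<bar> \<le> \<bar>c\<bar> * 1" for x
    unfolding abs_mult by (intro mult_left_mono) auto
  then show ?case by blast
next
  case (add f g)
  then obtain B D where "\<forall>x. \<bar>f x\<bar> \<le> B" "\<forall>x. \<bar>g x\<bar> \<le> D" by blast
  then have "\<bar>f x + g x\<bar> \<le> B + D" for x by (intro abs_triangle_ineq[THEN order_trans] add_mono) auto
  then show ?case by blast
qed

lemma trig_functions_separate:
  fixes x y :: "'h::real_inner"
  assumes "x \<noteq> y"
  shows "\<exists>f\<in>trig_functions. f x \<noteq> f y"
proof
  define h where "h = (pi / ((y - x) \<bullet> (y - x))) *\<^sub>R (y - x)"
  have "(y - x) \<bullet> (y - x) \<noteq> 0" using assms by simp
  then have "(y - x) \<bullet> h = pi" by (simp add: h_def)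
  then have "y \<bullet> h + - (x \<bullet> h) = pi" by (simp add: inner_diff_left)
  then show "1 * cos (x \<bullet> h + - (x \<bullet> h)) \<noteq> 1 * cos (y \<bullet> h + - (x \<bullet> h))" by simp
  show "(\<lambda>z. 1 * cos (z \<bullet> h + - (x \<bullet> h))) \<in> trig_functions" by (rule trig_functions.cos)
qed

text \<open>A Stone--Weierstrass approximation is only controlled on the compact set; composing it with a
  polynomial close to the clamping function on its bounded range controls it everywhere.\<close>

lemma trig_functions_approx:
  fixes f :: "'h::real_inner \<Rightarrow> real"
  assumes compact_K: "compact K" and f_cont: "continuous_on K f"
    and f_le: "\<And>x. x \<in> K \<Longrightarrow> \<bar>f x\<bar> \<le> B" "0 \<le> B" and e_pos: "0 < e"
  shows "\<exists>g\<in>trig_functions. (\<forall>x\<in>K. \<bar>f x - g x\<bar> \<le> e) \<and> (\<forall>x. \<bar>g x\<bar> \<le> B + e)"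
proof -
  interpret function_ring_on "trig_functions :: ('h \<Rightarrow> real) set" K
    by standard (use compact_K in \<open>auto intro: trig_functions_continuous trig_functions.add trig_functions_mult
        trig_functions_const dest: trig_functions_separate\<close>)
  obtain g where g_approx: "g \<in> trig_functions" "\<And>x. x \<in> K \<Longrightarrow> \<bar>f x - g x\<bar> < e / 2"
    using Stone_Weierstrass_basic[OF f_cont, of "e / 2"] e_pos by auto
  obtain D where g_le: "\<And>x. \<bar>g x\<bar> \<le> D" using trig_functions_bounded[OF g_approx(1)] by blast
  define clamp where "clamp u = max (- B) (min B u)" for u :: real
  have "continuous_on {-D..D} clamp" unfolding clamp_def by (intro continuous_intros)
  then obtain q where q_approx: "polynomial_function q" "\<And>u. u \<in> {-D..D} \<Longrightarrow> norm (clamp u - q u) < e / 2"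
    using Stone_Weierstrass_polynomial_function[of "{-D..D}" clamp "e / 2"] e_pos by auto
  have q_clamp: "\<bar>clamp (g x) - q (g x)\<bar> < e / 2" for x
    using q_approx(2)[of "g x"] g_le[of x] by (simp add: abs_le_iff minus_le_iff)
  have clamp_bound: "\<bar>clamp u\<bar> \<le> B" for u using f_le(2) by (auto simp: clamp_def)
  have clamp_closer: "\<bar>f x - clamp (g x)\<bar> \<le> \<bar>f x - g x\<bar>" if "x \<in> K" for x
    using f_le(1)[OF that] f_le(2) by (auto simp: clamp_def)
  show ?thesis
  proof (rule bexI[of _ "\<lambda>x. q (g x)"], intro conjI ballI allI)
    show "(\<lambda>x. q (g x)) \<in> trig_functions"
      using trig_functions_polynomial[OF g_approx(1), of q] q_approx(1)
      by (simp add: real_polynomial_function_eq)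
    show "\<bar>f x - q (g x)\<bar> \<le> e" if "x \<in> K" for x
      using clamp_closer[OF that] g_approx(2)[OF that] q_clamp[of x] by linarith
    show "\<bar>q (g x)\<bar> \<le> B + e" for x using clamp_bound[of "g x"] q_clamp[of x] e_pos by linarith
  qed
qed

lemma weak_conv_m_cos:
  assumes "prob_space M" "prob_space N" "\<And>n. U n \<in> borel_measurable M" "V \<in> borel_measurable N"
    and conv: "weak_conv_m (\<lambda>n. distr M borel (U n)) (distr N borel V)"
  shows "(\<lambda>n. \<integral>\<omega>. cos (U n \<omega> + a) \<partial>M) \<longlonglongrightarrow> (\<integral>\<omega>. cos (V \<omega> + a) \<partial>N)"
proof -
  note [measurable] = assms(3,4)
  have "(\<lambda>n. \<integral>x. cos (x + a) \<partial>distr M borel (U n)) \<longlonglongrightarrow> (\<integral>x. cos (x + a) \<partial>distr N borel V)"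
    by (rule weak_conv_imp_integral_bdd_continuous_conv[OF _ _ conv, where B = 1])
      (use assms in \<open>auto intro!: prob_space.real_distribution_distr continuous_intros\<close>)
  then show ?thesis by (simp add: integral_distr)
qed

lemma trig_functions_expectation_tendsto:
  fixes X :: "nat \<Rightarrow> 'w \<Rightarrow> 'h::real_inner" and Y :: "'v \<Rightarrow> 'h"
  assumes prob_M: "prob_space M" and prob_N: "prob_space N"
    and meas_X: "\<And>n. X n \<in> borel_measurable M" and meas_Y: "Y \<in> borel_measurable N"
    and conv: "\<And>h. weak_conv_m (\<lambda>n. distr M borel (\<lambda>\<omega>. X n \<omega> \<bullet> h)) (distr N borel (\<lambda>\<omega>. Y \<omega> \<bullet> h))"
    and g_trig: "g \<in> trig_functions"
  shows "(\<lambda>n. \<integral>\<omega>. g (X n \<omega>) \<partial>M) \<longlonglongrightarrow> (\<integral>\<omega>. g (Y \<omega>) \<partial>N)"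
  using g_trig
proof induction
  case (cos c h a)
  have "continuous_on UNIV (\<lambda>x. x \<bullet> h)" by (intro continuous_intros)
  note borel_measurable_continuous_compose[OF this meas_X] borel_measurable_continuous_compose[OF this meas_Y]
  from weak_conv_m_cos[OF prob_M prob_N this conv] show ?case
    unfolding integral_mult_right_zero by (rule tendsto_mult_left)
next
  case (add f g)
  obtain B D where f_le: "\<And>x. \<bar>f x\<bar> \<le> B" and g_le: "\<And>x. \<bar>g x\<bar> \<le> D"
    using add.hyps trig_functions_bounded by metis
  note cont = trig_functions_continuous[OF add.hyps(1)] trig_functions_continuous[OF add.hyps(2)]
  have "integrable M (\<lambda>\<omega>. f (X n \<omega>))" "integrable M (\<lambda>\<omega>. g (X n \<omega>))" for n
    using prob_space.integrable_bounded_continuous[OF prob_M] cont f_le g_le meas_X by metis+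
  moreover have "integrable N (\<lambda>\<omega>. f (Y \<omega>))" "integrable N (\<lambda>\<omega>. g (Y \<omega>))"
    using prob_space.integrable_bounded_continuous[OF prob_N] cont f_le g_le meas_Y by metis+
  ultimately show ?case using add.IH by (simp add: tendsto_add)
qed

text \<open>A compact set carrying almost all the mass of every \<open>X n\<close> and of \<open>Y\<close> allows to replace \<open>f\<close> by a
  single trigonometric function in all the expectations.\<close>

lemma trig_functions_expectation_approx:
  fixes X :: "nat \<Rightarrow> 'w \<Rightarrow> 'h::{real_inner, polish_space}" and Y :: "'v \<Rightarrow> 'h"
  assumes prob_M: "prob_space M" and prob_N: "prob_space N"
    and meas_X: "\<And>n. X n \<in> borel_measurable M" and meas_Y: "Y \<in> borel_measurable N"
    and tight: "uniformly_tight M X"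
    and f_cont_bdd: "continuous_on UNIV f" "bounded (range f)" and "0 < \<epsilon>"
  shows "\<exists>g\<in>trig_functions. (\<forall>n. \<bar>(\<integral>\<omega>. f (X n \<omega>) \<partial>M) - (\<integral>\<omega>. g (X n \<omega>) \<partial>M)\<bar> \<le> \<epsilon>) \<and>
    \<bar>(\<integral>\<omega>. f (Y \<omega>) \<partial>N) - (\<integral>\<omega>. g (Y \<omega>) \<partial>N)\<bar> \<le> \<epsilon>"
proof -
  interpret M: prob_space M by fact
  interpret N: prob_space N by fact
  obtain B where f_le: "\<And>x. \<bar>f x\<bar> \<le> B" using f_cont_bdd(2) by (auto simp: bounded_iff)
  have "0 \<le> B" using f_le[of 0] by linarith
  define c where "c = 1 + (B + (B + 1))"
  define e where "e = min 1 (\<epsilon> / c)"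
  have "0 < c" using \<open>0 \<le> B\<close> by (simp add: c_def)
  then have e_small: "0 < e" "e \<le> 1" "c * e \<le> \<epsilon>" using \<open>0 < \<epsilon>\<close> by (auto simp: e_def min_def field_simps)
  obtain K1 where K1_mass: "compact K1" "\<forall>n. M.prob {\<omega>\<in>space M. X n \<omega> \<notin> K1} \<le> e"
    using uniformly_tightD[OF tight e_small(1)] by blast
  obtain K2 where K2_mass: "compact K2" "N.prob {\<omega>\<in>space N. Y \<omega> \<notin> K2} \<le> e"
    using N.random_variable_tight[OF meas_Y e_small(1)] .
  have f_cont: "continuous_on (K1 \<union> K2) f" using f_cont_bdd(1) by (rule continuous_on_subset) simp
  obtain g where g_trig: "g \<in> trig_functions" and near: "\<forall>x\<in>K1 \<union> K2. \<bar>f x - g x\<bar> \<le> e"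
    and "\<forall>x. \<bar>g x\<bar> \<le> B + e"
    using trig_functions_approx[OF compact_Un[OF K1_mass(1) K2_mass(1)] f_cont f_le \<open>0 \<le> B\<close> e_small(1)]
    by blast
  then have g_le: "\<bar>g x\<bar> \<le> B + 1" for x using e_small(2) by (meson add_left_mono order_trans)
  note g_cont = trig_functions_continuous[OF g_trig, of UNIV]
  have "\<bar>(\<integral>\<omega>. f (X n \<omega>) \<partial>M) - (\<integral>\<omega>. g (X n \<omega>) \<partial>M)\<bar> \<le> e + (B + (B + 1)) * e" for n
    using K1_mass near e_small(1)
    by (intro M.abs_expectation_diff_le[OF f_cont_bdd(1) f_le g_cont g_le meas_X, of K1]) auto
  moreover have "\<bar>(\<integral>\<omega>. f (Y \<omega>) \<partial>N) - (\<integral>\<omega>. g (Y \<omega>) \<partial>N)\<bar> \<le> e + (B + (B + 1)) * e"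
    using K2_mass near e_small(1)
    by (intro N.abs_expectation_diff_le[OF f_cont_bdd(1) f_le g_cont g_le meas_Y, of K2]) auto
  moreover have "e + (B + (B + 1)) * e \<le> \<epsilon>" using e_small(3) by (simp add: c_def algebra_simps)
  ultimately show ?thesis using g_trig order_trans by blast
qed

theorem converges_in_distribution_cramer_wold:
  fixes X :: "nat \<Rightarrow> 'w \<Rightarrow> 'h::{real_inner, polish_space}" and Y :: "'v \<Rightarrow> 'h"
  assumes prob_M: "prob_space M" and prob_N: "prob_space N"
    and meas_X: "\<And>n. X n \<in> borel_measurable M" and meas_Y: "Y \<in> borel_measurable N"
    and tight: "uniformly_tight M X"
    and conv: "\<And>h. weak_conv_m (\<lambda>n. distr M borel (\<lambda>\<omega>. X n \<omega> \<bullet> h)) (distr N borel (\<lambda>\<omega>. Y \<omega> \<bullet> h))"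
  shows "converges_in_distribution M X N Y"
  unfolding converges_in_distribution_def
proof (intro conjI allI impI meas_X meas_Y)
  fix f :: "'h \<Rightarrow> real" assume f_cont_bdd: "continuous_on UNIV f" "bounded (range f)"
  show "(\<lambda>n. \<integral>\<omega>. f (X n \<omega>) \<partial>M) \<longlonglongrightarrow> (\<integral>\<omega>. f (Y \<omega>) \<partial>N)"
  proof (rule LIMSEQ_I)
    fix r :: real assume "0 < r"
    then have "0 < r / 3" by simp
    then obtain g where g_trig: "g \<in> trig_functions"
      and near: "\<forall>n. \<bar>(\<integral>\<omega>. f (X n \<omega>) \<partial>M) - (\<integral>\<omega>. g (X n \<omega>) \<partial>M)\<bar> \<le> r / 3"
        "\<bar>(\<integral>\<omega>. f (Y \<omega>) \<partial>N) - (\<integral>\<omega>. g (Y \<omega>) \<partial>N)\<bar> \<le> r / 3"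
      using trig_functions_expectation_approx[OF prob_M prob_N meas_X meas_Y tight f_cont_bdd] by blast
    obtain m where m_close: "\<forall>n\<ge>m. norm ((\<integral>\<omega>. g (X n \<omega>) \<partial>M) - (\<integral>\<omega>. g (Y \<omega>) \<partial>N)) < r / 3"
      using LIMSEQ_D[OF trig_functions_expectation_tendsto[OF prob_M prob_N meas_X meas_Y conv g_trig] \<open>0 < r / 3\<close>] by blast
    have "norm ((\<integral>\<omega>. f (X n \<omega>) \<partial>M) - (\<integral>\<omega>. f (Y \<omega>) \<partial>N)) < r" if "m \<le> n" for n
      using near(1)[rule_format, of n] near(2) m_close[rule_format, OF that]
      unfolding real_norm_def by linarith
    then show "\<exists>m. \<forall>n\<ge>m. norm ((\<integral>\<omega>. f (X n \<omega>) \<partial>M) - (\<integral>\<omega>. f (Y \<omega>) \<partial>N)) < r" by blast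
  qed
qed

subsection \<open>Tightness in the space of square summable functions\<close>

lemma borel_measurable_ell2_nth [measurable]: "(\<lambda>f. ell2_nth f x) \<in> borel_measurable borel"
  unfolding inner_ell2_basis[symmetric] by (intro borel_measurable_continuous_onI continuous_intros)

lemma borel_measurable_ell2_restrict [measurable]: "ell2_restrict A \<in> borel_measurable borel"
  by (intro borel_measurable_continuous_onI linear_continuous_on bounded_linear_ell2_restrict)

lemma finite_net_ell2_small_tail:
  assumes "finite F" "0 < d"
  shows "\<exists>N. finite N \<and> {f. norm f \<le> R \<and> norm (ell2_restrict (- F) f) \<le> d / 2} \<subseteq> (\<Union>a\<in>N. cball a d)"
proof -
  define C where "C = (\<lambda>c. \<Sum>x\<in>F. c x *\<^sub>R ell2_basis x) ` PiE UNIV (\<lambda>_::'a. {-R..R})"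
  have "compact (PiE UNIV (\<lambda>_::'a. {-R..R}))"
    using compactin_PiE[of "\<lambda>_::'a. euclidean" UNIV "\<lambda>_. {-R..R}"] by (simp add: euclidean_product_topology)
  then have "compact C"
    unfolding C_def by (intro compact_continuous_image continuous_intros
      continuous_on_subset[OF continuous_on_product_coordinates subset_UNIV])
  then obtain N where N_net: "finite N" "C \<subseteq> (\<Union>a\<in>N. ball a (d / 2))"
    unfolding compact_eq_totally_bounded using half_gt_zero[OF assms(2)] by blast
  have "f \<in> (\<Union>a\<in>N. cball a d)" if f_small_tail: "norm f \<le> R" "norm (ell2_restrict (- F) f) \<le> d / 2" for f
  proof -
    have "ell2_restrict F f \<in> C"
      unfolding C_def ell2_restrict_eq_sum[OF assms(1)]
      using order_trans[OF abs_ell2_nth_le_norm f_small_tail(1)]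
      by (intro imageI) (auto simp: abs_le_iff minus_le_iff)
    then obtain a where a_near: "a \<in> N" "dist a (ell2_restrict F f) < d / 2" using N_net(2) by auto
    have "f - ell2_restrict F f = ell2_restrict (- F) f" by (rule ell2_eqI) (simp add: ell2_nth_simps)
    then have "dist (ell2_restrict F f) f \<le> d / 2"
      using f_small_tail(2) by (simp add: dist_norm norm_minus_commute)
    then have "dist a f \<le> d" using a_near(2) dist_triangle[of a f "ell2_restrict F f"] by simp
    with a_near(1) show ?thesis by auto
  qed
  with N_net(1) show ?thesis by blast
qed

lemma ennreal_infsum_eq_nn_integral:
  fixes f :: "'a \<Rightarrow> real"
  assumes "f summable_on A" "\<And>x. x \<in> A \<Longrightarrow> 0 \<le> f x"
  shows "ennreal (infsum f A) = (\<integral>\<^sup>+x. ennreal (f x) \<partial>count_space A)"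
proof -
  have "Infinite_Set_Sum.abs_summable_on f A"
    using assms by (simp add: abs_summable_equivalent[symmetric] cong: summable_on_cong)
  then show ?thesis using assms(2) by (simp add: nn_integral_conv_infsetsum infsetsum_infsum)
qed

lemma nn_integral_norm_sq_ell2_restrict:
  fixes X :: "'w \<Rightarrow> 'a::countable ell2"
  assumes [measurable]: "X \<in> borel_measurable M"
  shows "(\<integral>\<^sup>+\<omega>. ennreal ((norm (ell2_restrict A (X \<omega>)))\<^sup>2) \<partial>M)
    = (\<integral>\<^sup>+x. \<integral>\<^sup>+\<omega>. ennreal ((ell2_nth (X \<omega>) x)\<^sup>2) \<partial>M \<partial>count_space A)"
proof -
  have "ennreal ((norm (ell2_restrict A f))\<^sup>2) = (\<integral>\<^sup>+x. ennreal ((ell2_nth f x)\<^sup>2) \<partial>count_space A)" for f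
    unfolding norm_sq_ell2_restrict
    by (intro ennreal_infsum_eq_nn_integral summable_on_subset_banach[OF square_summable_ell2_nth]) simp_all
  then show ?thesis by (simp add: nn_integral_count_space_nn_integral)
qed

lemma prob_norm_ell2_restrict_ge:
  fixes X :: "'w \<Rightarrow> 'a::countable ell2"
  assumes prob_M: "prob_space M" and meas_X [measurable]: "X \<in> borel_measurable M"
    and g_summable: "g summable_on UNIV" "\<And>x. 0 \<le> g x"
    and second_moment_le: "\<And>x. (\<integral>\<^sup>+\<omega>. ennreal ((ell2_nth (X \<omega>) x)\<^sup>2) \<partial>M) \<le> ennreal (g x)" and c_pos: "0 < c"
  shows "measure M {\<omega>\<in>space M. c \<le> norm (ell2_restrict A (X \<omega>))} \<le> infsum g A / c\<^sup>2"
proof -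
  interpret prob_space M by fact
  have g_summable_A: "g summable_on A" by (rule summable_on_subset_banach[OF g_summable(1)]) simp
  have "c \<le> r \<longleftrightarrow> 1 \<le> ennreal (1 / c\<^sup>2) * ennreal (r\<^sup>2)" if "0 \<le> r" for r
  proof -
    have "1 \<le> ennreal (1 / c\<^sup>2) * ennreal (r\<^sup>2) \<longleftrightarrow> c\<^sup>2 \<le> r\<^sup>2"
      using c_pos by (simp add: ennreal_mult[symmetric] ennreal_1[symmetric] del: ennreal_1)
    then show ?thesis using c_pos that by simp
  qed
  then have "emeasure M {\<omega>\<in>space M. c \<le> norm (ell2_restrict A (X \<omega>))}
      = emeasure M {\<omega>\<in>space M. 1 \<le> ennreal (1 / c\<^sup>2) * ennreal ((norm (ell2_restrict A (X \<omega>)))\<^sup>2)}" by simp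
  also have "\<dots> \<le> ennreal (1 / c\<^sup>2) *
      (\<integral>\<^sup>+\<omega>. ennreal ((norm (ell2_restrict A (X \<omega>)))\<^sup>2) * indicator (space M) \<omega> \<partial>M)"
    by (rule nn_integral_Markov_inequality) measurable
  also have "(\<integral>\<^sup>+\<omega>. ennreal ((norm (ell2_restrict A (X \<omega>)))\<^sup>2) * indicator (space M) \<omega> \<partial>M)
      = (\<integral>\<^sup>+\<omega>. ennreal ((norm (ell2_restrict A (X \<omega>)))\<^sup>2) \<partial>M)" by (intro nn_integral_cong) simp
  also have "ennreal (1 / c\<^sup>2) * \<dots> \<le> ennreal (1 / c\<^sup>2) * (\<integral>\<^sup>+x. ennreal (g x) \<partial>count_space A)"
    unfolding nn_integral_norm_sq_ell2_restrict[OF meas_X]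
    by (intro mult_left_mono nn_integral_mono second_moment_le) simp
  also have "\<dots> = ennreal (infsum g A / c\<^sup>2)"
    using g_summable(2)
    by (simp add: ennreal_infsum_eq_nn_integral[OF g_summable_A, symmetric] ennreal_mult[symmetric] infsum_nonneg)
  finally show ?thesis using g_summable(2) by (simp add: emeasure_eq_measure infsum_nonneg)
qed

lemma summable_on_small_tail:
  fixes g :: "'a \<Rightarrow> real"
  assumes "g summable_on UNIV" "0 < e"
  shows "\<exists>F. finite F \<and> infsum g (- F) < e"
proof -
  obtain F where F_approx: "finite F" "dist (sum g F) (infsum g UNIV) \<le> e / 2"
    using infsum_finite_approximation[OF assms(1), of "e / 2"] assms(2) by auto
  have "infsum g (- F) = infsum g UNIV - sum g F"
    using F_approx(1) assms(1) by (simp add: Compl_eq_Diff_UNIV infsum_Diff)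
  also have "\<dots> < e" using F_approx(2) assms(2) unfolding dist_real_def by linarith
  finally show ?thesis using F_approx(1) by blast
qed

lemma exists_divide_sq_le:
  fixes s \<epsilon> :: real
  assumes "0 < \<epsilon>"
  shows "\<exists>R>0. s / R\<^sup>2 \<le> \<epsilon>"
proof (intro exI conjI)
  have "0 < \<bar>s\<bar> / \<epsilon> + 1" using assms by (simp add: add_nonneg_pos)
  moreover have "s \<le> \<epsilon> * (\<bar>s\<bar> / \<epsilon> + 1)" using assms by (simp add: distrib_left)
  ultimately show "0 < sqrt (\<bar>s\<bar> / \<epsilon> + 1)" "s / (sqrt (\<bar>s\<bar> / \<epsilon> + 1))\<^sup>2 \<le> \<epsilon>"
    by (simp_all add: pos_divide_le_eq)
qed

theorem ell2_uniformly_tightI: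
  fixes X :: "'i \<Rightarrow> 'w \<Rightarrow> 'a::countable ell2"
  assumes prob_M: "prob_space M" and meas_X: "\<And>i. X i \<in> borel_measurable M"
    and g_summable: "g summable_on UNIV" "\<And>x. 0 \<le> g x"
    and second_moment_le: "\<And>i x. (\<integral>\<^sup>+\<omega>. ennreal ((ell2_nth (X i \<omega>) x)\<^sup>2) \<partial>M) \<le> ennreal (g x)"
  shows "uniformly_tight M X"
proof (rule uniformly_tightI_finite_nets[OF prob_M meas_X])
  fix e d :: real assume e_pos: "0 < e" and d_pos: "0 < d"
  interpret prob_space M by fact
  have tail: "prob {\<omega>\<in>space M. c \<le> norm (ell2_restrict A (X i \<omega>))} \<le> infsum g A / c\<^sup>2" if "0 < c" for i c A
    using prob_M meas_X g_summable second_moment_le that by (rule prob_norm_ell2_restrict_ge)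
  obtain R where R_large: "0 < R" "infsum g UNIV / R\<^sup>2 \<le> e / 2"
    using exists_divide_sq_le[OF half_gt_zero[OF e_pos]] by blast
  obtain F where F_tail: "finite F" "infsum g (- F) < e / 2 * (d / 2)\<^sup>2"
    using summable_on_small_tail[OF g_summable(1), of "e / 2 * (d / 2)\<^sup>2"] e_pos d_pos by auto
  obtain N where N_net: "finite N"
    "{f. norm f \<le> R \<and> norm (ell2_restrict (- F) f) \<le> d / 2} \<subseteq> (\<Union>a\<in>N. cball a d)"
    using finite_net_ell2_small_tail[OF F_tail(1) d_pos] by blast
  have "prob {\<omega>\<in>space M. X i \<omega> \<notin> (\<Union>a\<in>N. cball a d)} \<le> e" for i
  proof -
    note [measurable] = meas_X
    define A where "A c B = {\<omega>\<in>space M. c \<le> norm (ell2_restrict B (X i \<omega>))}" for c B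
    have A_event [measurable]: "A c B \<in> events" for c B unfolding A_def by measurable
    have "ell2_restrict UNIV f = f" for f :: "'a ell2" by (rule ell2_eqI) (simp add: ell2_nth_simps)
    then have "norm (X i \<omega>) \<le> R \<and> norm (ell2_restrict (- F) (X i \<omega>)) \<le> d / 2"
      if "\<omega> \<in> space M" "\<omega> \<notin> A R UNIV \<union> A (d / 2) (- F)" for \<omega> using that by (simp add: A_def)
    then have "{\<omega>\<in>space M. X i \<omega> \<notin> (\<Union>a\<in>N. cball a d)} \<subseteq> A R UNIV \<union> A (d / 2) (- F)"
      using N_net(2) by blast
    then have "prob {\<omega>\<in>space M. X i \<omega> \<notin> (\<Union>a\<in>N. cball a d)} \<le> prob (A R UNIV \<union> A (d / 2) (- F))"
      by (intro finite_measure_mono) measurable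
    also have "\<dots> \<le> prob (A R UNIV) + prob (A (d / 2) (- F))" by (intro measure_subadditive A_event) simp_all
    also have "\<dots> \<le> infsum g UNIV / R\<^sup>2 + infsum g (- F) / (d / 2)\<^sup>2"
      unfolding A_def using R_large(1) d_pos by (intro add_mono tail) auto
    also have "\<dots> \<le> e / 2 + e / 2"
      using R_large(2) F_tail(2) d_pos by (intro add_mono) (simp_all add: divide_le_eq)
    finally show ?thesis by simp
  qed
  with N_net(1) show "\<exists>N. finite N \<and> (\<forall>i. prob {\<omega>\<in>space M. X i \<omega> \<notin> (\<Union>a\<in>N. cball a d)} \<le> e)" by blast
qed

section \<open>Centred normal laws\<close>

definition centered_normal :: "real \<Rightarrow> real measure" where
  "centered_normal v = distr std_normal_distribution borel (\<lambda>z. sqrt v * z)"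

lemma prob_space_std_normal: "prob_space std_normal_distribution"
  by (rule prob_space_normal_density) simp

lemma real_distribution_centered_normal: "real_distribution (centered_normal v)"
  unfolding centered_normal_def by (intro prob_space.real_distribution_distr prob_space_std_normal) simp

lemma centered_normal_0: "centered_normal 0 = return borel 0"
  using prob_space.distr_const[OF prob_space_std_normal, of 0 borel] by (simp add: centered_normal_def)

lemma centered_normal_eq_density:
  assumes "0 < \<sigma>"
  shows "centered_normal (\<sigma>\<^sup>2) = density lborel (normal_density 0 \<sigma>)"
proof -
  interpret prob_space std_normal_distribution by (rule prob_space_std_normal)
  have "distributed std_normal_distribution lborel (\<lambda>z. z) (\<lambda>z. ennreal (std_normal_density z))"
    unfolding distributed_def by (auto simp: distr_id2 sets_eq_imp_space_eq)
  from normal_density_affine[OF this, of \<sigma> 0] assms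
  have "distr std_normal_distribution lborel (\<lambda>z. \<sigma> * z) = density lborel (normal_density 0 \<sigma>)"
    by (simp add: distributed_def)
  moreover have "distr std_normal_distribution lborel (\<lambda>z. \<sigma> * z)
      = distr std_normal_distribution borel (\<lambda>z. \<sigma> * z)"
    by (rule distr_cong) simp_all
  ultimately show ?thesis using assms by (simp add: centered_normal_def)
qed

lemma char_centered_normal:
  assumes "0 \<le> v"
  shows "char (centered_normal v) t = complex_of_real (exp (- (t\<^sup>2 * v) / 2))"
proof -
  have "char (centered_normal v) t = char std_normal_distribution (t * sqrt v)"
    unfolding char_def centered_normal_def by (subst integral_distr) (auto simp: mult.assoc)
  then show ?thesis using assms by (simp add: char_std_normal_distribution power_mult_distrib)
qed

lemma centered_normal_moments:
  assumes "0 \<le> v"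
  shows "(\<integral>x. x \<partial>centered_normal v) = 0" "integrable (centered_normal v) (\<lambda>x. x\<^sup>2)"
    "(\<integral>x. x\<^sup>2 \<partial>centered_normal v) = v"
proof -
  show "(\<integral>x. x \<partial>centered_normal v) = 0"
    using integral_std_normal_distribution_moment_odd[OF odd_one]
    by (simp add: centered_normal_def integral_distr)
  show "integrable (centered_normal v) (\<lambda>x. x\<^sup>2)"
    using integrable_std_normal_distribution_moment[of 2]
    by (simp add: centered_normal_def integrable_distr_eq power_mult_distrib)
  show "(\<integral>x. x\<^sup>2 \<partial>centered_normal v) = v"
    using std_normal_distribution_even_moments(1)[of 1] assms
    by (simp add: centered_normal_def integral_distr power_mult_distrib)
qed

context prob_space
begin

lemma centered_normal_variable_moments:
  assumes meas_U [measurable]: "random_variable borel U" and "0 \<le> v"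
    and law: "distr M borel U = centered_normal v"
  shows "expectation U = 0" "integrable M (\<lambda>\<omega>. (U \<omega>)\<^sup>2)" "expectation (\<lambda>\<omega>. (U \<omega>)\<^sup>2) = v"
proof -
  note moments = centered_normal_moments[OF \<open>0 \<le> v\<close>, folded law]
  show "expectation U = 0" using moments(1) by (simp add: integral_distr)
  show "integrable M (\<lambda>\<omega>. (U \<omega>)\<^sup>2)" using moments(2) by (simp add: integrable_distr_eq)
  show "expectation (\<lambda>\<omega>. (U \<omega>)\<^sup>2) = v" using moments(3) by (simp add: integral_distr)
qed

lemma distr_AE_const:
  assumes "random_variable borel U" "AE \<omega> in M. U \<omega> = c"
  shows "distr M borel U = return borel c"
proof -
  have "distr M borel U = distr M borel (\<lambda>_. c)"
    using assms by (intro distr_cong_AE) simp_all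
  then show ?thesis by simp
qed

lemma distr_gaussian_variable:
  assumes gaussian_U: "gaussian_variable M U" and mean: "expectation U = 0"
    and var: "expectation (\<lambda>\<omega>. U \<omega> * U \<omega>) = v"
  shows "distr M borel U = centered_normal v"
proof -
  have meas_U [measurable]: "random_variable borel U" using gaussian_U by (simp add: gaussian_variable_def)
  consider (normal) \<mu> \<sigma> where "0 < \<sigma>" "distributed M lborel U (normal_density \<mu> \<sigma>)"
    | (const) \<mu> where "AE \<omega> in M. U \<omega> = \<mu>"
    using gaussian_U by (auto simp: gaussian_variable_def)
  then show ?thesis
  proof cases
    case normal
    have "\<mu> = 0" using normal_distributed_expectation[OF normal] mean by simp
    moreover have "v = \<sigma>\<^sup>2"
      using normal_distributed_variance[OF normal] mean var by (simp add: power2_eq_square)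
    moreover have "distr M borel U = distr M lborel U" by (rule distr_cong) simp_all
    ultimately show ?thesis
      using normal by (simp add: distributed_def centered_normal_eq_density)
  next
    case const
    have "expectation U = expectation (\<lambda>_. \<mu>)" using const by (intro integral_cong_AE) auto
    then have "\<mu> = 0" using mean by (simp add: prob_space)
    have "expectation (\<lambda>\<omega>. U \<omega> * U \<omega>) = expectation (\<lambda>_. 0)"
      using const \<open>\<mu> = 0\<close> by (intro integral_cong_AE) auto
    then have "v = 0" using var by simp
    then show ?thesis using distr_AE_const[OF meas_U const] \<open>\<mu> = 0\<close> by (simp add: centered_normal_0)
  qed
qed

lemma gaussian_variable_if_centered_normal:
  assumes meas_U: "random_variable borel U" and "0 \<le> v" and law: "distr M borel U = centered_normal v"
  shows "gaussian_variable M U"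
proof (cases "v = 0")
  case True
  note moments = centered_normal_variable_moments[OF assms]
  have "AE \<omega> in M. (U \<omega>)\<^sup>2 = 0"
    using integral_nonneg_eq_0_iff_AE[OF moments(2)] moments(3) True by simp
  then show ?thesis using meas_U by (auto simp: gaussian_variable_def)
next
  case False
  then have "0 < sqrt v" using \<open>0 \<le> v\<close> by simp
  have "distr M lborel U = distr M borel U" by (rule distr_cong) simp_all
  also have "\<dots> = density lborel (normal_density 0 (sqrt v))"
    using centered_normal_eq_density[OF \<open>0 < sqrt v\<close>] \<open>0 \<le> v\<close> law by simp
  finally have "distributed M lborel U (normal_density 0 (sqrt v))"
    using meas_U by (simp add: distributed_def)
  then show ?thesis using meas_U \<open>0 < sqrt v\<close> by (auto simp: gaussian_variable_def)
qed

end

subsection \<open>Sums of independent variables\<close>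

lemma (in prob_space) norm_sq_sum_indep_vars:
  fixes X :: "'i \<Rightarrow> 'a \<Rightarrow> real" and v :: "'i \<Rightarrow> 'h::real_inner"
  assumes finite_I: "finite I" and indep: "indep_vars (\<lambda>_. borel) X I"
    and square_integrable: "\<And>i. i \<in> I \<Longrightarrow> integrable M (\<lambda>\<omega>. (X i \<omega>)\<^sup>2)"
    and mean: "\<And>i. i \<in> I \<Longrightarrow> expectation (X i) = 0"
  shows "integrable M (\<lambda>\<omega>. (norm (\<Sum>i\<in>I. X i \<omega> *\<^sub>R v i))\<^sup>2)"
    and "expectation (\<lambda>\<omega>. (norm (\<Sum>i\<in>I. X i \<omega> *\<^sub>R v i))\<^sup>2)
      = (\<Sum>i\<in>I. expectation (\<lambda>\<omega>. (X i \<omega>)\<^sup>2) * (norm (v i))\<^sup>2)"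
proof -
  have expand: "(norm (\<Sum>i\<in>I. X i \<omega> *\<^sub>R v i))\<^sup>2 = (\<Sum>i\<in>I. \<Sum>j\<in>I. (X i \<omega> * X j \<omega>) * (v i \<bullet> v j))" for \<omega>
    unfolding power2_norm_eq_inner inner_sum_left inner_sum_right
    by (intro sum.cong refl) (simp add: inner_commute mult.assoc)
  have meas_X: "random_variable borel (X i)" if "i \<in> I" for i using indep that by (simp add: indep_vars_def)
  have integrable: "integrable M (X i)" if "i \<in> I" for i
    using meas_X[OF that] square_integrable[OF that] by (rule square_integrable_imp_integrable)
  have product_moments: "integrable M (\<lambda>\<omega>. X i \<omega> * X j \<omega>) \<and>
      expectation (\<lambda>\<omega>. X i \<omega> * X j \<omega>) = (if i = j then expectation (\<lambda>\<omega>. (X i \<omega>)\<^sup>2) else 0)"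
    if ij_in_I: "i \<in> I" "j \<in> I" for i j
  proof (cases "i = j")
    case False
    have "indep_var borel (X i) borel (\<lambda>\<omega>. \<Sum>k\<in>{j}. X k \<omega>)"
      using False ij_in_I by (intro indep_vars_sum indep_vars_subset[OF indep]) auto
    then have "indep_var borel (X i) borel (X j)" by simp
    from indep_var_integrable[OF this] indep_var_lebesgue_integral[OF this]
    show ?thesis using integrable ij_in_I mean False by simp
  qed (use square_integrable ij_in_I in \<open>simp add: power2_eq_square\<close>)
  show "integrable M (\<lambda>\<omega>. (norm (\<Sum>i\<in>I. X i \<omega> *\<^sub>R v i))\<^sup>2)"
    unfolding expand
    using product_moments by (intro Bochner_Integration.integrable_sum integrable_mult_left) simp
  have "expectation (\<lambda>\<omega>. (norm (\<Sum>i\<in>I. X i \<omega> *\<^sub>R v i))\<^sup>2)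
      = (\<Sum>i\<in>I. \<Sum>j\<in>I. expectation (\<lambda>\<omega>. X i \<omega> * X j \<omega>) * (v i \<bullet> v j))"
    unfolding expand using product_moments by (simp add: Bochner_Integration.integral_sum)
  also have "\<dots> = (\<Sum>i\<in>I. expectation (\<lambda>\<omega>. (X i \<omega>)\<^sup>2) * (norm (v i))\<^sup>2)"
    using finite_I product_moments
    by (intro sum.cong) (auto simp: power2_norm_eq_inner if_distrib[of "\<lambda>u. u * _"] cong: if_cong)
  finally show "expectation (\<lambda>\<omega>. (norm (\<Sum>i\<in>I. X i \<omega> *\<^sub>R v i))\<^sup>2)
      = (\<Sum>i\<in>I. expectation (\<lambda>\<omega>. (X i \<omega>)\<^sup>2) * (norm (v i))\<^sup>2)" .
qed

lemma weak_conv_m_distr_continuous: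
  assumes distr_\<mu>: "\<And>n. real_distribution (\<mu> n)" and distr_\<nu>: "real_distribution \<nu>"
    and conv: "weak_conv_m \<mu> \<nu>"
    and f_cont: "continuous_on UNIV (f :: real \<Rightarrow> real)"
  shows "weak_conv_m (\<lambda>n. distr (\<mu> n) borel f) (distr \<nu> borel f)"
proof (rule integral_bdd_continuous_conv_imp_weak_conv)
  have f_meas: "f \<in> borel_measurable \<kappa>" if "real_distribution \<kappa>" for \<kappa>
    using borel_measurable_continuous_onI[OF f_cont]
    by (simp add: measurable_cong_sets[OF real_distribution.events_eq_borel[OF that] refl])
  have prob: "prob_space \<kappa>" if "real_distribution \<kappa>" for \<kappa> using that by (simp add: real_distribution_def)
  show "real_distribution (distr (\<mu> n) borel f)" for n
    by (intro prob_space.real_distribution_distr prob f_meas distr_\<mu>)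
  show "real_distribution (distr \<nu> borel f)"
    by (intro prob_space.real_distribution_distr prob f_meas distr_\<nu>)
  fix g :: "real \<Rightarrow> real" assume g_bdd_cont: "\<And>x. isCont g x" "\<And>x. \<bar>g x\<bar> \<le> 1"
  have g_meas [measurable]: "g \<in> borel_measurable borel"
    using g_bdd_cont(1) by (intro borel_measurable_continuous_onI continuous_at_imp_continuous_on) simp
  have "isCont f x" for x using f_cont by (simp add: continuous_on_eq_continuous_at)
  from isCont_o2[OF this g_bdd_cont(1)] have gf_cont: "isCont (\<lambda>x. g (f x)) x" for x .
  have "(\<lambda>n. \<integral>x. g (f x) \<partial>\<mu> n) \<longlonglongrightarrow> (\<integral>x. g (f x) \<partial>\<nu>)"
    by (rule weak_conv_imp_integral_bdd_continuous_conv[OF distr_\<mu> distr_\<nu> conv gf_cont, of 1])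
      (simp add: g_bdd_cont(2))
  then show "(\<lambda>n. integral\<^sup>L (distr (\<mu> n) borel f) g) \<longlonglongrightarrow> integral\<^sup>L (distr \<nu> borel f) g"
    using f_meas distr_\<mu> distr_\<nu> by (simp add: integral_distr)
qed

lemma (in prob_space) central_limit_theorem_centered:
  fixes X :: "nat \<Rightarrow> 'a \<Rightarrow> real"
  assumes indep: "indep_vars (\<lambda>_. borel) X UNIV" and mean: "\<And>n. expectation (X n) = 0"
    and square_integrable: "\<And>n. integrable M (\<lambda>\<omega>. (X n \<omega>)\<^sup>2)" and var: "\<And>n. expectation (\<lambda>\<omega>. (X n \<omega>)\<^sup>2) = v"
    and law: "\<And>n. distr M borel (X n) = \<mu>"
  shows "weak_conv_m (\<lambda>n. distr M borel (\<lambda>\<omega>. (\<Sum>i<n. X i \<omega>) / sqrt (real n))) (centered_normal v)"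
proof -
  have [measurable]: "random_variable borel (X n)" for n using indep by (simp add: indep_vars_def)
  have "0 \<le> v" unfolding var[of 0, symmetric] by simp
  then consider (zero) "v = 0" | (pos) "0 < v" "0 < sqrt v" by force
  then show ?thesis
  proof cases
    case zero
    have "AE \<omega> in M. (X n \<omega>)\<^sup>2 = 0" for n
      using integral_nonneg_eq_0_iff_AE[OF square_integrable[of n]] var[of n] zero by simp
    then have "AE \<omega> in M. \<forall>n. X n \<omega> = 0" by (simp add: AE_all_countable)
    then have "distr M borel (\<lambda>\<omega>. (\<Sum>i<n. X i \<omega>) / sqrt (real n)) = return borel 0" for n
      by (intro distr_AE_const) auto
    then show ?thesis using zero by (simp add: centered_normal_0 weak_conv_m_def weak_conv_def)
  next
    case pos
    define S where "S n \<omega> = (\<Sum>i<n. X i \<omega>) / sqrt (real n * (sqrt v)\<^sup>2)" for n \<omega>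
    have [measurable]: "random_variable borel (S n)" for n unfolding S_def by measurable
    have "weak_conv_m (\<lambda>n. distr M borel (S n)) std_normal_distribution"
      unfolding S_def using var mean pos
      by (intro central_limit_theorem_zero_mean[OF indep mean pos(2) square_integrable _ law]) simp
    then have "weak_conv_m (\<lambda>n. distr (distr M borel (S n)) borel (\<lambda>x. sqrt v * x)) (centered_normal v)"
      unfolding centered_normal_def
      by (intro weak_conv_m_distr_continuous real_distribution_distr continuous_intros)
        (simp_all add: real_dist_normal_dist)
    then show ?thesis
      using pos by (simp add: distr_distr comp_def) (simp add: S_def real_sqrt_mult)
  qed
qed

section \<open>Gaussian series\<close>

lemma (in prob_space) distr_sum_indep_std_normal:
  assumes "finite I" and indep: "indep_vars (\<lambda>_. borel) G I"
    and law: "\<And>i. i \<in> I \<Longrightarrow> distr M borel (G i) = std_normal_distribution"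
  shows "distr M borel (\<lambda>\<omega>. \<Sum>i\<in>I. G i \<omega> * c i) = centered_normal (\<Sum>i\<in>I. (c i)\<^sup>2)"
proof (rule Levy_uniqueness)
  have meas_G: "random_variable borel (G i)" if "i \<in> I" for i using indep that by (simp add: indep_vars_def)
  show "real_distribution (distr M borel (\<lambda>\<omega>. \<Sum>i\<in>I. G i \<omega> * c i))"
    using meas_G by (intro real_distribution_distr borel_measurable_sum) simp
  show "real_distribution (centered_normal (\<Sum>i\<in>I. (c i)\<^sup>2))" by (rule real_distribution_centered_normal)
  show "char (distr M borel (\<lambda>\<omega>. \<Sum>i\<in>I. G i \<omega> * c i)) = char (centered_normal (\<Sum>i\<in>I. (c i)\<^sup>2))"
  proof
    fix t
    have scale: "char (distr M borel (\<lambda>\<omega>. G i \<omega> * c i)) t = complex_of_real (exp (- (t * c i)\<^sup>2 / 2))"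
      if "i \<in> I" for i
    proof -
      have "char (distr M borel (\<lambda>\<omega>. G i \<omega> * c i)) t = char (distr M borel (G i)) (t * c i)"
        using meas_G[OF that] by (simp add: char_def integral_distr mult.commute mult.left_commute)
      then show ?thesis by (simp add: law[OF that] char_std_normal_distribution)
    qed
    have "indep_vars (\<lambda>_. borel) (\<lambda>i \<omega>. G i \<omega> * c i) I"
      by (rule indep_vars_compose2[OF indep]) simp
    then have "char (distr M borel (\<lambda>\<omega>. \<Sum>i\<in>I. G i \<omega> * c i)) t
        = (\<Prod>i\<in>I. char (distr M borel (\<lambda>\<omega>. G i \<omega> * c i)) t)"
      by (rule char_distr_sum)
    also have "\<dots> = complex_of_real (exp (\<Sum>i\<in>I. - (t * c i)\<^sup>2 / 2))"
      by (simp add: scale exp_sum \<open>finite I\<close> flip: of_real_prod)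
    also have "(\<Sum>i\<in>I. - (t * c i)\<^sup>2 / 2) = - (t\<^sup>2 * (\<Sum>i\<in>I. (c i)\<^sup>2)) / 2"
      by (simp add: power_mult_distrib sum_distrib_left sum_negf sum_divide_distrib)
    also have "complex_of_real (exp \<dots>) = char (centered_normal (\<Sum>i\<in>I. (c i)\<^sup>2)) t"
      by (simp add: char_centered_normal sum_nonneg)
    finally show "char (distr M borel (\<lambda>\<omega>. \<Sum>i\<in>I. G i \<omega> * c i)) t = char (centered_normal (\<Sum>i\<in>I. (c i)\<^sup>2)) t" .
  qed
qed

lemma (in prob_space) distr_AE_limit_centered_normal:
  fixes U :: "nat \<Rightarrow> 'a \<Rightarrow> real"
  assumes meas_U [measurable]: "\<And>n. random_variable borel (U n)"
    and meas_V [measurable]: "random_variable borel V"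
    and lim: "AE \<omega> in M. (\<lambda>n. U n \<omega>) \<longlonglongrightarrow> V \<omega>"
    and law: "\<And>n. distr M borel (U n) = centered_normal (s n)" and s_lim: "s \<longlonglongrightarrow> v" "\<And>n. 0 \<le> s n"
  shows "distr M borel V = centered_normal v"
proof (rule Levy_uniqueness)
  show "char (distr M borel V) = char (centered_normal v)"
  proof
    fix t
    have "(\<lambda>n. expectation (\<lambda>\<omega>. iexp (t * U n \<omega>))) \<longlonglongrightarrow> expectation (\<lambda>\<omega>. iexp (t * V \<omega>))"
    proof (rule integral_dominated_convergence[where w = "\<lambda>_. 1"])
      show "AE \<omega> in M. (\<lambda>n. iexp (t * U n \<omega>)) \<longlonglongrightarrow> iexp (t * V \<omega>)"
        using lim by eventually_elim (intro tendsto_intros)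
    qed auto
    then have "(\<lambda>n. char (distr M borel (U n)) t) \<longlonglongrightarrow> char (distr M borel V) t"
      by (simp add: char_def integral_distr)
    then have "(\<lambda>n. complex_of_real (exp (- (t\<^sup>2 * s n) / 2))) \<longlonglongrightarrow> char (distr M borel V) t"
      by (simp add: law char_centered_normal s_lim(2))
    moreover have "(\<lambda>n. complex_of_real (exp (- (t\<^sup>2 * s n) / 2))) \<longlonglongrightarrow> complex_of_real (exp (- (t\<^sup>2 * v) / 2))"
      by (intro tendsto_intros s_lim) simp
    moreover have "0 \<le> v" using s_lim by (intro LIMSEQ_le_const[of s]) auto
    ultimately show "char (distr M borel V) t = char (centered_normal v) t"
      by (simp add: char_centered_normal LIMSEQ_unique)
  qed
qed (simp_all add: real_distribution_centered_normal)

lemma iid_std_normal_sequence: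
  defines "\<Omega> \<equiv> PiM (UNIV :: nat set) (\<lambda>_. std_normal_distribution)"
  shows "prob_space \<Omega>" "prob_space.indep_vars \<Omega> (\<lambda>_. borel) (\<lambda>k \<omega>. \<omega> k) UNIV"
    "distr \<Omega> borel (\<lambda>\<omega>. \<omega> k) = std_normal_distribution"
proof -
  interpret S: prob_space std_normal_distribution by (rule prob_space_std_normal)
  interpret product_prob_space "\<lambda>_. std_normal_distribution" "UNIV :: nat set"
    by unfold_locales
  interpret \<Omega>: prob_space \<Omega> unfolding \<Omega>_def by (rule prob_space_axioms)
  show "prob_space \<Omega>" by (rule \<Omega>.prob_space_axioms)
  have sets: "sets \<Omega> = sets borel"
    unfolding \<Omega>_def sets_PiM_equal_borel[symmetric] by (intro sets_PiM_cong) auto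
  have law: "distr \<Omega> borel (\<lambda>\<omega>. \<omega> k) = std_normal_distribution" for k
    using PiM_component[of k] distr_cong[of \<Omega> \<Omega> borel std_normal_distribution "\<lambda>\<omega>. \<omega> k" "\<lambda>\<omega>. \<omega> k"]
    by (simp add: \<Omega>_def)
  then show "distr \<Omega> borel (\<lambda>\<omega>. \<omega> k) = std_normal_distribution" .
  have meas: "(\<lambda>\<omega>. \<omega> k) \<in> borel_measurable \<Omega>" for k
    unfolding measurable_cong_sets[OF sets refl]
    by (intro borel_measurable_continuous_onI continuous_on_product_coordinates)
  show "\<Omega>.indep_vars (\<lambda>_. borel) (\<lambda>k \<omega>. \<omega> k) UNIV"
  proof (subst \<Omega>.indep_vars_iff_distr_eq_PiM)
    show "distr \<Omega> (Pi\<^sub>M UNIV (\<lambda>_. borel)) (\<lambda>x. \<lambda>i\<in>UNIV. x i) = Pi\<^sub>M UNIV (\<lambda>i. distr \<Omega> borel (\<lambda>\<omega>. \<omega> i))"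
      unfolding law \<Omega>_def[symmetric] restrict_UNIV
      by (intro distr_id2) (simp add: sets sets_PiM_equal_borel)
  qed (auto intro: meas)
qed

lemma (in prob_space) expectation_less_if_sq_less:
  fixes D :: "'a \<Rightarrow> real"
  assumes meas_D: "random_variable borel D" and square_integrable: "integrable M (\<lambda>\<omega>. (D \<omega>)\<^sup>2)"
    and second_moment_less: "expectation (\<lambda>\<omega>. (D \<omega>)\<^sup>2) < e\<^sup>2" and e_pos: "0 < e"
  shows "expectation D < e"
proof -
  have "integrable M D" using meas_D square_integrable by (rule square_integrable_imp_integrable)
  then have "(expectation D)\<^sup>2 \<le> expectation (\<lambda>\<omega>. (D \<omega>)\<^sup>2)"
    using variance_eq[OF _ square_integrable] variance_positive[of D] by simp
  then show ?thesis
    using second_moment_less e_pos by (intro power2_less_imp_less[of "expectation D" e]) auto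
qed

lemma (in prob_space) random_series_AE_Cauchy_subseq:
  fixes G :: "nat \<Rightarrow> 'a \<Rightarrow> real" and v :: "nat \<Rightarrow> 'h::{real_inner, banach, second_countable_topology}"
  assumes indep: "indep_vars (\<lambda>_. borel) G UNIV" and mean: "\<And>k. expectation (G k) = 0"
    and square_integrable: "\<And>k. integrable M (\<lambda>\<omega>. (G k \<omega>)\<^sup>2)" and var: "\<And>k. expectation (\<lambda>\<omega>. (G k \<omega>)\<^sup>2) = 1"
    and v_summable: "summable (\<lambda>k. (norm (v k))\<^sup>2)"
  obtains r where "strict_mono r" "AE \<omega> in M. Cauchy (\<lambda>n. \<Sum>k<r n. G k \<omega> *\<^sub>R v k)"
proof -
  define s where "s n \<omega> = (\<Sum>k<n. G k \<omega> *\<^sub>R v k)" for n \<omega>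
  have meas_G [measurable]: "random_variable borel (G k)" for k using indep by (simp add: indep_vars_def)
  have G_int: "integrable M (G k)" for k
    using meas_G square_integrable by (rule square_integrable_imp_integrable)
  have s_int: "integrable M (s n)" for n
    unfolding s_def by (intro Bochner_Integration.integrable_sum integrable_scaleR_left G_int)
  note [measurable] = borel_measurable_integrable[OF s_int]
  have expectation_diff_less: "expectation (\<lambda>\<omega>. norm (s n \<omega> - s m \<omega>)) < e"
    if "m \<le> n" "(\<Sum>k=m..<n. (norm (v k))\<^sup>2) < e\<^sup>2" "0 < e" for m n e
  proof -
    have diff: "s n \<omega> - s m \<omega> = (\<Sum>k=m..<n. G k \<omega> *\<^sub>R v k)" for \<omega>
      unfolding s_def lessThan_atLeast0 using sum_diff_nat_ivl[of 0 m n] that(1) by simp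
    have "indep_vars (\<lambda>_. borel) G {m..<n}" by (rule indep_vars_subset[OF indep]) simp
    note moments = norm_sq_sum_indep_vars[OF finite_atLeastLessThan this square_integrable mean, of v]
    show ?thesis
    proof (rule expectation_less_if_sq_less[OF _ _ _ that(3)])
      show "integrable M (\<lambda>\<omega>. (norm (s n \<omega> - s m \<omega>))\<^sup>2)" unfolding diff by (rule moments(1))
      show "expectation (\<lambda>\<omega>. (norm (s n \<omega> - s m \<omega>))\<^sup>2) < e\<^sup>2"
        unfolding diff moments(2) using that(2) by (simp add: var)
    qed measurable
  qed
  have "\<exists>N. \<forall>i\<ge>N. \<forall>j\<ge>N. expectation (\<lambda>\<omega>. norm (s i \<omega> - s j \<omega>)) < e" if e_pos: "0 < e" for e
  proof -
    obtain N where N_tail: "\<forall>m\<ge>N. \<forall>n. norm (\<Sum>k=m..<n. (norm (v k))\<^sup>2) < e\<^sup>2"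
      using summable_Cauchy[THEN iffD1, OF v_summable, rule_format, of "e\<^sup>2"] e_pos by auto
    then have tail: "(\<Sum>k=m..<n. (norm (v k))\<^sup>2) < e\<^sup>2" if "N \<le> m" for m n
      using that by (auto simp: sum_nonneg)
    have "expectation (\<lambda>\<omega>. norm (s i \<omega> - s j \<omega>)) < e" if "N \<le> i" "N \<le> j" for i j
      using expectation_diff_less[of j i e] expectation_diff_less[of i j e] tail that e_pos
      by (cases "i \<le> j") (simp_all add: norm_minus_commute)
    then show ?thesis by blast
  qed
  from cauchy_L1_AE_cauchy_subseq[OF s_int this] show thesis
    using that unfolding s_def by blast
qed

lemma summable_inner_sq:
  assumes "summable (\<lambda>k. (norm (v k))\<^sup>2)"
  shows "summable (\<lambda>k. (v k \<bullet> h)\<^sup>2)"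
proof (rule summable_comparison_test'[OF summable_mult2[OF assms, of "(norm h)\<^sup>2"]])
  show "norm ((v k \<bullet> h)\<^sup>2) \<le> (norm (v k))\<^sup>2 * (norm h)\<^sup>2" for k
    using power_mono[OF Cauchy_Schwarz_ineq2[of "v k" h], of 2] by (simp add: power_mult_distrib)
qed

theorem gaussian_series_exists:
  fixes v :: "nat \<Rightarrow> 'h::{real_inner, banach, second_countable_topology}"
  assumes v_summable: "summable (\<lambda>k. (norm (v k))\<^sup>2)"
  shows "\<exists>N :: 'h measure. prob_space N \<and> sets N = sets borel \<and>
    (\<forall>h. distr N borel (\<lambda>y. y \<bullet> h) = centered_normal (\<Sum>k. (v k \<bullet> h)\<^sup>2))"
proof -
  define \<Omega> where "\<Omega> = PiM (UNIV :: nat set) (\<lambda>_. std_normal_distribution)"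
  note \<Omega>_iid = iid_std_normal_sequence[folded \<Omega>_def]
  interpret \<Omega>: prob_space \<Omega> by (rule \<Omega>_iid(1))
  have coord [measurable]: "(\<lambda>\<omega>. \<omega> k) \<in> borel_measurable \<Omega>" for k
    using \<Omega>_iid(2) by (simp add: \<Omega>.indep_vars_def)
  have "centered_normal 1 = std_normal_distribution" using centered_normal_eq_density[of 1] by simp
  then have law: "distr \<Omega> borel (\<lambda>\<omega>. \<omega> k) = centered_normal 1" for k by (simp add: \<Omega>_iid(3))
  note moments = \<Omega>.centered_normal_variable_moments[OF coord zero_le_one law]
  obtain r where r_mono: "strict_mono r" and Cauchy: "AE \<omega> in \<Omega>. Cauchy (\<lambda>n. \<Sum>k<r n. \<omega> k *\<^sub>R v k)"
    by (rule \<Omega>.random_series_AE_Cauchy_subseq[OF \<Omega>_iid(2) moments v_summable])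
  define Y where "Y \<omega> = lim (\<lambda>n. \<Sum>k<r n. \<omega> k *\<^sub>R v k)" for \<omega> :: "nat \<Rightarrow> real"
  have meas_Y [measurable]: "Y \<in> borel_measurable \<Omega>"
    unfolding Y_def by (intro borel_measurable_lim_metric) measurable
  have Y_lim: "AE \<omega> in \<Omega>. (\<lambda>n. \<Sum>k<r n. \<omega> k *\<^sub>R v k) \<longlonglongrightarrow> Y \<omega>"
    using Cauchy by eventually_elim (simp add: Y_def Cauchy_convergent convergent_LIMSEQ_iff[symmetric])
  have "distr \<Omega> borel (\<lambda>\<omega>. Y \<omega> \<bullet> h) = centered_normal (\<Sum>k. (v k \<bullet> h)\<^sup>2)" for h
  proof (rule \<Omega>.distr_AE_limit_centered_normal)
    show "AE \<omega> in \<Omega>. (\<lambda>n. \<Sum>k<r n. \<omega> k * (v k \<bullet> h)) \<longlonglongrightarrow> Y \<omega> \<bullet> h"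
      using Y_lim
    proof eventually_elim
      case (elim \<omega>)
      then have "(\<lambda>n. (\<Sum>k<r n. \<omega> k *\<^sub>R v k) \<bullet> h) \<longlonglongrightarrow> Y \<omega> \<bullet> h" by (intro tendsto_intros)
      then show ?case by (simp add: inner_sum_left)
    qed
    show "distr \<Omega> borel (\<lambda>\<omega>. \<Sum>k<r n. \<omega> k * (v k \<bullet> h)) = centered_normal (\<Sum>k<r n. (v k \<bullet> h)\<^sup>2)" for n
      by (intro \<Omega>.distr_sum_indep_std_normal \<Omega>.indep_vars_subset[OF \<Omega>_iid(2)] \<Omega>_iid(3)) auto
    show "(\<lambda>n. \<Sum>k<r n. (v k \<bullet> h)\<^sup>2) \<longlonglongrightarrow> (\<Sum>k. (v k \<bullet> h)\<^sup>2)"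
      using LIMSEQ_subseq_LIMSEQ[OF summable_LIMSEQ[OF summable_inner_sq[OF v_summable]] r_mono]
      by (simp add: comp_def)
  qed (auto intro: sum_nonneg)
  moreover have "distr (distr \<Omega> borel Y) borel (\<lambda>y. y \<bullet> h) = distr \<Omega> borel (\<lambda>\<omega>. Y \<omega> \<bullet> h)" for h
    by (subst distr_distr) (auto simp: comp_def)
  ultimately show ?thesis
    by (intro exI[of _ "distr \<Omega> borel Y"]) (simp add: \<Omega>.prob_space_distr)
qed

lemma gaussian_processI_centered_normal:
  fixes N :: "'h::real_inner measure"
  assumes prob_N: "prob_space N" "sets N = sets borel"
    and C_covariance: "linear C" "\<And>u w. C u \<bullet> w = C w \<bullet> u" "\<And>h. 0 \<le> C h \<bullet> h"
    and law: "\<And>h. distr N borel (\<lambda>y. y \<bullet> h) = centered_normal (C h \<bullet> h)"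
  shows "gaussian_process N (\<lambda>y. y) 0 C"
proof -
  interpret N: prob_space N by fact
  have meas: "(\<lambda>y. y \<bullet> h) \<in> borel_measurable N" for h
    unfolding measurable_cong_sets[OF prob_N(2) refl]
    by (intro borel_measurable_continuous_onI continuous_intros)
  note moments = N.centered_normal_variable_moments[OF meas C_covariance(3) law]
  have "(\<integral>y. (y \<bullet> u) * (y \<bullet> w) \<partial>N) = C u \<bullet> w" for u w
  proof -
    have "(\<integral>y. (y \<bullet> u) * (y \<bullet> w) \<partial>N) = (\<integral>y. ((y \<bullet> (u + w))\<^sup>2 - (y \<bullet> u)\<^sup>2 - (y \<bullet> w)\<^sup>2) / 2 \<partial>N)"
      by (intro Bochner_Integration.integral_cong) (auto simp: inner_add_right power2_sum)
    also have "\<dots> = (C (u + w) \<bullet> (u + w) - C u \<bullet> u - C w \<bullet> w) / 2" by (simp add: moments)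
    also have "\<dots> = C u \<bullet> w"
      using C_covariance(2)[of w u]
      by (simp add: linear_add[OF C_covariance(1)] inner_add_left inner_add_right)
    finally show ?thesis .
  qed
  then show ?thesis
    unfolding gaussian_process_def
    using prob_N(1) moments(1) N.gaussian_variable_if_centered_normal[OF meas C_covariance(3) law]
    by (simp add: measurable_cong_sets[OF prob_N(2) refl])
qed

section \<open>The covariance of a probability mass function\<close>

lemma integrable_pmf_ell2_nth: "integrable (measure_pmf p) (ell2_nth h)"
  by (rule measure_pmf.integrable_const_bound[of _ "norm h"]) (auto simp: abs_ell2_nth_le_norm)

lemma integrable_pmf_ell2_nth_mult: "integrable (measure_pmf p) (\<lambda>x. ell2_nth h x * ell2_nth k x)"
  by (rule measure_pmf.integrable_const_bound[of _ "norm h * norm k"])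
    (auto simp: abs_mult intro!: mult_mono abs_ell2_nth_le_norm)

lemma inner_ell2_of_pmf: "ell2_of_pmf p \<bullet> h = measure_pmf.expectation p (ell2_nth h)"
proof -
  have "(\<lambda>x. pmf p x * ell2_nth h x) summable_on UNIV"
    using summable_ell2_nth_mult[of "ell2_of_pmf p" h] by (simp add: ell2_of_pmf.rep_eq)
  then have "Infinite_Set_Sum.abs_summable_on (\<lambda>x. pmf p x * ell2_nth h x) UNIV"
    unfolding abs_summable_equivalent[symmetric] by (rule summable_on_iff_abs_summable_on_real[THEN iffD1])
  then show ?thesis
    by (simp add: inner_ell2.rep_eq ell2_of_pmf.rep_eq pmf_expectation_eq_infsetsum infsetsum_infsum)
qed

definition pmf_covariance :: "'a pmf \<Rightarrow> 'a ell2 \<Rightarrow> 'a ell2 \<Rightarrow> real" where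
  "pmf_covariance p h k = measure_pmf.expectation p
    (\<lambda>x. (ell2_nth h x - ell2_of_pmf p \<bullet> h) * (ell2_nth k x - ell2_of_pmf p \<bullet> k))"

lemma pmf_covariance_eq:
  "pmf_covariance p h k = measure_pmf.expectation p (\<lambda>x. ell2_nth h x * ell2_nth k x)
     - (ell2_of_pmf p \<bullet> h) * (ell2_of_pmf p \<bullet> k)"
proof -
  define a b where "a = ell2_of_pmf p \<bullet> h" and "b = ell2_of_pmf p \<bullet> k"
  have "pmf_covariance p h k = measure_pmf.expectation p
      (\<lambda>x. ell2_nth h x * ell2_nth k x - b * ell2_nth h x - a * ell2_nth k x + a * b)"
    unfolding pmf_covariance_def a_def[symmetric] b_def[symmetric]
    by (intro Bochner_Integration.integral_cong) (simp_all add: algebra_simps)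
  then show ?thesis
    by (simp add: integrable_pmf_ell2_nth integrable_pmf_ell2_nth_mult flip: inner_ell2_of_pmf)
      (simp add: a_def b_def)
qed

lemma pmf_covariance_commute: "pmf_covariance p h k = pmf_covariance p k h"
  by (simp add: pmf_covariance_def mult.commute)

lemma pmf_covariance_nonneg: "0 \<le> pmf_covariance p h h"
  by (simp add: pmf_covariance_def)

lemma bounded_linear_pmf_covariance: "bounded_linear (\<lambda>h. pmf_covariance p h k)"
proof -
  have "bounded_linear (\<lambda>h. measure_pmf.expectation p (\<lambda>x. ell2_nth h x * ell2_nth k x))"
  proof (rule bounded_linear_intro[of _ "norm k"])
    fix h :: "'a ell2"
    have "\<bar>measure_pmf.expectation p (\<lambda>x. ell2_nth h x * ell2_nth k x)\<bar>
        \<le> measure_pmf.expectation p (\<lambda>x. \<bar>ell2_nth h x * ell2_nth k x\<bar>)" by (rule integral_abs_bound)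
    also have "\<dots> \<le> measure_pmf.expectation p (\<lambda>x. norm h * norm k)"
      using integrable_abs[OF integrable_pmf_ell2_nth_mult[of p h k]]
      by (intro integral_mono) (simp_all add: abs_mult mult_mono abs_ell2_nth_le_norm)
    finally show "norm (measure_pmf.expectation p (\<lambda>x. ell2_nth h x * ell2_nth k x)) \<le> norm h * norm k"
      by simp
  qed (simp_all add: ell2_nth_simps distrib_right integrable_pmf_ell2_nth_mult mult.assoc)
  then show ?thesis
    unfolding pmf_covariance_eq
    by (intro bounded_linear_sub bounded_linear_mult_const bounded_linear_inner_right)
qed

lemma pmf_covariance_ell2_basis:
  "pmf_covariance p (ell2_basis i) (ell2_basis j) = pmf p i * (if i = j then 1 else 0) - pmf p i * pmf p j"
proof -
  have "measure_pmf.expectation p (\<lambda>x. ell2_nth (ell2_basis i) x * ell2_nth (ell2_basis j) x)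
      = measure_pmf.expectation p (\<lambda>x. indicator {i} x * (if i = j then 1 else 0))"
    by (intro Bochner_Integration.integral_cong) (auto simp: ell2_basis.rep_eq indicator_def)
  also have "\<dots> = pmf p i * (if i = j then 1 else 0)" by (simp add: measure_pmf_single)
  finally show ?thesis by (simp add: pmf_covariance_eq inner_ell2_basis ell2_of_pmf.rep_eq)
qed

lemma covariance_operator_inner:
  assumes C_linear: "bounded_linear C"
    and basis: "\<And>i i'. C (ell2_basis i) \<bullet> ell2_basis i' =
      pmf p i * (if i = i' then 1 else 0) - pmf p i * pmf p i'"
  shows "C u \<bullet> v = pmf_covariance p u v"
proof (rule bilinear_eq_on_ell2_basis[where b = "\<lambda>u v. C u \<bullet> v"])
  show "bounded_linear (\<lambda>u. C u \<bullet> v)" for v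
    by (rule bounded_linear_compose[OF bounded_linear_inner_left C_linear])
  show "bounded_linear (pmf_covariance p u)" for u
    unfolding pmf_covariance_commute[of p u, abs_def] by (rule bounded_linear_pmf_covariance)
qed (simp_all add: basis pmf_covariance_ell2_basis bounded_linear_inner_right bounded_linear_pmf_covariance)

lemma pmf_expectation_sums:
  fixes q :: "nat pmf" and g :: "nat \<Rightarrow> real"
  assumes "integrable (measure_pmf q) g"
  shows "(\<lambda>k. pmf q k * g k) sums measure_pmf.expectation q g"
proof -
  have "integrable (count_space UNIV) (\<lambda>k. pmf q k * g k)"
    using assms unfolding measure_pmf_eq_density by (subst (asm) integrable_density) auto
  then have "(\<lambda>k. pmf q k * g k) sums (\<integral>k. pmf q k * g k \<partial>count_space UNIV)"
    by (rule sums_integral_count_space_nat)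
  then show ?thesis unfolding measure_pmf_eq_density by (subst integral_density) auto
qed

theorem gaussian_process_pmf_covariance_exists:
  fixes p :: "'a::countable pmf"
  assumes C_covariance: "linear C" "\<And>u v. C u \<bullet> v = pmf_covariance p u v"
  shows "\<exists>N :: 'a ell2 measure. gaussian_process N (\<lambda>y. y) 0 C"
proof -
  define q where "q = map_pmf to_nat p"
  define v where "v k = sqrt (pmf q k) *\<^sub>R (ell2_basis (from_nat k) - ell2_of_pmf p)" for k
  have sums: "(\<lambda>k. pmf q k * g (from_nat k)) sums measure_pmf.expectation p g"
    if "integrable (measure_pmf p) g" for g :: "'a \<Rightarrow> real"
    using that pmf_expectation_sums[of q "\<lambda>k. g (from_nat k)"] by (simp add: q_def)
  have "norm ((norm (ell2_basis x - ell2_of_pmf p))\<^sup>2) \<le> (1 + norm (ell2_of_pmf p))\<^sup>2" for x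
    using norm_triangle_ineq4[of "ell2_basis x" "ell2_of_pmf p"] by (simp add: norm_ell2_basis power_mono)
  then have "integrable (measure_pmf p) (\<lambda>x. (norm (ell2_basis x - ell2_of_pmf p))\<^sup>2)"
    by (intro measure_pmf.integrable_const_bound[where B = "(1 + norm (ell2_of_pmf p))\<^sup>2"] AE_I2) simp_all
  from sums[OF this] have "summable (\<lambda>k. (norm (v k))\<^sup>2)"
    by (simp add: v_def power_mult_distrib sums_iff)
  then obtain N :: "'a ell2 measure" where prob_N: "prob_space N" "sets N = sets borel"
    and law: "\<forall>h. distr N borel (\<lambda>y. y \<bullet> h) = centered_normal (\<Sum>k. (v k \<bullet> h)\<^sup>2)"
    using gaussian_series_exists by blast
  have var: "(\<Sum>k. (v k \<bullet> h)\<^sup>2) = pmf_covariance p h h" for h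
  proof -
    have "(v k \<bullet> h)\<^sup>2 = pmf q k * (ell2_nth h (from_nat k) - ell2_of_pmf p \<bullet> h)\<^sup>2" for k
      by (simp add: v_def power_mult_distrib inner_diff_left inner_commute[of "ell2_basis _"]
          inner_ell2_basis)
    moreover have "integrable (measure_pmf p) (\<lambda>x. (ell2_nth h x - ell2_of_pmf p \<bullet> h)\<^sup>2)"
      unfolding power2_diff using integrable_pmf_ell2_nth_mult[of p h h] integrable_pmf_ell2_nth[of p h]
      by (simp add: power2_eq_square)
    ultimately show ?thesis
      using sums[of "\<lambda>x. (ell2_nth h x - ell2_of_pmf p \<bullet> h)\<^sup>2"]
      by (simp add: sums_iff pmf_covariance_def power2_eq_square)
  qed
  have "gaussian_process N (\<lambda>y. y) 0 C"
    using law by (intro gaussian_processI_centered_normal prob_N C_covariance(1))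
      (simp_all add: C_covariance(2) var pmf_covariance_commute pmf_covariance_nonneg)
  then show ?thesis ..
qed

section \<open>The central limit theorem for the empirical distribution\<close>

lemma (in prob_space) indep_vars_reindex:
  assumes inj: "inj_on f I" and indep: "indep_vars M' X (f ` I)"
  shows "indep_vars (\<lambda>i. M' (f i)) (\<lambda>i. X (f i)) I"
  unfolding indep_vars_def2
proof (intro conjI ballI)
  show "random_variable (M' (f i)) (X (f i))" if "i \<in> I" for i
    using indep that by (simp add: indep_vars_def2)
  have sets: "indep_sets (\<lambda>i. {X i -` A \<inter> space M |A. A \<in> sets (M' i)}) (f ` I)"
    using indep by (simp add: indep_vars_def2)
  show "indep_sets (\<lambda>i. {X (f i) -` A \<inter> space M |A. A \<in> sets (M' (f i))}) I"
  proof (rule indep_setsI)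
    show "{X (f i) -` A \<inter> space M |A. A \<in> sets (M' (f i))} \<subseteq> events" if "i \<in> I" for i
      using sets that by (auto simp: indep_sets_def)
    fix A J assume J_finite: "J \<noteq> {}" "J \<subseteq> I" "finite J"
      and A_in_family: "\<forall>i\<in>J. A i \<in> {X (f i) -` A \<inter> space M |A. A \<in> sets (M' (f i))}"
    have inj_J: "inj_on f J" using inj J_finite(2) by (rule inj_on_subset)
    have "prob (\<Inter>k\<in>f ` J. A (the_inv_into J f k)) = (\<Prod>k\<in>f ` J. prob (A (the_inv_into J f k)))"
      using J_finite A_in_family by (intro indep_setsD[OF sets]) (auto simp: the_inv_into_f_f[OF inj_J])
    then show "prob (\<Inter>j\<in>J. A j) = (\<Prod>j\<in>J. prob (A j))"
      by (simp add: prod.reindex[OF inj_J] the_inv_into_f_f[OF inj_J])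
  qed
qed

definition empirical_ell2 :: "(nat \<Rightarrow> 'w \<Rightarrow> 'a) \<Rightarrow> nat \<Rightarrow> 'w \<Rightarrow> 'a ell2" where
  "empirical_ell2 Z n \<omega> = (1 / real n) *\<^sub>R (\<Sum>j=1..n. ell2_basis (Z j \<omega>))"

lemma ell2_nth_empirical_ell2: "ell2_nth (empirical_ell2 Z n \<omega>) x = empirical_pmf Z n \<omega> x"
  by (auto simp: empirical_ell2_def empirical_pmf_def ell2_nth_simps of_bool_def intro!: sum.cong)

definition empirical_fluctuation :: "(nat \<Rightarrow> 'w \<Rightarrow> 'a) \<Rightarrow> 'a pmf \<Rightarrow> nat \<Rightarrow> 'w \<Rightarrow> 'a ell2" where
  "empirical_fluctuation Z p n \<omega> = sqrt (real n) *\<^sub>R (empirical_ell2 Z n \<omega> - ell2_of_pmf p)"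

lemma empirical_fluctuation_eq_sum:
  "empirical_fluctuation Z p n \<omega> = (\<Sum>i<n. ell2_basis (Z (Suc i) \<omega>) - ell2_of_pmf p) /\<^sub>R sqrt (real n)"
proof (cases "n = 0")
  case False
  have "(\<Sum>j=1..n. ell2_basis (Z j \<omega>)) = (\<Sum>i<n. ell2_basis (Z (Suc i) \<omega>))"
    by (rule sum.reindex_bij_witness[of _ Suc "\<lambda>j. j - 1"]) auto
  then have "empirical_ell2 Z n \<omega> - ell2_of_pmf p
      = (\<Sum>i<n. ell2_basis (Z (Suc i) \<omega>) - ell2_of_pmf p) /\<^sub>R real n"
    using False
    by (simp add: empirical_ell2_def sum_subtractf sum_constant_scaleR scaleR_diff_right divide_inverse)
  then show ?thesis
    using False by (simp add: empirical_fluctuation_def real_div_sqrt field_simps)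
qed (simp add: empirical_fluctuation_def)

locale iid_sample = prob_space M for M :: "'w measure" +
  fixes Z :: "nat \<Rightarrow> 'w \<Rightarrow> 'a::countable" and p :: "'a pmf"
  assumes Z_indep: "indep_vars (\<lambda>_. count_space UNIV) Z {1..}"
    and Z_distr: "\<And>j. 1 \<le> j \<Longrightarrow> distr M (count_space UNIV) (Z j) = measure_pmf p"
begin

lemma measurable_Z: "1 \<le> j \<Longrightarrow> Z j \<in> measurable M (count_space UNIV)"
  using Z_indep by (simp add: indep_vars_def)

lemma measurable_empirical_fluctuation: "empirical_fluctuation Z p n \<in> borel_measurable M"
proof -
  have [measurable]: "Z (Suc i) \<in> measurable M (count_space UNIV)" for i by (rule measurable_Z) simp
  show ?thesis unfolding empirical_fluctuation_eq_sum[abs_def] by measurable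
qed

definition deviation :: "'a ell2 \<Rightarrow> nat \<Rightarrow> 'w \<Rightarrow> real" where
  "deviation h i \<omega> = ell2_nth h (Z (Suc i) \<omega>) - ell2_of_pmf p \<bullet> h"

lemma empirical_fluctuation_inner:
  "empirical_fluctuation Z p n \<omega> \<bullet> h = (\<Sum>i<n. deviation h i \<omega>) / sqrt (real n)"
  by (simp add: empirical_fluctuation_eq_sum deviation_def inner_sum_left inner_diff_left
      inner_commute[of "ell2_basis _"] inner_ell2_basis divide_inverse mult.commute)

lemma distr_deviation:
  "distr M borel (deviation h i) = distr (measure_pmf p) borel (\<lambda>x. ell2_nth h x - ell2_of_pmf p \<bullet> h)"
  unfolding Z_distr[of "Suc i", simplified, symmetric] deviation_def[abs_def]
  by (subst distr_distr) (auto intro: measurable_Z simp: comp_def)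

lemma indep_vars_deviation: "indep_vars (\<lambda>_. borel) (deviation h) UNIV"
proof -
  have "indep_vars (\<lambda>_. count_space UNIV) Z (range Suc)" by (rule indep_vars_subset[OF Z_indep]) auto
  from indep_vars_reindex[OF inj_Suc this]
  show ?thesis unfolding deviation_def[abs_def] by (rule indep_vars_compose2) simp
qed

lemma measurable_deviation: "deviation h i \<in> borel_measurable M"
  using indep_vars_deviation by (simp add: indep_vars_def)

lemma expectation_deviation:
  assumes [measurable]: "g \<in> borel_measurable borel"
  shows "expectation (\<lambda>\<omega>. g (deviation h i \<omega>))
    = measure_pmf.expectation p (\<lambda>x. g (ell2_nth h x - ell2_of_pmf p \<bullet> h) :: real)"
proof -
  note [measurable] = measurable_deviation
  have "expectation (\<lambda>\<omega>. g (deviation h i \<omega>)) = integral\<^sup>L (distr M borel (deviation h i)) g"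
    by (simp add: integral_distr)
  then show ?thesis unfolding distr_deviation by (simp add: integral_distr)
qed

lemma deviation_mean: "expectation (deviation h i) = 0"
  using expectation_deviation[of "\<lambda>u. u" h i] by (simp add: integrable_pmf_ell2_nth inner_ell2_of_pmf)

lemma deviation_square: "expectation (\<lambda>\<omega>. (deviation h i \<omega>)\<^sup>2) = pmf_covariance p h h"
  using expectation_deviation[of power2 h i] by (simp add: pmf_covariance_def power2_eq_square)

lemma deviation_square_integrable: "integrable M (\<lambda>\<omega>. (deviation h i \<omega>)\<^sup>2)"
proof (rule integrable_const_bound[of _ "(norm h + \<bar>ell2_of_pmf p \<bullet> h\<bar>)\<^sup>2"])
  have "\<bar>deviation h i \<omega>\<bar> \<le> norm h + \<bar>ell2_of_pmf p \<bullet> h\<bar>" for \<omega>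
    using abs_ell2_nth_le_norm[of h "Z (Suc i) \<omega>"] unfolding deviation_def by linarith
  then have "(deviation h i \<omega>)\<^sup>2 \<le> (norm h + \<bar>ell2_of_pmf p \<bullet> h\<bar>)\<^sup>2" for \<omega>
    using power_mono[of "\<bar>deviation h i \<omega>\<bar>" _ 2] by simp
  then show "AE \<omega> in M. norm ((deviation h i \<omega>)\<^sup>2) \<le> (norm h + \<bar>ell2_of_pmf p \<bullet> h\<bar>)\<^sup>2" by simp
qed (use measurable_deviation in measurable)

lemma empirical_fluctuation_second_moment:
  "integrable M (\<lambda>\<omega>. (empirical_fluctuation Z p n \<omega> \<bullet> h)\<^sup>2)"
  "expectation (\<lambda>\<omega>. (empirical_fluctuation Z p n \<omega> \<bullet> h)\<^sup>2) \<le> pmf_covariance p h h"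
proof -
  have inner_sq: "(empirical_fluctuation Z p n \<omega> \<bullet> h)\<^sup>2 = (norm (\<Sum>i<n. deviation h i \<omega> *\<^sub>R (1::real)))\<^sup>2 / n" for \<omega>
    by (simp add: empirical_fluctuation_inner power_divide)
  note moments = norm_sq_sum_indep_vars[OF finite_lessThan
      indep_vars_subset[OF indep_vars_deviation subset_UNIV] deviation_square_integrable deviation_mean, of h "\<lambda>_. 1::real" n]
  show "integrable M (\<lambda>\<omega>. (empirical_fluctuation Z p n \<omega> \<bullet> h)\<^sup>2)"
    unfolding inner_sq using moments(1) by (rule integrable_divide)
  show "expectation (\<lambda>\<omega>. (empirical_fluctuation Z p n \<omega> \<bullet> h)\<^sup>2) \<le> pmf_covariance p h h"
    unfolding inner_sq integral_divide_zero moments(2) by (simp add: deviation_square pmf_covariance_nonneg)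
qed

lemma empirical_fluctuation_tight: "uniformly_tight M (empirical_fluctuation Z p)"
proof (rule ell2_uniformly_tightI[OF prob_space_axioms measurable_empirical_fluctuation])
  show "pmf p summable_on UNIV"
    using pmf_abs_summable[of p UNIV] by (simp add: abs_summable_equivalent[symmetric])
  fix n x
  note moment =
    empirical_fluctuation_second_moment[where h = "ell2_basis x" and n = n, unfolded inner_ell2_basis]
  have "expectation (\<lambda>\<omega>. (ell2_nth (empirical_fluctuation Z p n \<omega>) x)\<^sup>2) \<le> pmf p x"
    using moment(2) by (rule order_trans) (simp add: pmf_covariance_ell2_basis)
  then show "(\<integral>\<^sup>+\<omega>. ennreal ((ell2_nth (empirical_fluctuation Z p n \<omega>) x)\<^sup>2) \<partial>M) \<le> ennreal (pmf p x)"
    using nn_integral_eq_integral[OF moment(1)] by (simp add: ennreal_leI)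
qed simp

theorem empirical_fluctuation_converges:
  assumes gaussian_Y: "gaussian_process N Y 0 C" and C_covariance: "\<And>u v. C u \<bullet> v = pmf_covariance p u v"
  shows "converges_in_distribution M (empirical_fluctuation Z p) N Y"
proof (rule converges_in_distribution_cramer_wold)
  show prob_N: "prob_space N" and "Y \<in> borel_measurable N"
    using gaussian_Y by (simp_all add: gaussian_process_def)
  fix h
  have "distr N borel (\<lambda>\<omega>. Y \<omega> \<bullet> h) = centered_normal (pmf_covariance p h h)"
    using gaussian_Y C_covariance
    by (intro prob_space.distr_gaussian_variable[OF prob_N]) (simp_all add: gaussian_process_def)
  then show "weak_conv_m (\<lambda>n. distr M borel (\<lambda>\<omega>. empirical_fluctuation Z p n \<omega> \<bullet> h))
      (distr N borel (\<lambda>\<omega>. Y \<omega> \<bullet> h))"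
    unfolding empirical_fluctuation_inner
    using central_limit_theorem_centered[OF indep_vars_deviation deviation_mean deviation_square_integrable
      deviation_square distr_deviation] by simp
qed (auto intro: prob_space_axioms measurable_empirical_fluctuation empirical_fluctuation_tight)

end

section \<open>Isotonic regression as a projection\<close>

lemma the_arg_min_ell2_eq_metric_projection:
  assumes "closed S" "convex S" "S \<noteq> {}"
  shows "(THE \<xi>. is_arg_min (\<lambda>\<xi>. \<Sum>\<^sub>\<infinity>x. (ell2_nth \<xi> x - ell2_nth a x)\<^sup>2) (\<lambda>\<xi>. \<xi> \<in> S) \<xi>) = metric_projection S a"
proof -
  have "(\<Sum>\<^sub>\<infinity>x. (ell2_nth \<xi> x - ell2_nth a x)\<^sup>2) = (norm (\<xi> - a))\<^sup>2" for \<xi>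
    unfolding norm_sq_ell2 by (simp add: minus_ell2.rep_eq)
  then show ?thesis by (simp add: is_arg_min_norm_sq_iff[OF assms])
qed

definition antitone_cone :: "('a \<times> 'a) set \<Rightarrow> 'a ell2 set" where
  "antitone_cone E = {\<xi>. \<forall>(x, y)\<in>E. ell2_nth \<xi> y \<le> ell2_nth \<xi> x}"

lemma closed_antitone_cone: "closed (antitone_cone E)"
proof -
  have "antitone_cone E = (\<Inter>(x, y)\<in>E. {\<xi>. \<xi> \<bullet> ell2_basis y \<le> \<xi> \<bullet> ell2_basis x})"
    by (auto simp: antitone_cone_def inner_ell2_basis)
  then show ?thesis by (auto intro!: closed_INT closed_Collect_le continuous_intros)
qed

lemma convex_antitone_cone: "convex (antitone_cone E)"
proof (rule convexI)
  fix \<xi> \<zeta> :: "'a ell2" and u v :: real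
  assume "\<xi> \<in> antitone_cone E" "\<zeta> \<in> antitone_cone E" "0 \<le> u" "0 \<le> v"
  then show "u *\<^sub>R \<xi> + v *\<^sub>R \<zeta> \<in> antitone_cone E"
    by (auto simp: antitone_cone_def ell2_nth_simps intro!: add_mono mult_left_mono)
qed

lemma antitone_cone_nonempty: "antitone_cone E \<noteq> {}"
  by (auto simp: antitone_cone_def ell2_nth_simps intro: exI[of _ 0])

lemma antitonic_ell2_eq: "antitonic_ell2 = antitone_cone {(x, y). x \<le> y}"
  by (auto simp: antitonic_ell2_def antitone_cone_def antimono_def)

lemma antitonic_ell2_closed_convex:
  "closed antitonic_ell2" "convex antitonic_ell2" "antitonic_ell2 \<noteq> {}"
  unfolding antitonic_ell2_eq by (rule closed_antitone_cone convex_antitone_cone antitone_cone_nonempty)+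

definition level_cone :: "('a::order \<Rightarrow> real) \<Rightarrow> 'a ell2 set" where
  "level_cone p = antitone_cone {(x, y). x \<le> y \<and> p x = p y}"

lemma level_cone_closed_convex:
  "closed (level_cone p)" "convex (level_cone p)" "level_cone p \<noteq> {}"
  unfolding level_cone_def by (rule closed_antitone_cone convex_antitone_cone antitone_cone_nonempty)+

lemma level_cone_iff: "\<xi> \<in> level_cone p \<longleftrightarrow> (\<forall>x y. x \<le> y \<longrightarrow> p x = p y \<longrightarrow> ell2_nth \<xi> y \<le> ell2_nth \<xi> x)"
  by (auto simp: level_cone_def antitone_cone_def)

lemma comparable_level_set_value:
  assumes "y \<in> comparable_level_set le p x" shows "p y = p x"
  using assms unfolding comparable_level_set_def mem_Collect_eq by (induction rule: rtrancl_induct) auto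

lemma comparable_level_set_step:
  assumes "u \<in> comparable_level_set le p x" "p v = p u" "comparable le u v"
  shows "v \<in> comparable_level_set le p x"
proof -
  have "p u = p x" by (rule comparable_level_set_value[OF assms(1)])
  then show ?thesis using assms unfolding comparable_level_set_def by (auto intro: rtrancl_into_rtrancl)
qed

lemma square_summable_override_on:
  fixes g :: "'a \<Rightarrow> real"
  assumes "(\<lambda>y. (g y)\<^sup>2) summable_on A"
  shows "(\<lambda>y. (override_on (ell2_nth z) g A y)\<^sup>2) summable_on UNIV"
proof -
  have "(\<lambda>y. (override_on (ell2_nth z) g A y)\<^sup>2) summable_on A"
    using assms by (simp cong: summable_on_cong)
  moreover have "(\<lambda>y. (ell2_nth z y)\<^sup>2) summable_on - A"
    by (rule summable_on_subset_banach[OF square_summable_ell2_nth]) simp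
  then have "(\<lambda>y. (override_on (ell2_nth z) g A y)\<^sup>2) summable_on - A"
    by (rule summable_on_cong[THEN iffD1, rotated]) simp
  ultimately have "(\<lambda>y. (override_on (ell2_nth z) g A y)\<^sup>2) summable_on A \<union> - A"
    by (intro summable_on_Un_disjoint) auto
  then show ?thesis by simp
qed

lemma level_cone_override_on:
  fixes p :: "'a::order \<Rightarrow> real"
  defines "A x \<equiv> comparable_level_set (\<ge>) p x"
  assumes z_in_cone: "z \<in> level_cone p" and square_summable: "(\<lambda>y. (g y)\<^sup>2) summable_on A x"
    and g_antitone: "monotone_on (A x) (\<ge>) (\<le>) g"
  shows "\<exists>\<xi>\<in>level_cone p. ell2_nth \<xi> = override_on (ell2_nth z) g (A x)"
proof (rule bexI)
  define \<xi> where "\<xi> = Abs_ell2 (override_on (ell2_nth z) g (A x))"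
  show nth: "ell2_nth \<xi> = override_on (ell2_nth z) g (A x)"
    unfolding \<xi>_def by (rule Abs_ell2_inverse) (simp add: square_summable_override_on[OF square_summable])
  show "\<xi> \<in> level_cone p"
    unfolding level_cone_iff nth
  proof (intro allI impI)
    fix u v assume uv_level: "u \<le> v" "p u = p v"
    have "u \<in> A x \<longleftrightarrow> v \<in> A x"
      using uv_level comparable_level_set_step[of u "(\<ge>)" p x v] comparable_level_set_step[of v "(\<ge>)" p x u]
      by (auto simp: A_def comparable_def)
    moreover have "g v \<le> g u" if "u \<in> A x" "v \<in> A x"
      using g_antitone uv_level(1) that by (auto simp: monotone_on_def)
    moreover have "ell2_nth z v \<le> ell2_nth z u" using z_in_cone uv_level by (auto simp: level_cone_iff)
    ultimately show "override_on (ell2_nth z) g (A x) v \<le> override_on (ell2_nth z) g (A x) u"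
      by (auto simp: override_on_def)
  qed
qed

definition regression_loss :: "'a set \<Rightarrow> ('a \<Rightarrow> real) \<Rightarrow> ('a \<Rightarrow> real) \<Rightarrow> real" where
  "regression_loss A \<theta> f = (\<Sum>\<^sub>\<infinity>x\<in>A. (f x - \<theta> x)\<^sup>2)"

lemma regression_loss_cong: "(\<And>x. x \<in> A \<Longrightarrow> f x = g x) \<Longrightarrow> regression_loss A \<theta> f = regression_loss A \<theta> g"
  unfolding regression_loss_def by (intro infsum_cong) simp

lemma dist_sq_eq_regression_loss:
  "(dist \<theta> f)\<^sup>2
    = regression_loss A (ell2_nth \<theta>) (ell2_nth f) + regression_loss (- A) (ell2_nth \<theta>) (ell2_nth f)"
proof -
  have "(dist \<theta> f)\<^sup>2 = (\<Sum>\<^sub>\<infinity>y\<in>A \<union> - A. (ell2_nth (f - \<theta>) y)\<^sup>2)"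
    by (simp add: dist_norm norm_minus_commute[of \<theta>] norm_sq_ell2)
  also have "\<dots> = (\<Sum>\<^sub>\<infinity>y\<in>A. (ell2_nth (f - \<theta>) y)\<^sup>2) + (\<Sum>\<^sub>\<infinity>y\<in>- A. (ell2_nth (f - \<theta>) y)\<^sup>2)"
    by (intro infsum_Un_disjoint summable_on_subset_banach[OF square_summable_ell2_nth]) auto
  finally show ?thesis by (simp add: regression_loss_def minus_ell2.rep_eq)
qed

text \<open>A competitor on one comparable level set is glued with the global projection off that set:
  no constraint of the level cone links the set with its complement.\<close>

lemma metric_projection_level_cone_optimal_on_level_set:
  fixes p :: "'a::order \<Rightarrow> real" and \<theta> :: "'a ell2"
  defines "z \<equiv> metric_projection (level_cone p) \<theta>" and "A x \<equiv> comparable_level_set (\<ge>) p x"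
  assumes square_summable: "(\<lambda>y. (g y)\<^sup>2) summable_on A x" and g_antitone: "monotone_on (A x) (\<ge>) (\<le>) g"
  shows "regression_loss (A x) (ell2_nth \<theta>) (ell2_nth z) \<le> regression_loss (A x) (ell2_nth \<theta>) g"
    and "regression_loss (A x) (ell2_nth \<theta>) g \<le> regression_loss (A x) (ell2_nth \<theta>) (ell2_nth z) \<Longrightarrow>
      y \<in> A x \<Longrightarrow> g y = ell2_nth z y"
proof -
  let ?J = "\<lambda>A f. regression_loss A (ell2_nth \<theta>) f"
  have z_in_cone: "z \<in> level_cone p"
    unfolding z_def by (rule metric_projection_in[OF level_cone_closed_convex])
  obtain \<xi> where \<xi>_glued: "\<xi> \<in> level_cone p" "ell2_nth \<xi> = override_on (ell2_nth z) g (A x)"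
    using level_cone_override_on[OF z_in_cone, of g x] square_summable g_antitone unfolding A_def by blast
  have "?J (A x) (ell2_nth \<xi>) = ?J (A x) g" "?J (- A x) (ell2_nth \<xi>) = ?J (- A x) (ell2_nth z)"
    unfolding \<xi>_glued(2) by (rule regression_loss_cong, simp)+
  then have "(dist \<theta> \<xi>)\<^sup>2 - (dist \<theta> z)\<^sup>2 = ?J (A x) g - ?J (A x) (ell2_nth z)"
    by (simp add: dist_sq_eq_regression_loss[of \<theta> _ "A x"])
  then have near: "(dist \<xi> z)\<^sup>2 \<le> ?J (A x) g - ?J (A x) (ell2_nth z)"
    using metric_projection_pythagoras[OF level_cone_closed_convex \<xi>_glued(1), of \<theta>] by (simp add: z_def)
  then show "?J (A x) (ell2_nth z) \<le> ?J (A x) g" using zero_le_power2[of "dist \<xi> z"] by linarith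
  assume "?J (A x) g \<le> ?J (A x) (ell2_nth z)" "y \<in> A x"
  then have "(dist \<xi> z)\<^sup>2 \<le> 0" using near by linarith
  then have "override_on (ell2_nth z) g (A x) = ell2_nth z" using \<xi>_glued(2) by simp
  then show "g y = ell2_nth z y" using \<open>y \<in> A x\<close> by (metis override_on_apply_in)
qed

lemma isotonic_regression_comparable_level_set:
  fixes p :: "'a::order \<Rightarrow> real" and \<theta> :: "'a ell2"
  shows "isotonic_regression (\<ge>) (comparable_level_set (\<ge>) p x) (ell2_nth \<theta>) =
    restrict (ell2_nth (metric_projection (level_cone p) \<theta>)) (comparable_level_set (\<ge>) p x)"
proof -
  define A where "A = comparable_level_set (\<ge>) p x"
  define z where "z = metric_projection (level_cone p) \<theta>"
  define J where "J = regression_loss A (ell2_nth \<theta>)"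
  define P where "P f \<longleftrightarrow> f \<in> extensional A \<and> (\<lambda>x. (f x)\<^sup>2) summable_on A \<and> monotone_on A (\<ge>) (\<le>) f"
    for f :: "'a \<Rightarrow> real"
  have z_in_cone: "z \<in> level_cone p"
    unfolding z_def by (rule metric_projection_in[OF level_cone_closed_convex])
  have J_z: "J (restrict (ell2_nth z) A) = J (ell2_nth z)"
    unfolding J_def by (rule regression_loss_cong) simp
  have P_z: "P (restrict (ell2_nth z) A)"
    unfolding P_def
  proof (intro conjI)
    have "(\<lambda>x. (ell2_nth z x)\<^sup>2) summable_on A"
      by (rule summable_on_subset_banach[OF square_summable_ell2_nth]) simp
    then show "(\<lambda>x. (restrict (ell2_nth z) A x)\<^sup>2) summable_on A" by (simp cong: summable_on_cong)
    show "monotone_on A (\<ge>) (\<le>) (restrict (ell2_nth z) A)"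
      using z_in_cone comparable_level_set_value[of _ "(\<ge>)" p x]
      by (auto simp: monotone_on_def A_def level_cone_iff)
  qed simp
  have "isotonic_regression (\<ge>) A (ell2_nth \<theta>) = (THE f. is_arg_min J P f)"
    unfolding isotonic_regression_def J_def regression_loss_def[abs_def] P_def[abs_def] ..
  also have "\<dots> = restrict (ell2_nth z) A"
  proof (rule the_equality)
    have "J (ell2_nth z) \<le> J g" if "P g" for g
      using metric_projection_level_cone_optimal_on_level_set(1)[of g p x \<theta>] that
      by (simp add: P_def J_def A_def z_def)
    then show "is_arg_min J P (restrict (ell2_nth z) A)"
      using P_z by (simp add: is_arg_min_def J_z not_less)
    fix g assume "is_arg_min J P g"
    then have "P g" "J g \<le> J (ell2_nth z)" using P_z by (auto simp: is_arg_min_def J_z not_less)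
    then have "g y = ell2_nth z y" if "y \<in> A" for y
      using metric_projection_level_cone_optimal_on_level_set(2)[of g p x \<theta> y] that
      by (simp add: P_def J_def A_def z_def)
    then show "g = restrict (ell2_nth z) A"
      using \<open>P g\<close> by (intro extensionalityI[of _ A]) (simp_all add: P_def)
  qed
  finally show ?thesis by (simp add: A_def z_def)
qed

lemma level_set_regression_eq_metric_projection:
  fixes p :: "'a::order \<Rightarrow> real"
  shows "level_set_regression (\<ge>) p \<theta> = metric_projection (level_cone p) \<theta>"
proof -
  have "x \<in> comparable_level_set (\<ge>) p x" for x by (simp add: comparable_level_set_def)
  then show ?thesis
    unfolding level_set_regression_def isotonic_regression_comparable_level_set
    by (simp add: ell2_nth_inverse)
qed

section \<open>The tangent cone of the antitonic functions\<close>

lemma eventually_le_finite_positive: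
  fixes V :: "real set"
  assumes "finite V" "\<And>v. v \<in> V \<Longrightarrow> 0 < v"
  shows "\<forall>\<^sub>F d in at_right 0. \<forall>v\<in>V. d \<le> v"
proof (rule eventually_ball_finite[OF assms(1)], rule ballI)
  fix v assume "v \<in> V"
  then show "\<forall>\<^sub>F d in at_right 0. d \<le> v"
    using assms(2) by (auto simp: eventually_at_right_field intro!: exI[of _ v])
qed

lemma eventually_gap_below:
  fixes p :: "'a ell2"
  assumes nonneg: "\<And>y. 0 \<le> ell2_nth p y"
  shows "\<forall>\<^sub>F d in at_right 0. \<forall>y. ell2_nth p y < ell2_nth p x \<longrightarrow> d \<le> ell2_nth p x - ell2_nth p y"
proof (cases "ell2_nth p x = 0")
  case True
  then have "\<not> ell2_nth p y < ell2_nth p x" for y using nonneg[of y] by simp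
  then show ?thesis by simp
next
  case False
  define c where "c = ell2_nth p x"
  have c_pos: "0 < c" using False nonneg[of x] by (simp add: c_def)
  define V where
    "V = insert (c / 2) ((\<lambda>y. c - ell2_nth p y) ` {y. c / 2 \<le> \<bar>ell2_nth p y\<bar> \<and> ell2_nth p y < c})"
  have "finite {y. c / 2 \<le> \<bar>ell2_nth p y\<bar>}" using c_pos by (intro finite_ell2_superlevel) simp
  then have "finite V" unfolding V_def by simp
  then have "\<forall>\<^sub>F d in at_right 0. \<forall>v\<in>V. d \<le> v"
    by (rule eventually_le_finite_positive) (use c_pos in \<open>auto simp: V_def\<close>)
  then have "\<forall>\<^sub>F d in at_right 0. \<forall>y. ell2_nth p y < c \<longrightarrow> d \<le> c - ell2_nth p y"
  proof eventually_elim
    case (elim d)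
    show ?case
    proof (intro allI impI)
      fix y assume y_below: "ell2_nth p y < c"
      show "d \<le> c - ell2_nth p y"
      proof (cases "c / 2 \<le> ell2_nth p y")
        case True
        then have "c - ell2_nth p y \<in> V" using y_below by (auto simp: V_def)
        then show ?thesis using elim by blast
      next
        case False
        have "d \<le> c / 2" using elim by (simp add: V_def)
        then show ?thesis using False by linarith
      qed
    qed
  qed
  then show ?thesis by (simp add: c_def)
qed

lemma eventually_gap_above:
  fixes p :: "'a::order ell2"
  assumes "finite {..y}"
  shows "\<forall>\<^sub>F d in at_right 0. \<forall>x\<le>y. ell2_nth p y < ell2_nth p x \<longrightarrow> d \<le> ell2_nth p x - ell2_nth p y"
proof -
  define V where "V = (\<lambda>x. ell2_nth p x - ell2_nth p y) ` {x. x \<le> y \<and> ell2_nth p y < ell2_nth p x}"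
  have "finite V" unfolding V_def using assms by (intro finite_imageI) (simp add: atMost_def)
  then have "\<forall>\<^sub>F d in at_right 0. \<forall>v\<in>V. d \<le> v"
    by (rule eventually_le_finite_positive) (auto simp: V_def)
  then show ?thesis by eventually_elim (auto simp: V_def)
qed

lemma ell2_nonneg_if_antitone_above:
  fixes \<xi> :: "'a::order ell2"
  assumes "infinite {x..}" and antitone: "\<And>y. x \<le> y \<Longrightarrow> ell2_nth \<xi> y \<le> ell2_nth \<xi> x"
  shows "0 \<le> ell2_nth \<xi> x"
proof (rule ccontr)
  assume neg: "\<not> 0 \<le> ell2_nth \<xi> x"
  then have "{x..} \<subseteq> {y. - ell2_nth \<xi> x \<le> \<bar>ell2_nth \<xi> y\<bar>}" using antitone by fastforce
  moreover have "finite {y. - ell2_nth \<xi> x \<le> \<bar>ell2_nth \<xi> y\<bar>}"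
    using neg by (intro finite_ell2_superlevel) simp
  ultimately show False using assms(1) finite_subset by blast
qed

lemma feasible_directions_antitonic_subset: "feasible_directions antitonic_ell2 p \<subseteq> level_cone (ell2_nth p)"
proof
  fix \<eta> assume "\<eta> \<in> feasible_directions antitonic_ell2 p"
  then obtain t where t_feasible: "0 < t" "p + t *\<^sub>R \<eta> \<in> antitonic_ell2"
    by (auto simp: feasible_directions_def)
  show "\<eta> \<in> level_cone (ell2_nth p)"
    unfolding level_cone_iff
  proof (intro allI impI)
    fix x y assume "x \<le> y" "ell2_nth p x = ell2_nth p y"
    then have "t * ell2_nth \<eta> y \<le> t * ell2_nth \<eta> x"
      using antimonoD[of "ell2_nth (p + t *\<^sub>R \<eta>)" x y] t_feasible(2)
      by (simp add: antitonic_ell2_def ell2_nth_simps)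
    then show "ell2_nth \<eta> y \<le> ell2_nth \<eta> x" using t_feasible(1) by simp
  qed
qed

text \<open>Positive level sets are finite and elements of the level cone are nonnegative where \<open>p\<close> vanishes,
  so that truncation to the following sets stays in the level cone.\<close>

definition level_hull :: "'a::order ell2 \<Rightarrow> 'a set \<Rightarrow> 'a set" where
  "level_hull p F = {x. \<exists>y\<in>F. 0 < ell2_nth p y \<and> ell2_nth p y \<le> ell2_nth p x}
    \<union> {x. ell2_nth p x = 0 \<and> (\<exists>y\<in>F. x \<le> y)}"

context
  fixes p :: "'a::order ell2"
  assumes finite_below: "\<And>x :: 'a. finite {..x}" and infinite_above: "\<And>x :: 'a. infinite {x..}"
    and antitonic: "p \<in> antitonic_ell2"
begin

lemma antitonic_ell2_nonneg: "0 \<le> ell2_nth p x"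
  using infinite_above antitonic
  by (intro ell2_nonneg_if_antitone_above) (auto simp: antitonic_ell2_def antimono_def)

lemma level_cone_nonneg:
  assumes \<xi>_in_cone: "\<xi> \<in> level_cone (ell2_nth p)" and p_x_eq_0: "ell2_nth p x = 0"
  shows "0 \<le> ell2_nth \<xi> x"
proof (rule ell2_nonneg_if_antitone_above[OF infinite_above])
  fix y assume "x \<le> y"
  then have "ell2_nth p y \<le> ell2_nth p x" using antitonic by (auto simp: antitonic_ell2_def antimono_def)
  then have "ell2_nth p x = ell2_nth p y" using p_x_eq_0 antitonic_ell2_nonneg[of y] by simp
  then show "ell2_nth \<xi> y \<le> ell2_nth \<xi> x" using \<xi>_in_cone \<open>x \<le> y\<close> by (auto simp: level_cone_iff)
qed

text \<open>Only finitely many gaps between values of \<open>p\<close> involve the support of the direction, so that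
  the strict inequalities of \<open>p\<close> survive a small perturbation.\<close>

lemma finite_support_level_cone_feasible:
  assumes \<eta>_in_cone: "\<eta> \<in> level_cone (ell2_nth p)" and finite_F: "finite F"
    and supp: "\<And>x. x \<notin> F \<Longrightarrow> ell2_nth \<eta> x = 0"
  shows "\<eta> \<in> feasible_directions antitonic_ell2 p"
proof -
  have "\<forall>\<^sub>F d in at_right 0. 0 < d \<and>
      (\<forall>x\<in>F. \<forall>y. ell2_nth p y < ell2_nth p x \<longrightarrow> d \<le> ell2_nth p x - ell2_nth p y) \<and>
      (\<forall>y\<in>F. \<forall>x\<le>y. ell2_nth p y < ell2_nth p x \<longrightarrow> d \<le> ell2_nth p x - ell2_nth p y)"
    by (intro eventually_conj eventually_at_right_less eventually_ball_finite[OF finite_F] ballI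
        eventually_gap_below antitonic_ell2_nonneg eventually_gap_above finite_below)
  from eventually_happens'[OF trivial_limit_at_right_real this] obtain d where d_pos: "0 < d"
    and below: "\<forall>x\<in>F. \<forall>y. ell2_nth p y < ell2_nth p x \<longrightarrow> d \<le> ell2_nth p x - ell2_nth p y"
    and above: "\<forall>y\<in>F. \<forall>x\<le>y. ell2_nth p y < ell2_nth p x \<longrightarrow> d \<le> ell2_nth p x - ell2_nth p y"
    by (elim exE conjE) (rule that)
  define t where "t = d / (2 * norm \<eta> + 1)"
  have "0 < 2 * norm \<eta> + 1" by (simp add: add_nonneg_pos)
  then have t_small: "0 < t" "t * (2 * norm \<eta> + 1) = d" using d_pos unfolding t_def by simp_all
  have "ell2_nth p y + t * ell2_nth \<eta> y \<le> ell2_nth p x + t * ell2_nth \<eta> x" if x_le_y: "x \<le> y" for x y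
  proof -
    have "ell2_nth p y \<le> ell2_nth p x"
      using antitonic x_le_y by (auto simp: antitonic_ell2_def antimono_def)
    then consider (level) "ell2_nth p x = ell2_nth p y" | (off) "ell2_nth p y < ell2_nth p x" "x \<notin> F" "y \<notin> F"
      | (gap) "ell2_nth p y < ell2_nth p x" "x \<in> F \<or> y \<in> F" by force
    then show ?thesis
    proof cases
      case level
      then show ?thesis using \<eta>_in_cone x_le_y t_small(1) by (auto simp: level_cone_iff)
    next
      case off
      then show ?thesis by (simp add: supp)
    next
      case gap
      have "t * (ell2_nth \<eta> y - ell2_nth \<eta> x) \<le> t * (2 * norm \<eta>)"
        using t_small(1) abs_ell2_nth_le_norm[of \<eta> x] abs_ell2_nth_le_norm[of \<eta> y]
        by (intro mult_left_mono) auto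
      also have "\<dots> \<le> d" using t_small by (simp add: distrib_left)
      also have "d \<le> ell2_nth p x - ell2_nth p y" using gap x_le_y below above by blast
      finally show ?thesis by (simp add: right_diff_distrib)
    qed
  qed
  then have "p + t *\<^sub>R \<eta> \<in> antitonic_ell2" by (auto simp: antitonic_ell2_def antimono_def ell2_nth_simps)
  with t_small(1) show ?thesis by (auto simp: feasible_directions_def)
qed

lemma finite_level_hull:
  assumes "finite F"
  shows "finite (level_hull p F)"
proof (rule finite_subset)
  show "level_hull p F \<subseteq> (\<Union>y\<in>F \<inter> {y. 0 < ell2_nth p y}. {x. ell2_nth p y \<le> \<bar>ell2_nth p x\<bar>}) \<union> (\<Union>y\<in>F. {..y})"
    by (auto simp: level_hull_def)
  show "finite \<dots>" using assms by (auto intro!: finite_UN_I finite_ell2_superlevel finite_below)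
qed

lemma subset_level_hull: "F \<subseteq> level_hull p F"
  using antitonic_ell2_nonneg by (auto simp: level_hull_def order.order_iff_strict)

lemma ell2_restrict_level_hull:
  assumes \<xi>_in_cone: "\<xi> \<in> level_cone (ell2_nth p)"
  shows "ell2_restrict (level_hull p F) \<xi> \<in> level_cone (ell2_nth p)"
  unfolding level_cone_iff
proof (intro allI impI)
  fix x y assume xy_level: "x \<le> y" "ell2_nth p x = ell2_nth p y"
  have mono: "ell2_nth \<xi> y \<le> ell2_nth \<xi> x" using \<xi>_in_cone xy_level by (auto simp: level_cone_iff)
  show "ell2_nth (ell2_restrict (level_hull p F) \<xi>) y \<le> ell2_nth (ell2_restrict (level_hull p F) \<xi>) x"
  proof (cases "ell2_nth p x = 0")
    case True
    have "x \<in> level_hull p F" if "y \<in> level_hull p F"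
      using that True xy_level by (auto simp: level_hull_def intro: order_trans)
    then show ?thesis using mono level_cone_nonneg[OF \<xi>_in_cone True] by (auto simp: ell2_nth_simps)
  next
    case False
    then have "x \<in> level_hull p F \<longleftrightarrow> y \<in> level_hull p F" using xy_level(2) by (auto simp: level_hull_def)
    then show ?thesis using mono by (auto simp: ell2_nth_simps)
  qed
qed

theorem tangent_cone_antitonic_ell2: "tangent_cone antitonic_ell2 p = level_cone (ell2_nth p)"
  unfolding tangent_cone_def
proof (rule antisym)
  show "closure (feasible_directions antitonic_ell2 p) \<subseteq> level_cone (ell2_nth p)"
    by (intro closure_minimal feasible_directions_antitonic_subset level_cone_closed_convex(1))
  show "level_cone (ell2_nth p) \<subseteq> closure (feasible_directions antitonic_ell2 p)"
  proof (clarsimp simp: closure_approachable)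
    fix \<xi> and e :: real assume \<xi>_in_cone: "\<xi> \<in> level_cone (ell2_nth p)" and "0 < e"
    then obtain F where F_approx: "finite F" "\<forall>G. finite G \<and> F \<subseteq> G \<longrightarrow> dist (ell2_restrict G \<xi>) \<xi> < e"
      using ell2_restrict_approx[of e \<xi>] by blast
    have "ell2_restrict (level_hull p F) \<xi> \<in> feasible_directions antitonic_ell2 p"
      using ell2_restrict_level_hull[OF \<xi>_in_cone] finite_level_hull[OF F_approx(1)]
      by (rule finite_support_level_cone_feasible) (simp add: ell2_nth_simps)
    then show "\<exists>\<eta>\<in>feasible_directions antitonic_ell2 p. dist \<eta> \<xi> < e"
      using F_approx(2) finite_level_hull[OF F_approx(1)] subset_level_hull by blast
  qed
qed

end

section \<open>The antitonic estimator\<close>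

lemma antitonic_estimator_eq_metric_projection:
  "antitonic_estimator Z n \<omega> = metric_projection antitonic_ell2 (empirical_ell2 Z n \<omega>)"
  unfolding antitonic_estimator_def ell2_nth_empirical_ell2[symmetric]
  by (rule the_arg_min_ell2_eq_metric_projection[OF antitonic_ell2_closed_convex])

lemma antitonic_estimator_eq_projection_quotient:
  "sqrt (real n) *\<^sub>R (antitonic_estimator Z n \<omega> - ell2_of_pmf p)
    = projection_quotient antitonic_ell2 (ell2_of_pmf p) (inverse (sqrt (real n)))
        (empirical_fluctuation Z p n \<omega>)"
  by (cases "n = 0")
    (simp_all add: projection_quotient_def antitonic_estimator_eq_metric_projection empirical_fluctuation_def)

lemma inverse_sqrt_at_right_0: "filterlim (\<lambda>n. inverse (sqrt (real n))) (at_right 0) sequentially"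
  by (rule filterlim_compose[OF filterlim_inverse_at_right_top
        filterlim_compose[OF sqrt_at_top filterlim_real_sequentially]])

theorem antitonic_estimator_converges:
  fixes p :: "'a::{order, countable} pmf"
  assumes sample: "iid_sample M Z p" and p_antitone: "antimono (pmf p)"
    and order: "\<And>x :: 'a. finite {..x}" "\<And>x :: 'a. infinite {x..}"
    and gaussian_Y: "gaussian_process N Y 0 C" and C_covariance: "\<And>u v. C u \<bullet> v = pmf_covariance p u v"
  shows "converges_in_distribution M (\<lambda>n \<omega>. sqrt (real n) *\<^sub>R (antitonic_estimator Z n \<omega> - ell2_of_pmf p))
    N (\<lambda>\<omega>. level_set_regression (\<ge>) (pmf p) (Y \<omega>))"
proof -
  interpret iid_sample M Z p by fact
  define t where "t n = inverse (sqrt (real n))" for n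
  define Q where "Q n = projection_quotient antitonic_ell2 (ell2_of_pmf p) (t n)" for n
  define P where "P = metric_projection (level_cone (pmf p))"
  note F_closed_convex = antitonic_ell2_closed_convex(1,2)
  have p_in: "ell2_of_pmf p \<in> antitonic_ell2"
    using p_antitone by (simp add: antitonic_ell2_def ell2_of_pmf.rep_eq)
  have nonexpansive: "dist (Q n \<theta>) (Q n \<theta>') \<le> dist \<theta> \<theta>'" for n \<theta> \<theta>'
    unfolding Q_def t_def by (intro projection_quotient_nonexpansive F_closed_convex p_in) simp
  have "tangent_cone antitonic_ell2 (ell2_of_pmf p) = level_cone (pmf p)"
    using tangent_cone_antitonic_ell2[OF order p_in] by (simp add: ell2_of_pmf.rep_eq)
  then have "(\<lambda>n. Q n \<theta>) \<longlonglongrightarrow> P \<theta>" for \<theta>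
    using filterlim_compose[OF projection_quotient_tendsto[OF F_closed_convex p_in] inverse_sqrt_at_right_0]
    by (simp add: Q_def P_def t_def)
  then have lim: "((\<lambda>(n, y). Q n y) \<longlongrightarrow> P \<theta>) (sequentially \<times>\<^sub>F nhds \<theta>)" for \<theta>
    by (rule nonexpansive_tendsto_prod[OF nonexpansive])
  have "converges_in_distribution M (\<lambda>n \<omega>. Q n (empirical_fluctuation Z p n \<omega>)) N (\<lambda>\<omega>. P (Y \<omega>))"
    using prob_space_axioms empirical_fluctuation_tight empirical_fluctuation_converges[OF gaussian_Y C_covariance] _ _ lim
  proof (rule converges_in_distribution_extended_mapping)
    show "continuous_on UNIV (Q n)" for n
      by (rule lipschitz_on_continuous_on, rule lipschitz_onI[of _ _ 1]) (simp_all add: nonexpansive)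
    show "continuous_on UNIV P"
      unfolding P_def by (rule continuous_on_metric_projection[OF level_cone_closed_convex])
  qed
  then show ?thesis
    by (simp add: antitonic_estimator_eq_projection_quotient level_set_regression_eq_metric_projection
        Q_def P_def t_def)
qed

section \<open>The grid\<close>

instance grid :: countable
proof (rule countable_classI[of "\<lambda>x. to_nat (coords x)"])
  show "x = y" if "to_nat (coords x) = to_nat (coords y)" for x y
    using that by (simp add: coords_inject)
qed

lemma infinite_atLeast_grid: "infinite {x::grid..}"
proof
  assume fin: "finite {x::grid..}"
  define f where "f n = Abs_grid (fst (coords x) + n, snd (coords x))" for n
  have coords_f: "coords (f n) = (fst (coords x) + n, snd (coords x))" for n
    using coords[of x] unfolding f_def by (intro Abs_grid_inverse) (auto split: prod.splits)
  have "inj f" by (rule injI) (metis Pair_inject add_left_cancel coords_f)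
  moreover have "range f \<subseteq> {x..}" by (auto simp: less_eq_grid_def coords_f)
  ultimately show False using finite_subset[OF _ fin] by (meson finite_imageD infinite_UNIV_nat)
qed

lemma finite_atMost_grid: "finite {..x::grid}"
proof (rule inj_on_finite[of coords])
  show "coords ` {..x} \<subseteq> {..fst (coords x)} \<times> {..snd (coords x)}"
    by (simp add: image_subset_iff less_eq_grid_def mem_Times_iff)
qed (auto simp: inj_on_def coords_inject)

theorem theorem6:
  fixes M :: "'w measure"
    and Z :: "nat \<Rightarrow> 'w \<Rightarrow> grid"
    and p :: "grid pmf"
    and C :: "grid ell2 \<Rightarrow> grid ell2"
  assumes "prob_space M"
    and "prob_space.indep_vars M (\<lambda>_. count_space UNIV) Z {1..}"
    and "\<And>j. 1 \<le> j \<Longrightarrow> distr M (count_space UNIV) (Z j) = measure_pmf p"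
    and "antimono (pmf p)"
    and "bounded_linear C"
    and "\<And>i i'. C (ell2_basis i) \<bullet> ell2_basis i' =
           pmf p i * (if i = i' then 1 else 0) - pmf p i * pmf p i'"
  shows "(\<exists>N :: grid ell2 measure. gaussian_process N (\<lambda>y. y) 0 C) \<and>
    (\<forall>(N :: 'v measure) Y. gaussian_process N Y 0 C \<longrightarrow>
       converges_in_distribution M
         (\<lambda>n \<omega>. sqrt (real n) *\<^sub>R (antitonic_estimator Z n \<omega> - ell2_of_pmf p))
         N (\<lambda>\<omega>. level_set_regression (\<ge>) (pmf p) (Y \<omega>)))"
proof (intro conjI allI impI)
  have C_covariance: "C u \<bullet> v = pmf_covariance p u v" for u v
    by (rule covariance_operator_inner[OF assms(5,6)])
  show "\<exists>N :: grid ell2 measure. gaussian_process N (\<lambda>y. y) 0 C"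
    by (rule gaussian_process_pmf_covariance_exists[OF bounded_linear.linear[OF assms(5)] C_covariance])
  have "iid_sample M Z p" using assms(1-3) by (intro iid_sample.intro iid_sample_axioms.intro)
  then show "converges_in_distribution M
      (\<lambda>n \<omega>. sqrt (real n) *\<^sub>R (antitonic_estimator Z n \<omega> - ell2_of_pmf p))
      N (\<lambda>\<omega>. level_set_regression (\<ge>) (pmf p) (Y \<omega>))"
    if "gaussian_process N Y 0 C" for N :: "'v measure" and Y
    using antitonic_estimator_converges assms(4) finite_atMost_grid infinite_atLeast_grid that C_covariance
    by blast
qed

end
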